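(* Assume that $\psi(k)\ll k^{-(1+\delta)}$ for some $\delta>0$ (i.e. $\sup_{k\ge 1} k^{1+\delta}\psi(k)<\infty$). Then for any $f,g\in\mathcal{F}$ the two infinite series in $$C(f,g)=\mathbb{E} f(U)g(U)+\sum_{k=1}^{\infty}\mathbb{E} f(U)g(U+S_k)+\sum_{k=1}^{\infty}\mathbb{E} g(U)f(U+S_k)$$ are absolutely convergent, and $C(f,g)$ is bilinear, symmetric and positive semidefinite in $f,g\in\mathcal{F}$; moreover, $C(f,f)=0$ if and only if $f=0$ a.e. For any $f\in\mathcal{F}$, with $\sigma=\sqrt{C(f,f)}$, the sum $\sum_{k=1}^N f(S_k)$ satisfies the central limit theorem $$\frac{\sum_{k=1}^N f(S_k)}{\sqrt{N}}\overset{d}{\longrightarrow}\mathcal{N}(0,\sigma^2)\qquad (N\to\infty)$$ and the law of the iterated logarithm $$\limsup_{N\to\infty}\frac{\sum_{k=1}^N f(S_k)}{\sqrt{2N\log\log N}}=\sigma\quad\text{almost surely.}$$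
   Context: $X_1,X_2,\dots$ are independent, identically distributed real-valued random variables, $S_k=\sum_{j=1}^k X_j$, $\{\cdot\}$ denotes fractional part, and $\psi(k)=\sup_{t\in[0,1]}|\mathbb{P}(\{S_k\}\le t)-t|$. $\mathcal{F}$ is the set of all $1$-periodic functions $f:\mathbb{R}\to\mathbb{R}$ that are of bounded variation on $[0,1]$ and satisfy $\int_0^1 f(x)\,\mathrm{d}x=0$. $U$ is a random variable uniformly distributed on $[0,1)$, independent of $X_1,X_2,\dots$. If $\sigma=0$, convergence in distribution to $\mathcal{N}(0,\sigma^2)$ means convergence in distribution to the constant $0$. *)

theory Defs
  imports "HOL-Probability.Probability"
begin

definition bounded_variation_on :: "(real \<Rightarrow> real) \<Rightarrow> real \<Rightarrow> real \<Rightarrow> bool" where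
  "bounded_variation_on f a b \<longleftrightarrow>
     (\<exists>B. \<forall>n (p :: nat \<Rightarrow> real).
        mono_on {..n} p \<and> p ` {..n} \<subseteq> {a..b} \<longrightarrow>
        (\<Sum>i<n. \<bar>f (p (Suc i)) - f (p i)\<bar>) \<le> B)"

definition class_F :: "(real \<Rightarrow> real) set" where
  "class_F = {f. (\<forall>x. f (x + 1) = f x) \<and> bounded_variation_on f 0 1 \<and>
                 (f has_integral 0) {0..1}}"

text \<open>Sequences of random variables are indexed from 1; the value \<open>X 0\<close> is never used.
  The free slot makes \<open>X(0 := U)\<close> the family \<open>U, X 1, X 2, \<dots>\<close>; its mutual independence says that
  the \<open>X j\<close> with \<open>j \<ge> 1\<close> are independent and that \<open>U\<close> is independent of the whole sequence.\<close>

definition partial_sum :: "(nat \<Rightarrow> 'a \<Rightarrow> real) \<Rightarrow> nat \<Rightarrow> 'a \<Rightarrow> real" where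
  "partial_sum X k \<omega> = (\<Sum>j = 1..k. X j \<omega>)"

definition discrepancy :: "'a measure \<Rightarrow> (nat \<Rightarrow> 'a \<Rightarrow> real) \<Rightarrow> nat \<Rightarrow> real" where
  "discrepancy M X k =
     (SUP t\<in>{0..1}. \<bar>measure M {\<omega> \<in> space M. frac (partial_sum X k \<omega>) \<le> t} - t\<bar>)"

definition cross_moment ::
  "'a measure \<Rightarrow> ('a \<Rightarrow> real) \<Rightarrow> (nat \<Rightarrow> 'a \<Rightarrow> real) \<Rightarrow> (real \<Rightarrow> real) \<Rightarrow> (real \<Rightarrow> real) \<Rightarrow> nat \<Rightarrow> real"
  where
  "cross_moment M U X f g k = (LINT \<omega>|M. f (U \<omega>) * g (U \<omega> + partial_sum X k \<omega>))"

text \<open>The series run over \<open>k \<ge> 1\<close>, whence the shift by \<open>Suc\<close>.\<close>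

definition cov_form ::
  "'a measure \<Rightarrow> ('a \<Rightarrow> real) \<Rightarrow> (nat \<Rightarrow> 'a \<Rightarrow> real) \<Rightarrow> (real \<Rightarrow> real) \<Rightarrow> (real \<Rightarrow> real) \<Rightarrow> real" where
  "cov_form M U X f g =
     (LINT \<omega>|M. f (U \<omega>) * g (U \<omega>))
     + (\<Sum>k. cross_moment M U X f g (Suc k))
     + (\<Sum>k. cross_moment M U X g f (Suc k))"

text \<open>The law of mean 0 and standard deviation \<open>\<sigma>\<close>. The degenerate case is separate because
  the library's \<open>normal_density 0 0\<close> is identically 0.\<close>

definition centered_normal :: "real \<Rightarrow> real measure" where
  "centered_normal \<sigma> =
     (if \<sigma> = 0 then return borel 0 else density lborel (\<lambda>x. ennreal (normal_density 0 \<sigma> x)))"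

end

theory Submission
  imports Defs "HOL-Real_Asymp.Real_Asymp"
begin

text \<open>Write \<open>P f x = E f(x + X\<^sub>1)\<close> for the transition operator of the
  walk (\<open>step_avg\<close>). The mean of \<open>f\<close> over \<open>x + S\<^sub>k\<close>
  is \<open>P\<^sup>k f x\<close>, and Koksma's inequality (\<open>koksma\<close>) bounds its
  distance from the integral of \<open>f\<close> over a period by a constant times the variation
  of \<open>f\<close> times the discrepancy \<open>\<psi> k\<close>. Rotating a periodic function
  does not change its variation, so the bound is uniform in \<open>x\<close>
  (\<open>step_avg_pow_rate\<close>). As \<open>\<psi>\<close> is summable, all series in the
  covariance form converge absolutely, and for centred \<open>f\<close> the series \<open>a = P f
  + P\<^sup>2 f + \<dots>\<close> (\<open>corrector\<close>) converges uniformly to a bounded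
  solution of \<open>P (f + a) = a\<close>.

  Variance. With \<open>h = f + a\<close> one has \<open>C(f,f) = \<integral> f\<^sup>2 + 2 f a =
  \<integral> h\<^sup>2 - \<integral> (P h)\<^sup>2\<close>, which is the integral of the variance
  of \<open>h(x + X\<^sub>1)\<close> over \<open>x\<close>, hence nonnegative. This quantity does
  not increase when \<open>h\<close> is replaced by \<open>P h\<close>, because \<open>P\<close>
  averages translates. If it is 0 for \<open>h\<close>, it is therefore 0 for every
  \<open>P\<^sup>n h\<close>, so all \<open>P\<^sup>n h\<close> have the same norm in L2; but
  \<open>P\<^sup>n h\<close> tends to 0 uniformly, so \<open>h\<close>, \<open>a\<close> and
  \<open>f\<close> vanish almost everywhere (\<open>sigma2_zero_imp_null\<close>).

  Limit theorems. The tilted operator \<open>Q g = P (e\<^sup>z\<^sup>f g)\<close> satisfies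
  \<open>E e\<^sup>z\<^sup>S = Q\<^sup>n 1\<close> for \<open>S = f(x + S\<^sub>1) + \<dots> + f(x
  + S\<^sub>n)\<close>. For small \<open>z\<close>, real or complex, the function \<open>1 + z a +
  z\<^sup>2 b\<close> is almost an eigenfunction of it with eigenvalue \<open>1 + z\<^sup>2
  \<sigma>\<^sup>2 / 2\<close> (\<open>perturbed_eigenfunction\<close>): the terms of first order
  cancel since \<open>P (f + a) = a\<close>, those of second order cancel approximately for a
  suitable \<open>b\<close>, since \<open>f\<^sup>2 / 2 + f a\<close> is mixing with mean
  \<open>\<sigma>\<^sup>2 / 2\<close>. Imaginary \<open>z\<close> of order \<open>1 / sqrt
  n\<close> gives convergence of characteristic functions and thus, by the continuity theorem of
  Levy, the central limit theorem. Real \<open>z\<close> gives two-sided Gaussian bounds for the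
  moment generating function and a maximal inequality, uniformly in the starting point.

  The maximal inequality and the first Borel-Cantelli lemma along a geometric sequence give the
  upper half of the law of the iterated logarithm (\<open>lil_upper\<close>). For the lower half,
  tilting turns the bounds for the moment generating function into a lower bound for tail
  probabilities (\<open>tail_lower_bound\<close>). It holds from every starting point, so over
  geometric blocks of time the Markov property makes the probability of no large increment at most
  a product of factors \<open>1 - p n\<close> with divergent sum of the \<open>p n\<close>. The
  contribution of the past of a block is controlled by the upper half applied to \<open>-
  f\<close>. All this takes place on the space of increment streams; the joint law of
  \<open>U\<close> and the increments carries it over to the given probability space
  (\<open>iid_path_distr\<close>).\<close>

section \<open>Functions of bounded variation\<close>

text \<open>Measuring variation over all intervals of length 1, and not only over \<open>[0,
  1]\<close>, makes the notion invariant under translations. That is what passes a variation bound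
  through averages of translates.\<close>

definition unit_variation_le :: "real \<Rightarrow> (real \<Rightarrow> real) \<Rightarrow> bool" where
  "unit_variation_le K f \<longleftrightarrow>
     (\<forall>n (p :: nat \<Rightarrow> real). mono_on {..n} p \<and> p n \<le> p 0 + 1 \<longrightarrow>
        (\<Sum>i<n. \<bar>f (p (Suc i)) - f (p i)\<bar>) \<le> K)"

lemma unit_variation_leD:
  "unit_variation_le K f \<Longrightarrow> mono_on {..n} p \<Longrightarrow> p n \<le> p 0 + 1 \<Longrightarrow>
    (\<Sum>i<n. \<bar>f (p (Suc i)) - f (p i)\<bar>) \<le> K"
  unfolding unit_variation_le_def by blast

lemma unit_variation_le_translate:
  assumes "unit_variation_le K f" shows "unit_variation_le K (\<lambda>x. f (s + x))"
  unfolding unit_variation_le_def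
proof (intro allI impI)
  fix n and p :: "nat \<Rightarrow> real" assume "mono_on {..n} p \<and> p n \<le> p 0 + 1"
  then show "(\<Sum>i<n. \<bar>f (s + p (Suc i)) - f (s + p i)\<bar>) \<le> K"
    using unit_variation_leD[OF assms, of n "\<lambda>i. s + p i"] by (auto simp: mono_on_def)
qed

lemma unit_variation_le_diff:
  assumes "unit_variation_le K f" "x \<le> y" "y \<le> x + 1" shows "\<bar>f y - f x\<bar> \<le> K"
  using unit_variation_leD[OF assms(1), of 1 "\<lambda>i. if i = 0 then x else y"] assms(2,3)
  by (auto simp: mono_on_def)

lemma unit_variation_le_add:
  assumes f: "unit_variation_le K f" and g: "unit_variation_le L g"
  shows "unit_variation_le (K + L) (\<lambda>x. f x + g x)"
  unfolding unit_variation_le_def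
proof (intro allI impI)
  fix n and p :: "nat \<Rightarrow> real" assume p: "mono_on {..n} p \<and> p n \<le> p 0 + 1"
  have "(\<Sum>i<n. \<bar>f (p (Suc i)) + g (p (Suc i)) - (f (p i) + g (p i))\<bar>)
      \<le> (\<Sum>i<n. \<bar>f (p (Suc i)) - f (p i)\<bar> + \<bar>g (p (Suc i)) - g (p i)\<bar>)"
    by (intro sum_mono) auto
  also have "\<dots> \<le> K + L"
    using unit_variation_leD[OF f, of n p] unit_variation_leD[OF g, of n p] p
    by (simp add: sum.distrib)
  finally show "(\<Sum>i<n. \<bar>f (p (Suc i)) + g (p (Suc i)) - (f (p i) + g (p i))\<bar>) \<le> K + L" .
qed

lemma unit_variation_le_mult:
  assumes f: "unit_variation_le K f" "\<And>x. \<bar>f x\<bar> \<le> A"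
    and g: "unit_variation_le L g" "\<And>x. \<bar>g x\<bar> \<le> B"
  shows "unit_variation_le (B * K + A * L) (\<lambda>x. f x * g x)"
  unfolding unit_variation_le_def
proof (intro allI impI)
  fix n and p :: "nat \<Rightarrow> real" assume p: "mono_on {..n} p \<and> p n \<le> p 0 + 1"
  have A: "0 \<le> A" using f(2)[of 0] by linarith
  have B: "0 \<le> B" using g(2)[of 0] by linarith
  have "(\<Sum>i<n. \<bar>f (p (Suc i)) * g (p (Suc i)) - f (p i) * g (p i)\<bar>)
      \<le> (\<Sum>i<n. B * \<bar>f (p (Suc i)) - f (p i)\<bar> + A * \<bar>g (p (Suc i)) - g (p i)\<bar>)"
  proof (intro sum_mono)
    fix i
    have "f (p (Suc i)) * g (p (Suc i)) - f (p i) * g (p i)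
        = g (p (Suc i)) * (f (p (Suc i)) - f (p i)) + f (p i) * (g (p (Suc i)) - g (p i))"
      by (simp add: algebra_simps)
    also have "\<bar>\<dots>\<bar> \<le> \<bar>g (p (Suc i))\<bar> * \<bar>f (p (Suc i)) - f (p i)\<bar>
        + \<bar>f (p i)\<bar> * \<bar>g (p (Suc i)) - g (p i)\<bar>"
      by (rule order.trans[OF abs_triangle_ineq]) (simp add: abs_mult)
    also have "\<dots> \<le> B * \<bar>f (p (Suc i)) - f (p i)\<bar> + A * \<bar>g (p (Suc i)) - g (p i)\<bar>"
      using f(2) g(2) A B by (intro add_mono mult_right_mono) auto
    finally show "\<bar>f (p (Suc i)) * g (p (Suc i)) - f (p i) * g (p i)\<bar>
      \<le> B * \<bar>f (p (Suc i)) - f (p i)\<bar> + A * \<bar>g (p (Suc i)) - g (p i)\<bar>" .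
  qed
  also have "\<dots> = B * (\<Sum>i<n. \<bar>f (p (Suc i)) - f (p i)\<bar>) + A * (\<Sum>i<n. \<bar>g (p (Suc i)) - g (p i)\<bar>)"
    by (simp add: sum.distrib sum_distrib_left)
  also have "\<dots> \<le> B * K + A * L"
    using unit_variation_leD[OF f(1), of n p] unit_variation_leD[OF g(1), of n p] p A B
    by (intro add_mono mult_left_mono) auto
  finally show "(\<Sum>i<n. \<bar>f (p (Suc i)) * g (p (Suc i)) - f (p i) * g (p i)\<bar>) \<le> B * K + A * L" .
qed

text \<open>Periodicity moves an arbitrary unit interval to one that starts in \<open>[0, 1)\<close>; this one meets
  \<open>[0, 1]\<close> and its translate \<open>[1, 2]\<close>, and each of the two pieces costs at most the variation over
  a period.\<close>

lemma bounded_variation_imp_unit_variation: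
  assumes per: "\<And>x. f (x + 1) = f x" and bv: "bounded_variation_on f 0 1"
  obtains K where "unit_variation_le K f"
proof -
  from bv obtain B where B: "\<And>n p. mono_on {..n} p \<Longrightarrow> p ` {..n} \<subseteq> {0..1} \<Longrightarrow>
      (\<Sum>i<n. \<bar>f (p (Suc i)) - f (p i)\<bar>) \<le> B"
    unfolding bounded_variation_on_def by blast
  have per_nat: "f (x + real n) = f x" for x n
  proof (induction n)
    case (Suc n)
    then show ?case using per[of "x + real n"] by (simp add: ac_simps)
  qed simp
  have per_int: "f (x + of_int z) = f x" for x z
  proof (cases "z \<ge> 0")
    case True then show ?thesis using per_nat[of x "nat z"] by simp
  next
    case False then show ?thesis using per_nat[of "x + of_int z" "nat (-z)"] by simp
  qed
  have "(\<Sum>i<n. \<bar>f (p (Suc i)) - f (p i)\<bar>) \<le> 2 * B"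
    if p: "mono_on {..n} p" "p n \<le> p 0 + 1" for n p
  proof -
    define z where "z = \<lfloor>p 0\<rfloor>"
    define u where "u i = p i - of_int z" for i
    have u01: "0 \<le> u 0" "u 0 < 1" unfolding u_def z_def by linarith+
    have um: "u i \<le> u j" if "i \<le> j" "j \<le> n" for i j
      using p(1) that by (auto simp: u_def mono_on_def)
    have ur: "0 \<le> u i \<and> u i \<le> 2" if "i \<le> n" for i
      using um[of 0 i] um[of i n] u01 p(2) that by (auto simp: u_def)
    have fu: "f (p i) = f (u i)" for i using per_int[of "u i" z] by (simp add: u_def)
    \<comment> \<open>\<open>q\<close> stays in \<open>[0, 1]\<close> and \<open>r\<close> in the
      part beyond 1, moved back by a period; at each step at least one of them is constant, except
      where the partition crosses 1.\<close>
    define q where "q i = min (u i) 1" for i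
    define r where "r i = max (u i) 1 - 1" for i
    have "(\<Sum>i<n. \<bar>f (p (Suc i)) - f (p i)\<bar>)
        \<le> (\<Sum>i<n. \<bar>f (q (Suc i)) - f (q i)\<bar> + \<bar>f (r (Suc i)) - f (r i)\<bar>)"
    proof (intro sum_mono)
      fix i assume "i \<in> {..<n}"
      then have le: "u i \<le> u (Suc i)" using um[of i "Suc i"] by simp
      have f0: "f 0 = f 1" using per[of 0] by simp
      have fs: "f (x - 1) = f x" for x using per[of "x - 1"] by simp
      consider "u (Suc i) \<le> 1" | "u i \<le> 1" "1 < u (Suc i)" | "1 < u i" by linarith
      then show "\<bar>f (p (Suc i)) - f (p i)\<bar> \<le> \<bar>f (q (Suc i)) - f (q i)\<bar> + \<bar>f (r (Suc i)) - f (r i)\<bar>"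
        by cases (use le f0 in \<open>auto simp: fu q_def r_def min_def max_def fs\<close>)
    qed
    also have "\<dots> \<le> B + B"
      unfolding sum.distrib
    proof (intro add_mono B)
      show "mono_on {..n} q" "mono_on {..n} r"
        using um by (fastforce simp: mono_on_def q_def r_def min_def max_def)+
      show "q ` {..n} \<subseteq> {0..1}" "r ` {..n} \<subseteq> {0..1}"
        using ur by (auto simp: q_def r_def min_def max_def)
    qed
    finally show ?thesis by simp
  qed
  then show ?thesis using that[of "2 * B"] by (auto simp: unit_variation_le_def)
qed

definition partition_sums :: "(real \<Rightarrow> real) \<Rightarrow> real \<Rightarrow> real set" where
  "partition_sums f y = {\<Sum>i<n. \<bar>f (p (Suc i)) - f (p i)\<bar> |n p.
     mono_on {..n} (p :: nat \<Rightarrow> real) \<and> 0 \<le> p 0 \<and> p n \<le> y}"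

definition total_variation :: "(real \<Rightarrow> real) \<Rightarrow> real \<Rightarrow> real" where
  "total_variation f y = Sup (partition_sums f y)"

lemma partition_sums_bounded:
  assumes "unit_variation_le K f" "y \<le> 1" "v \<in> partition_sums f y" shows "v \<le> K"
proof -
  from assms(3) obtain n p where p: "mono_on {..n} p" "0 \<le> p 0" "p n \<le> y"
    and v: "v = (\<Sum>i<n. \<bar>f (p (Suc i)) - f (p i)\<bar>)"
    unfolding partition_sums_def by blast
  show ?thesis unfolding v
    by (rule unit_variation_leD[OF assms(1) p(1)]) (use p assms(2) in linarith)
qed

lemma bdd_above_partition_sums:
  "unit_variation_le K f \<Longrightarrow> y \<le> 1 \<Longrightarrow> bdd_above (partition_sums f y)"
  by (rule bdd_aboveI[of _ K]) (rule partition_sums_bounded)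

lemma zero_in_partition_sums: "0 \<le> y \<Longrightarrow> 0 \<in> partition_sums f y"
  unfolding partition_sums_def mem_Collect_eq
  by (rule exI[of _ 0], rule exI[of _ "\<lambda>_. 0"]) (auto simp: mono_on_def)

lemma total_variation_le: "unit_variation_le K f \<Longrightarrow> 0 \<le> y \<Longrightarrow> y \<le> 1 \<Longrightarrow> total_variation f y \<le> K"
  unfolding total_variation_def using zero_in_partition_sums[of y f] partition_sums_bounded[of K f y]
  by (intro cSup_least) blast+

lemma total_variation_nonneg:
  assumes "unit_variation_le K f" "0 \<le> y" "y \<le> 1" shows "0 \<le> total_variation f y"
  unfolding total_variation_def
  by (rule cSup_upper[OF zero_in_partition_sums])
     (use assms bdd_above_partition_sums in auto)

text \<open>Appending the points \<open>y\<close> and \<open>z\<close> to a partition of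
  \<open>[0, y]\<close> gives one of \<open>[0, z]\<close>. This inequality makes both the total
  variation and its difference with \<open>f\<close> increasing.\<close>

lemma total_variation_step:
  assumes K: "unit_variation_le K f" and yz: "0 \<le> y" "y \<le> z" "z \<le> 1"
  shows "total_variation f y + \<bar>f z - f y\<bar> \<le> total_variation f z"
proof -
  have "v \<le> total_variation f z - \<bar>f z - f y\<bar>" if "v \<in> partition_sums f y" for v
  proof -
    from that obtain n p where p: "mono_on {..n} p" "0 \<le> p 0" "p n \<le> y"
      and v: "v = (\<Sum>i<n. \<bar>f (p (Suc i)) - f (p i)\<bar>)"
      unfolding partition_sums_def by blast
    define q where "q i = (if i \<le> n then p i else if i = Suc n then y else z)" for i
    have pn: "p i \<le> p n" if "i \<le> n" for i using p(1) that by (auto simp: mono_on_def)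
    have "q i \<le> q j" if "i \<le> j" "j \<le> Suc (Suc n)" for i j
    proof -
      have "j \<le> n \<or> j = Suc n \<and> i \<le> n \<or> j = Suc n \<and> i = Suc n
        \<or> j = Suc (Suc n) \<and> i \<le> n \<or> j = Suc (Suc n) \<and> i > n"
        using that by arith
      then consider "j \<le> n" | "j = Suc n" "i \<le> n" | "j = Suc n" "i = Suc n"
        | "j = Suc (Suc n)" "i \<le> n" | "j = Suc (Suc n)" "i > n"
        by blast
      then show ?thesis
      proof cases
        case 1 then show ?thesis using p(1) that by (auto simp: q_def mono_on_def)
      next
        case 2 then show ?thesis using pn[of i] p(3) by (simp add: q_def)
      next
        case 4 then show ?thesis using pn[of i] p(3) yz(2) by (simp add: q_def)
      qed (use yz in \<open>auto simp: q_def\<close>)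
    qed
    then have "mono_on {..Suc (Suc n)} q" by (auto simp: mono_on_def)
    then have "(\<Sum>i<Suc (Suc n). \<bar>f (q (Suc i)) - f (q i)\<bar>) \<in> partition_sums f z"
      unfolding partition_sums_def mem_Collect_eq
      by (intro exI[of _ "Suc (Suc n)"] exI[of _ q]) (use p in \<open>auto simp: q_def\<close>)
    then have "(\<Sum>i<Suc (Suc n). \<bar>f (q (Suc i)) - f (q i)\<bar>) \<le> total_variation f z"
      unfolding total_variation_def
      by (rule cSup_upper) (use bdd_above_partition_sums[OF K yz(3)] in auto)
    moreover have "(\<Sum>i<n. \<bar>f (q (Suc i)) - f (q i)\<bar>) = v"
      unfolding v by (intro sum.cong) (auto simp: q_def)
    ultimately show ?thesis by (simp add: q_def)
  qed
  then have "total_variation f y \<le> total_variation f z - \<bar>f z - f y\<bar>"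
    unfolding total_variation_def[of f y] using zero_in_partition_sums[OF yz(1), of f]
    by (intro cSup_least) blast+
  then show ?thesis by simp
qed

text \<open>The two monotone functions are the total variation on \<open>[0, y]\<close> and its
  excess over \<open>f y - f 0\<close>. They are made constant outside \<open>[0, 1]\<close>, so
  that monotonicity and the bounds hold on the whole line.\<close>

lemma jordan_decomposition:
  assumes K: "unit_variation_le K f"
  obtains g h :: "real \<Rightarrow> real" where "mono g" "mono h"
    "\<And>y. 0 \<le> g y" "\<And>y. g y \<le> K" "\<And>y. 0 \<le> h y" "\<And>y. h y \<le> 2 * K"
    "\<And>y. 0 \<le> y \<Longrightarrow> y \<le> 1 \<Longrightarrow> f y = f 0 + g y - h y"
proof -
  define c :: "real \<Rightarrow> real" where "c y = max 0 (min 1 y)" for y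
  have c: "0 \<le> c y" "c y \<le> 1" for y by (auto simp: c_def)
  have cm: "c x \<le> c y" if "x \<le> y" for x y using that by (auto simp: c_def)
  define g where "g y = total_variation f (c y)" for y
  define h where "h y = total_variation f (c y) - f (c y) + f 0" for y
  note st = total_variation_step[OF K]
  have "mono g" unfolding g_def by (rule monoI) (use st[OF c(1) cm c(2)] in \<open>smt (verit)\<close>)
  moreover have mh: "mono h" unfolding h_def by (rule monoI) (use st[OF c(1) cm c(2)] in \<open>smt (verit)\<close>)
  moreover have g: "0 \<le> g y" "g y \<le> K" for y
    using total_variation_nonneg[OF K c] total_variation_le[OF K c] by (auto simp: g_def)
  moreover have "0 \<le> h y" for y
    using st[of 0 "c y"] c[of y] total_variation_nonneg[OF K, of 0] by (simp add: h_def)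
  moreover have "h y \<le> 2 * K" for y
    using g[of y] unit_variation_le_diff[OF K, of 0 "c y"] c[of y] by (simp add: h_def g_def)
  moreover have "f y = f 0 + g y - h y" if "0 \<le> y" "y \<le> 1" for y
    using that by (simp add: g_def h_def c_def)
  ultimately show ?thesis using that by blast
qed

lemma periodic_frac:
  fixes f :: "real \<Rightarrow> 'b"
  assumes per: "\<And>x. f (x + 1) = f x" shows "f (frac x) = f x"
proof -
  have per_nat: "f (x + real n) = f x" for x n
  proof (induction n)
    case (Suc n)
    then show ?case using per[of "x + real n"] by (simp add: ac_simps)
  qed simp
  show ?thesis
  proof (cases "\<lfloor>x\<rfloor> \<ge> 0")
    case True
    then show ?thesis using per_nat[of "frac x" "nat \<lfloor>x\<rfloor>"] by (simp add: frac_def)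
  next
    case False
    then show ?thesis using per_nat[of x "nat (- \<lfloor>x\<rfloor>)"] by (simp add: frac_def)
  qed
qed

lemma borel_measurable_frac [measurable]: "(frac :: real \<Rightarrow> real) \<in> borel_measurable borel"
  unfolding frac_def[abs_def] by measurable

lemma borel_measurable_unit_variation:
  assumes per: "\<And>x. f (x + 1) = f x" and K: "unit_variation_le K f"
  shows "f \<in> borel_measurable borel"
proof -
  obtain g h :: "real \<Rightarrow> real" where "mono g" "mono h"
    "\<And>y. 0 \<le> g y" "\<And>y. g y \<le> K" "\<And>y. 0 \<le> h y" "\<And>y. h y \<le> 2 * K"
    and f: "\<And>y. 0 \<le> y \<Longrightarrow> y \<le> 1 \<Longrightarrow> f y = f 0 + g y - h y"
    by (rule jordan_decomposition[OF K]) blast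
  note [measurable] = borel_measurable_mono[OF \<open>mono g\<close>] borel_measurable_mono[OF \<open>mono h\<close>]
  \<comment> \<open>A separate name for the right-hand side: as a rewrite rule the Jordan
    decomposition would loop at \<open>f 0\<close>.\<close>
  define G where "G x = f 0 + g (frac x) - h (frac x)" for x
  have "f = G"
  proof
    fix x
    show "f x = G x"
      using f[of "frac x"] periodic_frac[of f x, OF per]
      unfolding G_def by (simp only: frac_ge_0 less_imp_le[OF frac_lt_1] simp_thms)
  qed
  moreover have "G \<in> borel_measurable borel" unfolding G_def by measurable
  ultimately show ?thesis by simp
qed

lemma unit_variation_bounded:
  assumes per: "\<And>x. f (x + 1) = f x" and K: "unit_variation_le K f"
  shows "\<bar>f x\<bar> \<le> \<bar>f 0\<bar> + K"
  using unit_variation_le_diff[OF K, of 0 "frac x"] periodic_frac[of f x, OF per]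
  by (simp add: frac_ge_0 frac_lt_1 less_imp_le)

section \<open>Koksma's inequality modulo 1\<close>

text \<open>The law of \<open>U\<close>; integrals over a period are taken against it.\<close>

abbreviation (input) unif :: "real measure" where
  "unif \<equiv> uniform_measure lborel {0..<1}"

lemma sets_unif [measurable_cong]: "sets unif = sets borel"
  by simp

interpretation unif: prob_space unif
  by (rule prob_space_uniform_measure) auto

lemma nn_integral_unif:
  assumes [measurable]: "f \<in> borel_measurable borel"
  shows "(\<integral>\<^sup>+x. f x \<partial>unif) = (\<integral>\<^sup>+x. f x * indicator {0..<1} x \<partial>lborel)"
  by (subst nn_integral_uniform_measure) (auto simp: mult_ac divide_ennreal_def)

lemma unif_atMost: "0 \<le> t \<Longrightarrow> t \<le> 1 \<Longrightarrow> measure unif {..t} = t"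
proof -
  assume t: "0 \<le> t" "t \<le> 1"
  have "{0..<1} \<inter> {..t} = (if t = 1 then {0..<1} else {0..t})"
    using t by auto
  then show ?thesis using t by (subst measure_uniform_measure) auto
qed

lemma AE_unif: "AE x in unif. x \<in> {0..<1}"
  by (rule AE_uniform_measureI) auto

lemma frac_add_frac: "frac (x + frac y) = frac (x + (y :: real))"
  by (simp add: frac_def add_diff_eq)

text \<open>A rotation of the circle cuts \<open>[0, 1)\<close> at one point and exchanges the two
  pieces, each of which is moved by a translation of the line.\<close>

lemma unif_frac_translate: "distr unif borel (\<lambda>u. frac (s + u)) = unif"
proof (rule measure_eqI)
  show "sets (distr unif borel (\<lambda>u. frac (s + u))) = sets unif" by simp
next
  fix A assume "A \<in> sets (distr unif borel (\<lambda>u. frac (s + u)))"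
  then have [measurable]: "A \<in> sets borel" by simp
  define r where "r = frac s"
  have r: "0 \<le> r" "r < 1" by (auto simp: r_def frac_ge_0 frac_lt_1)
  have fr: "frac (s + u) = frac (r + u)" for u
    unfolding r_def by (metis add.commute frac_add_frac)
  have f1: "frac (r + u) = r + u" if "0 \<le> u" "u < 1 - r" for u
    using that r by (simp add: frac_eq)
  have f2: "frac (r + u) = r + u - 1" if "1 - r \<le> u" "u < 1" for u
    using that r frac_eq[of "r + u - 1"] frac_1_eq[of "r + u - 1"] by (simp add: algebra_simps)
  have "emeasure (distr unif borel (\<lambda>u. frac (s + u))) A = (\<integral>\<^sup>+u. indicator A (frac (r + u)) \<partial>unif)"
    by (subst nn_integral_indicator[symmetric], simp, subst nn_integral_distr) (auto simp: fr)
  also have "\<dots> = (\<integral>\<^sup>+u. indicator A (frac (r + u)) * indicator {0..<1} u \<partial>lborel)"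
    by (rule nn_integral_unif) simp
  also have "\<dots> = (\<integral>\<^sup>+u. indicator A (r + u) * indicator {r..<1} (r + u)
      + indicator A (r - 1 + u) * indicator {0..<r} (r - 1 + u) \<partial>lborel)"
  proof (intro nn_integral_cong)
    fix u
    consider "u < 0" | "0 \<le> u" "u < 1 - r" | "1 - r \<le> u" "u < 1" | "1 \<le> u" by linarith
    then show "(indicator A (frac (r + u)) * indicator {0..<1} u :: ennreal)
      = indicator A (r + u) * indicator {r..<1} (r + u)
        + indicator A (r - 1 + u) * indicator {0..<r} (r - 1 + u)"
      by cases (use f1[of u] f2[of u] r in \<open>auto simp: indicator_def diff_add_eq\<close>)
  qed
  also have "\<dots> = (\<integral>\<^sup>+u. indicator A (r + u) * indicator {r..<1} (r + u) \<partial>lborel)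
      + (\<integral>\<^sup>+u. indicator A (r - 1 + u) * indicator {0..<r} (r - 1 + u) \<partial>lborel)"
    by (rule nn_integral_add) auto
  also have "(\<integral>\<^sup>+u. indicator A (r + u) * indicator {r..<1} (r + u) \<partial>lborel)
      = (\<integral>\<^sup>+u. indicator A u * indicator {r..<1} u \<partial>lborel)"
    using nn_integral_real_affine[of "\<lambda>u. indicator A u * indicator {r..<1} u" 1 r] by simp
  also have "(\<integral>\<^sup>+u. indicator A (r - 1 + u) * indicator {0..<r} (r - 1 + u) \<partial>lborel)
      = (\<integral>\<^sup>+u. indicator A u * indicator {0..<r} u \<partial>lborel)"
    using nn_integral_real_affine[of "\<lambda>u. indicator A u * indicator {0..<r} u" 1 "r - 1"] by simp
  also have "(\<integral>\<^sup>+u. indicator A u * indicator {r..<1} u \<partial>lborel)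
      + (\<integral>\<^sup>+u. indicator A u * indicator {0..<r} u \<partial>lborel)
      = (\<integral>\<^sup>+u. indicator A u * indicator {r..<1} u + indicator A u * indicator {0..<r} u \<partial>lborel)"
    by (rule nn_integral_add[symmetric]) auto
  also have "\<dots> = (\<integral>\<^sup>+u. indicator A u * indicator {0..<1} u \<partial>lborel)"
    by (intro nn_integral_cong) (use r in \<open>auto simp: indicator_def\<close>)
  also have "\<dots> = (\<integral>\<^sup>+u. indicator A u \<partial>unif)"
    by (rule nn_integral_unif[symmetric]) simp
  also have "\<dots> = emeasure unif A" by simp
  finally show "emeasure (distr unif borel (\<lambda>u. frac (s + u))) A = emeasure unif A" .
qed

lemma integral_unif_translate:
  fixes f :: "real \<Rightarrow> real"
  assumes per: "\<And>x. f (x + 1) = f x" and [measurable]: "f \<in> borel_measurable borel"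
  shows "(LINT u|unif. f (s + u)) = (LINT u|unif. f u)"
proof -
  have "(LINT u|unif. f u) = (LINT u|distr unif borel (\<lambda>u. frac (s + u)). f u)"
    by (simp only: unif_frac_translate)
  also have "\<dots> = (LINT u|unif. f (frac (s + u)))"
    by (subst integral_distr) auto
  also have "\<dots> = (LINT u|unif. f (s + u))"
    using periodic_frac[of f, OF per] by simp
  finally show ?thesis by simp
qed

text \<open>An up-set is, up to its left end point \<open>c\<close>, the half-line to the right of
  \<open>c\<close>. Its measure is squeezed between the complements of \<open>{..c}\<close> and of
  \<open>{..t}\<close> for \<open>t\<close> slightly below \<open>c\<close>, whether or not
  \<open>c\<close> belongs to the set. Inserting 1 gives the empty set the end point 1.\<close>

lemma upset_discrepancy:
  fixes \<nu> :: "real measure"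
  assumes "prob_space \<nu>" and [measurable_cong]: "sets \<nu> = sets borel"
    and conc: "AE x in \<nu>. x \<in> {0..<1}"
    and d: "\<And>t. 0 \<le> t \<Longrightarrow> t \<le> 1 \<Longrightarrow> \<bar>measure \<nu> {..t} - t\<bar> \<le> d"
    and [measurable]: "J \<in> sets borel" and up: "\<And>y z. y \<in> J \<Longrightarrow> y \<le> z \<Longrightarrow> z \<in> J"
  defines "c \<equiv> Inf (insert 1 (J \<inter> {0..1}))"
  shows "\<bar>measure \<nu> J - (1 - c)\<bar> \<le> d"
proof -
  interpret prob_space \<nu> by fact
  have sp: "space \<nu> = UNIV" using sets_eq_imp_space_eq[OF assms(2)] by simp
  have bdd: "bdd_below (insert 1 (J \<inter> {0..1}))" by (rule bdd_belowI[of _ 0]) auto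
  have c1: "c \<le> 1" unfolding c_def by (rule cInf_lower[OF _ bdd]) auto
  have c0: "0 \<le> c" unfolding c_def by (rule cInf_greatest) auto
  have d0: "0 \<le> d" using d[of 0] abs_ge_zero[of "measure \<nu> {..0} - 0"] by linarith
  have compl: "measure \<nu> {t<..} = 1 - measure \<nu> {..t}" for t
    using prob_compl[of "{..t}"] by (simp add: sp Compl_eq_Diff_UNIV[symmetric])
  have "1 - c - d \<le> measure \<nu> {c<..}" using d[OF c0 c1] compl[of c] by linarith
  also have "\<dots> \<le> measure \<nu> J"
  proof (rule finite_measure_mono_AE)
    show "AE x in \<nu>. x \<in> {c<..} \<longrightarrow> x \<in> J"
      using conc
    proof eventually_elim
      case (elim x)
      show ?case
      proof
        assume "x \<in> {c<..}"
        then have "\<exists>z\<in>insert 1 (J \<inter> {0..1}). z < x"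
          unfolding c_def by (intro cInf_lessD) auto
        then obtain z where "z \<in> insert 1 (J \<inter> {0..1})" "z < x" by blast
        then show "x \<in> J" using elim up[of z x] by auto
      qed
    qed
  qed simp
  finally have lo: "1 - c - d \<le> measure \<nu> J" .
  have hi: "measure \<nu> J \<le> 1 - c + d"
  proof (cases "c = 0")
    case True then show ?thesis using d0 prob_le_1[of J] by linarith
  next
    case False
    have "measure \<nu> J \<le> 1 - c + d + e" if e: "0 < e" for e
    proof -
      define t where "t = max 0 (c - e)"
      have t: "0 \<le> t" "t \<le> 1" "t < c" "c - t \<le> e" using False c0 c1 e by (auto simp: t_def)
      have "measure \<nu> J \<le> measure \<nu> {t<..}"
      proof (rule finite_measure_mono_AE)
        show "AE x in \<nu>. x \<in> J \<longrightarrow> x \<in> {t<..}"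
          using conc
        proof eventually_elim
          case (elim x)
          show ?case
          proof
            assume "x \<in> J"
            then have "c \<le> x" unfolding c_def using elim by (intro cInf_lower[OF _ bdd]) auto
            then show "x \<in> {t<..}" using t by simp
          qed
        qed
      qed simp
      also have "\<dots> \<le> 1 - c + d + e" using d[OF t(1,2)] compl[of t] t by linarith
      finally show ?thesis .
    qed
    then show ?thesis by (rule field_le_epsilon)
  qed
  show ?thesis using lo hi by linarith
qed

text \<open>Fubini for the region under the graph of \<open>g\<close>. It reduces the comparison
  of integrals of monotone functions to that of measures of their superlevel sets, which are
  up-sets.\<close>

lemma layer_cake:
  fixes g :: "real \<Rightarrow> real" and \<nu> :: "real measure"
  assumes "prob_space \<nu>" and [measurable_cong]: "sets \<nu> = sets borel"
    and [measurable]: "g \<in> borel_measurable borel" and g: "\<And>y. 0 \<le> g y" "\<And>y. g y \<le> R"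
  shows "(\<integral>\<^sup>+y. ennreal (g y) \<partial>\<nu>) =
    (\<integral>\<^sup>+s. ennreal (measure \<nu> {y. s < g y}) * indicator {0..<R} s \<partial>lborel)"
proof -
  interpret prob_space \<nu> by fact
  interpret pair_sigma_finite lborel \<nu> ..
  have sp: "space \<nu> = UNIV" using sets_eq_imp_space_eq[OF assms(2)] by simp
  have "(\<integral>\<^sup>+y. ennreal (g y) \<partial>\<nu>) = (\<integral>\<^sup>+y. (\<integral>\<^sup>+s. indicator {0..<g y} s \<partial>lborel) \<partial>\<nu>)"
    using g by (intro nn_integral_cong) simp
  also have "\<dots> = (\<integral>\<^sup>+s. (\<integral>\<^sup>+y. indicator {0..<g y} s \<partial>\<nu>) \<partial>lborel)"
    by (rule Fubini') (simp add: atLeastLessThan_def indicator_def)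
  also have "\<dots> = (\<integral>\<^sup>+s. ennreal (measure \<nu> {y. s < g y}) * indicator {0..<R} s \<partial>lborel)"
  proof (intro nn_integral_cong)
    fix s :: real
    have "{y. s < g y} \<in> sets borel" by measurable
    then have "ennreal (measure \<nu> {y. s < g y}) = (\<integral>\<^sup>+y. indicator {y. s < g y} y \<partial>\<nu>)"
      by (simp add: emeasure_eq_measure)
    moreover have "(\<integral>\<^sup>+y. indicator {0..<g y} s \<partial>\<nu>) = (\<integral>\<^sup>+y. indicator {y. s < g y} y * indicator {0..<R} s \<partial>\<nu>)"
    proof (intro nn_integral_cong)
      fix y show "(indicator {0..<g y} s :: ennreal) = indicator {y. s < g y} y * indicator {0..<R} s"
        using g[of y] by (auto simp: indicator_def)
    qed
    moreover have "\<dots> = (\<integral>\<^sup>+y. indicator {y. s < g y} y \<partial>\<nu>) * indicator {0..<R} s"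
      by (rule nn_integral_multc) simp
    ultimately show "(\<integral>\<^sup>+y. indicator {0..<g y} s \<partial>\<nu>)
        = ennreal (measure \<nu> {y. s < g y}) * indicator {0..<R} s" by simp
  qed
  finally show ?thesis .
qed

lemma mono_integral_le:
  fixes g :: "real \<Rightarrow> real"
  assumes P: "prob_space \<nu>" "prob_space \<nu>'" and S: "sets \<nu> = sets borel" "sets \<nu>' = sets borel"
    and m: "mono g" and g: "\<And>y. 0 \<le> g y" "\<And>y. g y \<le> R"
    and d: "\<And>s. measure \<nu> {y. s < g y} \<le> measure \<nu>' {y. s < g y} + d" and d0: "0 \<le> d"
  shows "(LINT y|\<nu>. g y) \<le> (LINT y|\<nu>'. g y) + R * d"
proof -
  note [measurable] = borel_measurable_mono[OF m]
  note [measurable_cong] = S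
  have R: "0 \<le> R" using g[of 0] by linarith
  have *: "(\<integral>\<^sup>+y. ennreal (g y) \<partial>\<kappa>) = ennreal (LINT y|\<kappa>. g y)"
    if "prob_space \<kappa>" "sets \<kappa> = sets borel" for \<kappa>
  proof (rule nn_integral_eq_integral)
    interpret prob_space \<kappa> by fact
    note [measurable_cong] = that(2)
    show "integrable \<kappa> g" using g by (intro integrable_const_bound[of _ R]) auto
  qed (use g in auto)
  have "ennreal (LINT y|\<nu>. g y) \<le> (\<integral>\<^sup>+s. (ennreal (measure \<nu>' {y. s < g y}) + ennreal d) * indicator {0..<R} s \<partial>lborel)"
    unfolding *[OF P(1) S(1), symmetric] layer_cake[OF P(1) S(1) borel_measurable_mono[OF m] g]
    using d d0 by (intro nn_integral_mono) (auto simp: indicator_def simp flip: ennreal_plus intro!: ennreal_leI)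
  also have "\<dots> = (\<integral>\<^sup>+s. ennreal (measure \<nu>' {y. s < g y}) * indicator {0..<R} s + ennreal d * indicator {0..<R} s \<partial>lborel)"
    by (intro nn_integral_cong) (simp add: distrib_right)
  also have "\<dots> = (\<integral>\<^sup>+s. ennreal (measure \<nu>' {y. s < g y}) * indicator {0..<R} s \<partial>lborel)
     + (\<integral>\<^sup>+s. ennreal d * indicator {0..<R} s \<partial>lborel)"
  proof (rule nn_integral_add)
    have "mono (\<lambda>s. - measure \<nu>' {y. s < g y})"
    proof (rule monoI, simp)
      interpret prob_space \<nu>' by fact
      fix s t :: real assume "s \<le> t"
      moreover have "{y. s < g y} \<in> sets borel" by measurable
      ultimately show "measure \<nu>' {y. t < g y} \<le> measure \<nu>' {y. s < g y}"
        by (intro finite_measure_mono) (auto simp: S)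
    qed
    from borel_measurable_uminus[OF borel_measurable_mono[OF this]]
    have [measurable]: "(\<lambda>s. measure \<nu>' {y. s < g y}) \<in> borel_measurable borel" by simp
    show "(\<lambda>s. ennreal (measure \<nu>' {y. s < g y}) * indicator {0..<R} s) \<in> borel_measurable lborel"
      by measurable
  qed simp
  also have "(\<integral>\<^sup>+s. ennreal d * indicator {0..<R} s \<partial>lborel) = ennreal (R * d)"
    using R d0 by (simp add: nn_integral_cmult ennreal_mult[symmetric] mult.commute)
  also have "(\<integral>\<^sup>+s. ennreal (measure \<nu>' {y. s < g y}) * indicator {0..<R} s \<partial>lborel) = ennreal (LINT y|\<nu>'. g y)"
    unfolding *[OF P(2) S(2), symmetric] layer_cake[OF P(2) S(2) borel_measurable_mono[OF m] g] ..
  finally show ?thesis using g R d0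
    by (simp flip: ennreal_plus add: Bochner_Integration.integral_nonneg)
qed

lemma koksma_monotone:
  fixes g :: "real \<Rightarrow> real" and \<nu> :: "real measure"
  assumes P: "prob_space \<nu>" and S: "sets \<nu> = sets borel"
    and conc: "AE x in \<nu>. x \<in> {0..<1}"
    and d: "\<And>t. 0 \<le> t \<Longrightarrow> t \<le> 1 \<Longrightarrow> \<bar>measure \<nu> {..t} - t\<bar> \<le> d"
    and m: "mono g" and g: "\<And>y. 0 \<le> g y" "\<And>y. g y \<le> R"
  shows "\<bar>(LINT y|\<nu>. g y) - (LINT y|unif. g y)\<bar> \<le> R * d"
proof -
  note [measurable] = borel_measurable_mono[OF m]
  have d0: "0 \<le> d" using d[of 0] abs_ge_zero[of "measure \<nu> {..0} - 0"] by linarith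
  have J: "\<bar>measure \<nu> {y. s < g y} - measure unif {y. s < g y}\<bar> \<le> d" for s
  proof -
    have up: "z \<in> {y. s < g y}" if "y \<in> {y. s < g y}" "y \<le> z" for y z
      using that monoD[OF m, of y z] by auto
    have ms: "{y. s < g y} \<in> sets borel" by measurable
    have "\<bar>measure unif {y. s < g y} - (1 - Inf (insert 1 ({y. s < g y} \<inter> {0..1})))\<bar> \<le> 0"
      by (rule upset_discrepancy[OF unif.prob_space_axioms sets_unif AE_unif _ ms up])
         (simp only: unif_atMost diff_self abs_zero order_refl)
    moreover have "\<bar>measure \<nu> {y. s < g y} - (1 - Inf (insert 1 ({y. s < g y} \<inter> {0..1})))\<bar> \<le> d"
      by (rule upset_discrepancy[OF P S conc d ms up])
    ultimately show ?thesis by linarith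
  qed
  have "(LINT y|\<nu>. g y) \<le> (LINT y|unif. g y) + R * d"
    using J by (intro mono_integral_le[OF P unif.prob_space_axioms S sets_unif m g _ d0]) (smt (verit))+
  moreover have "(LINT y|unif. g y) \<le> (LINT y|\<nu>. g y) + R * d"
    using J by (intro mono_integral_le[OF unif.prob_space_axioms P sets_unif S m g _ d0]) (smt (verit))+
  ultimately show ?thesis by linarith
qed

text \<open>Split \<open>f\<close> on \<open>[0, 1]\<close> into monotone functions with ranges in
  \<open>[0, K]\<close> and \<open>[0, 2 * K]\<close>. Each contributes the length of its range
  times \<open>d\<close>, whence the constant 3.\<close>

lemma koksma:
  fixes f Y :: "_ \<Rightarrow> real"
  assumes "prob_space M" and [measurable]: "Y \<in> borel_measurable M"
    and d: "\<And>t. 0 \<le> t \<Longrightarrow> t \<le> 1 \<Longrightarrow> \<bar>measure M {\<omega>\<in>space M. frac (Y \<omega>) \<le> t} - t\<bar> \<le> d"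
    and per: "\<And>x. f (x + 1) = f x" and K: "unit_variation_le K f"
  shows "\<bar>(LINT \<omega>|M. f (Y \<omega>)) - (LINT x|unif. f x)\<bar> \<le> 3 * K * d"
proof -
  interpret prob_space M by fact
  define \<nu> where "\<nu> = distr M borel (\<lambda>\<omega>. frac (Y \<omega>))"
  have P: "prob_space \<nu>" unfolding \<nu>_def by (rule prob_space_distr) simp
  interpret \<nu>: prob_space \<nu> by fact
  have S[measurable_cong]: "sets \<nu> = sets borel" by (simp add: \<nu>_def)
  have conc: "AE x in \<nu>. x \<in> {0..<1}"
    unfolding \<nu>_def by (subst AE_distr_iff) (auto simp: frac_ge_0 frac_lt_1)
  have d': "\<bar>measure \<nu> {..t} - t\<bar> \<le> d" if "0 \<le> t" "t \<le> 1" for t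
  proof -
    have "(\<lambda>\<omega>. frac (Y \<omega>)) -` {..t} \<inter> space M = {\<omega>\<in>space M. frac (Y \<omega>) \<le> t}" by auto
    then show ?thesis using d[OF that] by (simp add: \<nu>_def measure_distr)
  qed
  obtain g h :: "real \<Rightarrow> real" where m: "mono g" "mono h"
    and g: "\<And>y. 0 \<le> g y" "\<And>y. g y \<le> K" and h: "\<And>y. 0 \<le> h y" "\<And>y. h y \<le> 2 * K"
    and f: "\<And>y. 0 \<le> y \<Longrightarrow> y \<le> 1 \<Longrightarrow> f y = f 0 + g y - h y"
    by (rule jordan_decomposition[OF K]) blast
  note [measurable] = borel_measurable_mono[OF m(1)] borel_measurable_mono[OF m(2)]
    borel_measurable_unit_variation[of f, OF per K]
  have *: "(LINT x|\<kappa>. f x) = f 0 + (LINT x|\<kappa>. g x) - (LINT x|\<kappa>. h x)"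
    if "prob_space \<kappa>" "sets \<kappa> = sets borel" "AE x in \<kappa>. x \<in> {0..<1}" for \<kappa>
  proof -
    interpret \<kappa>: prob_space \<kappa> by fact
    note [measurable_cong] = that(2)
    have i: "integrable \<kappa> g" "integrable \<kappa> h"
      using \<kappa>.integrable_const_bound[of g K] \<kappa>.integrable_const_bound[of h "2 * K"] g h by auto
    have "(LINT x|\<kappa>. f x) = (LINT x|\<kappa>. f 0 + g x - h x)"
    proof (rule integral_cong_AE)
      show "AE x in \<kappa>. f x = f 0 + g x - h x"
        using that(3) by eventually_elim (rule f, simp_all)
    qed simp_all
    also have "\<dots> = f 0 + (LINT x|\<kappa>. g x) - (LINT x|\<kappa>. h x)"
      using i by (simp add: \<kappa>.prob_space)
    finally show ?thesis .
  qed
  have "(LINT \<omega>|M. f (Y \<omega>)) = (LINT \<omega>|M. f (frac (Y \<omega>)))"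
    using periodic_frac[of f, OF per] by simp
  also have "\<dots> = (LINT x|\<nu>. f x)" unfolding \<nu>_def by (subst integral_distr) auto
  finally have "(LINT \<omega>|M. f (Y \<omega>)) = f 0 + (LINT x|\<nu>. g x) - (LINT x|\<nu>. h x)"
    using *[OF P S conc] by simp
  moreover have "(LINT x|unif. f x) = f 0 + (LINT x|unif. g x) - (LINT x|unif. h x)"
    by (rule *[OF unif.prob_space_axioms sets_unif AE_unif])
  moreover have "\<bar>(LINT y|\<nu>. g y) - (LINT y|unif. g y)\<bar> \<le> K * d"
    by (rule koksma_monotone[OF P S conc d' m(1) g])
  moreover have "\<bar>(LINT y|\<nu>. h y) - (LINT y|unif. h y)\<bar> \<le> 2 * K * d"
    by (rule koksma_monotone[OF P S conc d' m(2) h])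
  ultimately show ?thesis by linarith
qed

section \<open>The random walk on increment streams\<close>

definition bounded_borel :: "(real \<Rightarrow> 'b::{second_countable_topology, real_normed_vector}) \<Rightarrow> bool" where
  "bounded_borel f \<longleftrightarrow> f \<in> borel_measurable borel \<and> (\<exists>B. \<forall>x. norm (f x) \<le> B)"

text \<open>Closure properties of bounded Borel functions; they discharge all integrability
  conditions.\<close>

named_theorems bb_intros

lemma bounded_borelI: "f \<in> borel_measurable borel \<Longrightarrow> (\<And>x. norm (f x) \<le> B) \<Longrightarrow> bounded_borel f"
  unfolding bounded_borel_def by blast

lemma bounded_borel_measurable: "bounded_borel f \<Longrightarrow> f \<in> borel_measurable borel"
  unfolding bounded_borel_def by blast

lemma bounded_borel_bound:
  assumes "bounded_borel f" obtains B where "B > 0" "\<And>x. norm (f x) \<le> B"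
proof -
  obtain B where "\<And>x. norm (f x) \<le> B" using assms unfolding bounded_borel_def by blast
  then have "norm (f x) \<le> \<bar>B\<bar> + 1" for x by (smt (verit))
  then show ?thesis using that[of "\<bar>B\<bar> + 1"] by simp
qed

lemma bounded_borel_const [bb_intros]: "bounded_borel (\<lambda>_. c)"
  by (rule bounded_borelI[of _ "norm c"]) auto

lemma bounded_borel_add [bb_intros]:
  assumes "bounded_borel f" "bounded_borel g" shows "bounded_borel (\<lambda>x. f x + g x)"
proof -
  obtain A B where "\<And>x. norm (f x) \<le> A" "\<And>x. norm (g x) \<le> B"
    using assms unfolding bounded_borel_def by blast
  then show ?thesis using assms[THEN bounded_borel_measurable]
    by (intro bounded_borelI[of _ "A + B"] norm_triangle_mono) auto
qed

lemma bounded_borel_mult [bb_intros]: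
  fixes f g :: "real \<Rightarrow> 'b::{second_countable_topology, real_normed_algebra}"
  assumes "bounded_borel f" "bounded_borel g" shows "bounded_borel (\<lambda>x. f x * g x)"
proof -
  obtain A B where AB: "\<And>x. norm (f x) \<le> A" "\<And>x. norm (g x) \<le> B"
    using assms unfolding bounded_borel_def by blast
  have "norm (f x * g x) \<le> A * B" for x
    by (rule order.trans[OF norm_mult_ineq]) (use AB in \<open>meson mult_mono norm_ge_zero order_trans\<close>)
  then show ?thesis using assms[THEN bounded_borel_measurable]
    by (intro bounded_borelI[of _ "A * B"]) auto
qed

lemma bounded_borel_minus [bb_intros]: "bounded_borel f \<Longrightarrow> bounded_borel (\<lambda>x. - f x)"
  unfolding bounded_borel_def by auto

lemma bounded_borel_diff [bb_intros]:
  "bounded_borel f \<Longrightarrow> bounded_borel g \<Longrightarrow> bounded_borel (\<lambda>x. f x - g x)"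
  using bounded_borel_add[of f "\<lambda>x. - g x"] bounded_borel_minus[of g] by simp

lemma bounded_borel_of_real [bb_intros]:
  "bounded_borel f \<Longrightarrow>
    bounded_borel (\<lambda>x. of_real (f x) :: 'b::{second_countable_topology, real_normed_div_algebra})"
  unfolding bounded_borel_def by auto

lemma bounded_borel_divide [bb_intros]:
  fixes f :: "real \<Rightarrow> real"
  shows "bounded_borel f \<Longrightarrow> bounded_borel (\<lambda>x. f x / c)"
  unfolding divide_inverse by (intro bounded_borel_mult bounded_borel_const)

lemma bounded_borel_power [bb_intros]:
  fixes f :: "real \<Rightarrow> real"
  shows "bounded_borel f \<Longrightarrow> bounded_borel (\<lambda>x. f x ^ n)"
  by (induction n) (auto intro: bb_intros)

lemma bounded_borel_sum [bb_intros]: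
  "(\<And>i. i \<in> I \<Longrightarrow> bounded_borel (f i)) \<Longrightarrow> bounded_borel (\<lambda>x. \<Sum>i\<in>I. f i x)"
  by (induction I rule: infinite_finite_induct) (auto intro: bb_intros)

lemma bounded_borel_exp [bb_intros]:
  fixes f :: "real \<Rightarrow> 'b::{second_countable_topology, real_normed_field, banach}"
  assumes "bounded_borel f" shows "bounded_borel (\<lambda>x. exp (f x))"
proof -
  obtain B where B: "\<And>x. norm (f x) \<le> B" using assms unfolding bounded_borel_def by blast
  have [measurable]: "f \<in> borel_measurable borel" by (rule bounded_borel_measurable[OF assms])
  have "norm (exp (f x)) \<le> exp B" for x
    by (rule order.trans[OF norm_exp]) (use B in simp)
  moreover have "(\<lambda>x. exp (f x)) \<in> borel_measurable borel"
    by (intro borel_measurable_continuous_on[of exp] continuous_intros) auto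
  ultimately show ?thesis by (intro bounded_borelI)
qed

lemma bounded_borel_integrable:
  fixes f :: "real \<Rightarrow> 'b::{banach, second_countable_topology}"
  assumes "bounded_borel f" "finite_measure M" "g \<in> borel_measurable M"
  shows "integrable M (\<lambda>w. f (g w))"
proof -
  interpret finite_measure M by fact
  note [measurable] = bounded_borel_measurable[OF assms(1)] assms(3)
  obtain B where "\<And>x. norm (f x) \<le> B" using assms(1) unfolding bounded_borel_def by blast
  then show ?thesis by (intro integrable_const_bound[of _ B]) auto
qed

lemma bounded_borel_unif_integrable:
  fixes f :: "real \<Rightarrow> 'b::{banach, second_countable_topology}"
  shows "bounded_borel f \<Longrightarrow> integrable unif f"
  using bounded_borel_integrable[of f unif "\<lambda>x. x"] unif.finite_measure_axioms by simp

lemma unit_variation_bounded_borel: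
  assumes per: "\<And>x. f (x + 1) = f x" and K: "unit_variation_le K f"
  shows "bounded_borel f"
  using borel_measurable_unit_variation[of f, OF per K] unit_variation_bounded[of f, OF per K]
  by (auto intro!: bounded_borelI[of _ "\<bar>f 0\<bar> + K"])

primrec walk_pos :: "nat \<Rightarrow> real \<Rightarrow> real stream \<Rightarrow> real" where
  "walk_pos 0 x w = x"
| "walk_pos (Suc n) x w = walk_pos n (x + shd w) (stl w)"

text \<open>Both recursions split off the first increment, which suits the inductions by
  first-step analysis. The summands are taken at the positions after 1, \<dots>, \<open>n\<close>
  steps, so the starting point does not contribute.\<close>

primrec walk_sum :: "(real \<Rightarrow> real) \<Rightarrow> nat \<Rightarrow> real \<Rightarrow> real stream \<Rightarrow> real" where
  "walk_sum f 0 x w = 0"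
| "walk_sum f (Suc n) x w = f (x + shd w) + walk_sum f n (x + shd w) (stl w)"

lemma walk_pos_eq: "walk_pos n x w = x + (\<Sum>i<n. w !! i)"
  by (induction n arbitrary: x w) (auto simp: sum.lessThan_Suc_shift simp del: sum.lessThan_Suc)

lemma walk_sum_eq: "walk_sum f n x w = (\<Sum>k=1..n. f (walk_pos k x w))"
proof (induction n arbitrary: x w)
  case (Suc n)
  have "(\<Sum>k=1..Suc n. f (walk_pos k x w)) = f (walk_pos 1 x w) + (\<Sum>k=1..n. f (walk_pos (Suc k) x w))"
    by (subst sum.atLeast_Suc_atMost, simp)
       (simp only: sum.shift_bounds_cl_Suc_ivl One_nat_def)
  then show ?case using Suc by simp
qed simp

lemma walk_pos_shift: "walk_pos n x w = x + walk_pos n 0 w"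
  by (simp add: walk_pos_eq)

lemma walk_pos_stake [simp]: "walk_pos m x (stake m w @- w') = walk_pos m x w"
  by (induction m arbitrary: x w) auto

lemma walk_sum_stake [simp]: "walk_sum f m x (stake m w @- w') = walk_sum f m x w"
  by (induction m arbitrary: x w) auto

lemma walk_sum_add:
  "walk_sum f (m + n) x w = walk_sum f m x w + walk_sum f n (walk_pos m x w) (sdrop m w)"
  by (induction m arbitrary: x w) (auto simp: add.assoc)

lemma walk_sum_minus: "walk_sum (\<lambda>x. - f x) n x w = - walk_sum f n x w"
  by (induction n arbitrary: x w) auto

text \<open>The increments have law \<open>\<mu>\<close>; paths are streams of increments under
  the product measure \<open>\<Omega>\<close>.\<close>

locale random_walk = prob_space \<mu> for \<mu> :: "real measure" +
  assumes sets_\<mu> [measurable_cong, simp]: "sets \<mu> = sets borel"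
begin

abbreviation "\<Omega> \<equiv> stream_space \<mu>"

sublocale path: prob_space \<Omega>
  by (rule prob_space_stream_space)

lemma space_\<mu> [simp]: "space \<mu> = UNIV"
  using sets_eq_imp_space_eq[OF sets_\<mu>] by simp

lemma space_path [simp]: "space \<Omega> = UNIV"
  by (auto simp: space_stream_space)

lemma prob_\<mu>_UNIV [simp]: "measure \<mu> UNIV = 1"
  using prob_space by simp

lemma prob_path_UNIV [simp]: "measure \<Omega> UNIV = 1"
  using path.prob_space by simp

lemma sets_path [measurable_cong]: "sets \<Omega> = sets (stream_space borel)"
  by (rule sets_stream_space_cong) simp

lemma measurable_path_eq: "measurable N \<Omega> = measurable N (stream_space borel)"
  by (rule measurable_cong_sets) (simp_all add: sets_path)

lemma measurable_walk_pos [measurable (raw)]: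
  assumes "g \<in> borel_measurable N" "h \<in> measurable N \<Omega>"
  shows "(\<lambda>z. walk_pos n (g z) (h z)) \<in> borel_measurable N"
  using assms unfolding measurable_path_eq
proof (induction n arbitrary: g h)
  case (Suc n)
  have "(\<lambda>z. g z + shd (h z)) \<in> borel_measurable N"
    by (intro borel_measurable_add Suc.prems measurable_compose[OF Suc.prems(2) measurable_shd])
  moreover have "(\<lambda>z. stl (h z)) \<in> measurable N (stream_space borel)"
    by (rule measurable_compose[OF Suc.prems(2) measurable_stl])
  ultimately have "(\<lambda>z. g z + shd (h z)) \<in> borel_measurable N"
    "(\<lambda>z. stl (h z)) \<in> measurable N (stream_space borel)" .
  from Suc.IH[OF this] show ?case by simp
qed simp

lemma measurable_walk_sum [measurable (raw)]:
  assumes f[measurable]: "f \<in> borel_measurable borel"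
  assumes "g \<in> borel_measurable N" "h \<in> measurable N \<Omega>"
  shows "(\<lambda>z. walk_sum f n (g z) (h z)) \<in> borel_measurable N"
  using assms(2-) unfolding measurable_path_eq
proof (induction n arbitrary: g h)
  case (Suc n)
  have *[measurable]: "(\<lambda>z. g z + shd (h z)) \<in> borel_measurable N"
    by (intro borel_measurable_add Suc.prems measurable_compose[OF Suc.prems(2) measurable_shd])
  have **: "(\<lambda>z. stl (h z)) \<in> measurable N (stream_space borel)"
    by (rule measurable_compose[OF Suc.prems(2) measurable_stl])
  have "(\<lambda>z. f (g z + shd (h z)) + walk_sum f n (g z + shd (h z)) (stl (h z))) \<in> borel_measurable N"
    using Suc.IH[OF * **] by measurable
  then show ?case by simp
qed simp

lemma path_eq_distr_Stream: "\<Omega> = distr (\<mu> \<Otimes>\<^sub>M \<Omega>) \<Omega> (\<lambda>(s, w). s ## w)"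
proof (rule measure_eqI)
  fix A assume A[measurable]: "A \<in> sets \<Omega>"
  have "emeasure (distr (\<mu> \<Otimes>\<^sub>M \<Omega>) \<Omega> (\<lambda>(s, w). s ## w)) A
      = emeasure (\<mu> \<Otimes>\<^sub>M \<Omega>) ((\<lambda>(s, w). s ## w) -` A \<inter> space (\<mu> \<Otimes>\<^sub>M \<Omega>))"
    by (rule emeasure_distr) measurable
  also have "\<dots> = (\<integral>\<^sup>+s. emeasure \<Omega> (Pair s -` ((\<lambda>(s, w). s ## w) -` A \<inter> space (\<mu> \<Otimes>\<^sub>M \<Omega>))) \<partial>\<mu>)"
    by (rule path.emeasure_pair_measure_alt) measurable
  also have "\<dots> = (\<integral>\<^sup>+s. emeasure \<Omega> {w\<in>space \<Omega>. s ## w \<in> A} \<partial>\<mu>)"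
    by (intro nn_integral_cong arg_cong2[where f=emeasure]) (auto simp: space_pair_measure)
  also have "\<dots> = emeasure \<Omega> A" by (rule emeasure_stream_space[symmetric]) fact
  finally show "emeasure \<Omega> A = emeasure (distr (\<mu> \<Otimes>\<^sub>M \<Omega>) \<Omega> (\<lambda>(s, w). s ## w)) A" ..
qed simp

lemma integral_first_step:
  fixes F :: "real stream \<Rightarrow> 'b::{banach, second_countable_topology}"
  assumes [measurable]: "F \<in> borel_measurable \<Omega>" and B: "\<And>w. norm (F w) \<le> B"
  shows "(LINT w|\<Omega>. F w) = (LINT s|\<mu>. (LINT w|\<Omega>. F (s ## w)))"
proof -
  interpret pair_prob_space \<mu> \<Omega> ..
  have int: "integrable (\<mu> \<Otimes>\<^sub>M \<Omega>) (\<lambda>(s, w). F (s ## w))"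
    using B by (intro P.integrable_const_bound[of _ B]) auto
  have "(LINT w|\<Omega>. F w) = (LINT w|distr (\<mu> \<Otimes>\<^sub>M \<Omega>) \<Omega> (\<lambda>(s, w). s ## w). F w)"
    by (simp only: path_eq_distr_Stream[symmetric])
  also have "\<dots> = (LINT z|(\<mu> \<Otimes>\<^sub>M \<Omega>). F ((\<lambda>(s, w). s ## w) z))"
    by (rule integral_distr) measurable
  also have "\<dots> = (LINT z|(\<mu> \<Otimes>\<^sub>M \<Omega>). (\<lambda>(s, w). F (s ## w)) z)"
    by (intro Bochner_Integration.integral_cong) auto
  also have "\<dots> = (LINT s|\<mu>. (LINT w|\<Omega>. F (s ## w)))"
    using integral_fst'[OF int] by simp
  finally show ?thesis .
qed

text \<open>Markov property at time \<open>m\<close>: the increments after \<open>m\<close> may be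
  replaced by an independent copy of the stream.\<close>

lemma integral_markov:
  fixes F :: "real stream \<Rightarrow> 'b::{banach, second_countable_topology}"
  assumes "F \<in> borel_measurable \<Omega>" and "\<And>w. norm (F w) \<le> B"
  shows "(LINT w|\<Omega>. F w) = (LINT w|\<Omega>. (LINT w'|\<Omega>. F (stake m w @- w')))"
  using assms
proof (induction m arbitrary: F)
  case 0
  then show ?case by (simp add: path.prob_space)
next
  case (Suc m)
  note [measurable] = Suc.prems(1)
  have "(LINT w|\<Omega>. F w) = (LINT s|\<mu>. (LINT w|\<Omega>. F (s ## w)))"
    by (rule integral_first_step) fact+
  also have "\<dots> = (LINT s|\<mu>. (LINT w|\<Omega>. (LINT w'|\<Omega>. F (s ## stake m w @- w'))))"
  proof (rule Bochner_Integration.integral_cong[OF refl])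
    fix s
    show "(LINT w|\<Omega>. F (s ## w)) = (LINT w|\<Omega>. (LINT w'|\<Omega>. F (s ## stake m w @- w')))"
      by (rule Suc.IH) (use Suc.prems(2) in auto)
  qed
  also have "\<dots> = (LINT s|\<mu>. (LINT w|\<Omega>. (LINT w'|\<Omega>. F (stake (Suc m) (s ## w) @- w'))))"
    by simp
  also have "\<dots> = (LINT w|\<Omega>. (LINT w'|\<Omega>. F (stake (Suc m) w @- w')))"
  proof (rule integral_first_step[symmetric])
    show "(\<lambda>w. LINT w'|\<Omega>. F (stake (Suc m) w @- w')) \<in> borel_measurable \<Omega>"
      by (intro path.borel_measurable_lebesgue_integral) (unfold case_prod_beta, measurable)
    show "norm (LINT w'|\<Omega>. F (stake (Suc m) w @- w')) \<le> B" for w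
    proof (rule order.trans[OF integral_norm_bound])
      have "(LINT w'|\<Omega>. norm (F (stake (Suc m) w @- w'))) \<le> (LINT w'|\<Omega>. B)"
        using Suc.prems(2) order.trans[OF norm_ge_zero Suc.prems(2)]
        by (intro integral_mono path.integrable_const_bound[of _ B]) auto
      then show "(LINT w'|\<Omega>. norm (F (stake (Suc m) w @- w'))) \<le> B" by (simp add: path.prob_space)
    qed
  qed
  finally show ?case .
qed

text \<open>The transition operator of the walk. Complex values occur for characteristic
  functions.\<close>

definition step_avg :: "(real \<Rightarrow> 'b::{banach, second_countable_topology}) \<Rightarrow> real \<Rightarrow> 'b" where
  "step_avg f x = (LINT s|\<mu>. f (x + s))"

lemma integrable_step:
  fixes f :: "real \<Rightarrow> 'b::{banach, second_countable_topology}"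
  shows "bounded_borel f \<Longrightarrow> integrable \<mu> (\<lambda>s. f (x + s))"
  by (rule bounded_borel_integrable) (auto simp: finite_measure_axioms)

lemma step_avg_const [simp]: "step_avg (\<lambda>_. c) x = c"
  by (simp add: step_avg_def prob_space)

lemma step_avg_norm_le:
  assumes "bounded_borel f" "\<And>x. norm (f x) \<le> B" shows "norm (step_avg f x) \<le> B"
proof -
  have "norm (step_avg f x) \<le> (LINT s|\<mu>. norm (f (x + s)))"
    unfolding step_avg_def by (rule integral_norm_bound)
  also have "\<dots> \<le> (LINT s|\<mu>. B)"
    using integrable_step[OF assms(1)] assms(2) by (intro integral_mono) auto
  finally show ?thesis by (simp add: prob_space)
qed

lemma bounded_borel_step_avg [bb_intros]:
  assumes "bounded_borel f" shows "bounded_borel (step_avg f)"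
proof -
  note [measurable] = bounded_borel_measurable[OF assms]
  obtain B where B: "\<And>x. norm (f x) \<le> B" using assms unfolding bounded_borel_def by blast
  have "(\<lambda>x. LINT s|\<mu>. f (x + s)) \<in> borel_measurable borel"
    by (intro borel_measurable_lebesgue_integral) (unfold case_prod_beta, measurable)
  then have "step_avg f \<in> borel_measurable borel" by (simp add: step_avg_def[abs_def])
  then show ?thesis using step_avg_norm_le[OF assms B] by (rule bounded_borelI)
qed

lemma bounded_borel_step_avg_pow [bb_intros]: "bounded_borel f \<Longrightarrow> bounded_borel ((step_avg ^^ k) f)"
  by (induction k) (auto intro: bb_intros)

lemma step_avg_add:
  "bounded_borel f \<Longrightarrow> bounded_borel g \<Longrightarrow> step_avg (\<lambda>x. f x + g x) y = step_avg f y + step_avg g y"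
  unfolding step_avg_def by (intro Bochner_Integration.integral_add integrable_step)

lemma step_avg_diff:
  "bounded_borel f \<Longrightarrow> bounded_borel g \<Longrightarrow> step_avg (\<lambda>x. f x - g x) y = step_avg f y - step_avg g y"
  unfolding step_avg_def by (intro Bochner_Integration.integral_diff integrable_step)

lemma step_avg_cmult:
  fixes f :: "real \<Rightarrow> 'b::{banach, second_countable_topology, real_normed_field}"
  shows "step_avg (\<lambda>x. c * f x) y = c * step_avg f y"
  unfolding step_avg_def by simp

lemma step_avg_of_real:
  "bounded_borel f \<Longrightarrow> step_avg (\<lambda>x. of_real (f x) :: 'b::{banach, second_countable_topology, real_normed_field}) y
    = of_real (step_avg f y)"
  unfolding step_avg_def by (rule integral_of_real[OF integrable_step])

lemma step_avg_sum:
  "(\<And>i. i \<in> I \<Longrightarrow> bounded_borel (f i)) \<Longrightarrow> step_avg (\<lambda>x. \<Sum>i\<in>I. f i x) y = (\<Sum>i\<in>I. step_avg (f i) y)"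
  unfolding step_avg_def by (rule Bochner_Integration.integral_sum) (rule integrable_step, blast)

lemma step_avg_mono:
  fixes f g :: "real \<Rightarrow> real"
  shows "bounded_borel f \<Longrightarrow> bounded_borel g \<Longrightarrow> (\<And>x. f x \<le> g x) \<Longrightarrow> step_avg f y \<le> step_avg g y"
  unfolding step_avg_def using integrable_step[of f y] integrable_step[of g y] by (intro integral_mono) auto

lemma step_avg_cong: "(\<And>x. f x = g x) \<Longrightarrow> step_avg f y = step_avg g y"
  by (simp add: step_avg_def)

lemma step_avg_periodic: "(\<And>x. f (x + 1) = f x) \<Longrightarrow> step_avg f (x + 1) = step_avg f x"
proof -
  assume per: "\<And>x. f (x + 1) = f x"
  have "f (x + 1 + s) = f (x + s)" for s using per[of "x + s"] by (simp add: ac_simps)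
  then show ?thesis by (simp add: step_avg_def)
qed

lemma step_avg_pow_periodic:
  "(\<And>x. f (x + 1) = f x) \<Longrightarrow> (step_avg ^^ k) f (x + 1) = (step_avg ^^ k) f x"
  by (induction k arbitrary: x) (auto intro: step_avg_periodic)

lemma integral_walk_pos:
  assumes f: "bounded_borel f"
  shows "(LINT w|\<Omega>. f (walk_pos k x w)) = (step_avg ^^ k) f x"
proof (induction k arbitrary: x)
  case 0 show ?case by (simp add: path.prob_space)
next
  case (Suc k)
  obtain B where B: "\<And>x. norm (f x) \<le> B" using f unfolding bounded_borel_def by blast
  note [measurable] = bounded_borel_measurable[OF f]
  have "(LINT w|\<Omega>. f (walk_pos (Suc k) x w)) = (LINT s|\<mu>. (LINT w|\<Omega>. f (walk_pos (Suc k) x (s ## w))))"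
    by (rule integral_first_step[where B=B]) (measurable, rule B)
  then show ?case using Suc by (simp add: step_avg_def)
qed

lemma unif_integral_step_avg:
  fixes f :: "real \<Rightarrow> real"
  assumes f: "bounded_borel f" and per: "\<And>x. f (x + 1) = f x"
  shows "(LINT x|unif. step_avg f x) = (LINT x|unif. f x)"
proof -
  interpret pair_prob_space \<mu> unif ..
  note [measurable] = bounded_borel_measurable[OF f]
  obtain B where B: "\<And>x. norm (f x) \<le> B" using f unfolding bounded_borel_def by blast
  have int: "integrable (\<mu> \<Otimes>\<^sub>M unif) (\<lambda>(s, x). f (x + s))"
    using B by (intro P.integrable_const_bound[of _ B]) auto
  have "(LINT x|unif. step_avg f x) = (LINT s|\<mu>. (LINT x|unif. f (x + s)))"
    unfolding step_avg_def by (rule Fubini_integral[OF int])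
  also have "\<dots> = (LINT s|\<mu>. (LINT x|unif. f x))"
    using integral_unif_translate[of f, OF per] by (simp add: add.commute)
  finally show ?thesis by (simp add: prob_space)
qed

text \<open>Averages of translates have no more variation than the function itself, by the
  triangle inequality under the integral.\<close>

lemma unit_variation_le_step_avg:
  assumes f: "bounded_borel f" and K: "unit_variation_le K f"
  shows "unit_variation_le K (step_avg f)"
  unfolding unit_variation_le_def
proof (intro allI impI)
  fix n and p :: "nat \<Rightarrow> real" assume p: "mono_on {..n} p \<and> p n \<le> p 0 + 1"
  have int: "integrable \<mu> (\<lambda>s. \<bar>f (p (Suc i) + s) - f (p i + s)\<bar>)" for i
    using integrable_step[OF f] by (intro integrable_abs Bochner_Integration.integrable_diff)
  have "(\<Sum>i<n. \<bar>step_avg f (p (Suc i)) - step_avg f (p i)\<bar>)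
      \<le> (\<Sum>i<n. LINT s|\<mu>. \<bar>f (p (Suc i) + s) - f (p i + s)\<bar>)"
  proof (intro sum_mono)
    fix i
    have "step_avg f (p (Suc i)) - step_avg f (p i) = (LINT s|\<mu>. f (p (Suc i) + s) - f (p i + s))"
      unfolding step_avg_def using integrable_step[OF f] by simp
    then show "\<bar>step_avg f (p (Suc i)) - step_avg f (p i)\<bar> \<le> (LINT s|\<mu>. \<bar>f (p (Suc i) + s) - f (p i + s)\<bar>)"
      using integral_abs_bound by simp
  qed
  also have "\<dots> = (LINT s|\<mu>. (\<Sum>i<n. \<bar>f (p (Suc i) + s) - f (p i + s)\<bar>))"
    using int by simp
  also have "\<dots> \<le> (LINT s|\<mu>. K)"
  proof (rule integral_mono)
    fix s show "(\<Sum>i<n. \<bar>f (p (Suc i) + s) - f (p i + s)\<bar>) \<le> K"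
      using unit_variation_leD[OF unit_variation_le_translate[OF K, of s], of n p] p
      by (simp add: add.commute)
  qed (use int in auto)
  finally show "(\<Sum>i<n. \<bar>step_avg f (p (Suc i)) - step_avg f (p i)\<bar>) \<le> K"
    by (simp add: prob_space)
qed

lemma unit_variation_le_step_avg_pow:
  "bounded_borel f \<Longrightarrow> unit_variation_le K f \<Longrightarrow> unit_variation_le K ((step_avg ^^ k) f)"
  by (induction k) (auto intro: unit_variation_le_step_avg bb_intros)

end

section \<open>Mixing, the corrector and perturbed eigenfunctions\<close>

lemma exp_quadratic_remainder:
  fixes z :: "'b::{real_normed_field, banach}"
  shows "norm (exp z - (1 + z + z ^ 2 / 2)) \<le> norm z ^ 3 * exp (norm z)"
proof -
  let ?t = "\<lambda>n. inverse (fact (n + 3)) *\<^sub>R z ^ (n + 3)"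
  have "exp z = (\<Sum>n<3. inverse (fact n) *\<^sub>R z ^ n) + (\<Sum>n. ?t n)"
    by (rule exp_first_terms)
  also have "(\<Sum>n<3. inverse (fact n) *\<^sub>R z ^ n) = 1 + z + z ^ 2 / 2"
    by (simp add: eval_nat_numeral scaleR_conv_of_real)
  finally have eq: "exp z - (1 + z + z ^ 2 / 2) = (\<Sum>n. ?t n)" by simp
  have le: "norm (?t n) \<le> norm z ^ 3 * (inverse (fact n) *\<^sub>R norm z ^ n)" for n
  proof -
    have "(fact n :: real) \<le> fact (n + 3)" by (intro fact_mono) simp
    then have "inverse (fact (n + 3)) \<le> (inverse (fact n) :: real)"
      by (intro le_imp_inverse_le) auto
    then have "inverse (fact (n + 3)) * (norm z ^ n * norm z ^ 3) \<le> inverse (fact n) * (norm z ^ n * norm z ^ 3)"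
      by (intro mult_right_mono) auto
    moreover have "norm (?t n) = inverse (fact (n + 3)) * (norm z ^ n * norm z ^ 3)"
      unfolding norm_scaleR power_add norm_mult norm_power by simp
    ultimately show ?thesis by (simp add: mult_ac)
  qed
  have s: "summable (\<lambda>n. norm z ^ 3 * (inverse (fact n) *\<^sub>R norm z ^ n))"
    by (intro summable_mult summable_exp_generic)
  have "norm (\<Sum>n. ?t n) \<le> (\<Sum>n. norm (?t n))"
    by (rule summable_norm) (rule summable_comparison_test'[OF s, of 0], use le in auto)
  also have "\<dots> \<le> (\<Sum>n. norm z ^ 3 * (inverse (fact n) *\<^sub>R norm z ^ n))"
    by (rule suminf_le[OF le _ s]) (rule summable_comparison_test'[OF s, of 0], use le in auto)
  also have "\<dots> = norm z ^ 3 * exp (norm z)"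
    unfolding exp_def by (rule suminf_mult) (rule summable_exp_generic)
  finally show ?thesis unfolding eq .
qed

text \<open>Second-order expansion of \<open>e\<^sup>z\<^sup>u (1 + z a + z\<^sup>2 b)\<close>
  with an explicit cubic error. The field is left open so that it serves both for characteristic
  functions (complex \<open>z\<close>) and for moment generating functions (real
  \<open>z\<close>).\<close>

lemma tilted_expansion:
  fixes z :: "'b::{real_normed_field, banach}" and a b u :: real
  assumes B: "\<bar>u\<bar> \<le> B" "\<bar>a\<bar> \<le> B" "\<bar>b\<bar> \<le> B" and z: "norm z \<le> 1"
  shows "norm (exp (z * of_real u) * (1 + z * of_real a + z ^ 2 * of_real b)
      - (1 + z * of_real (u + a) + z ^ 2 * of_real (u ^ 2 / 2 + u * a + b)))
    \<le> norm z ^ 3 * (B ^ 3 * exp B * (1 + B + B) + (B * B + B ^ 2 * B) + B ^ 2 * B)"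
proof -
  define E where "E = exp (z * of_real u) - (1 + z * of_real u + (z * of_real u) ^ 2 / 2)"
  define g :: 'b where "g = 1 + z * of_real a + z ^ 2 * of_real b"
  have B0: "0 \<le> B" using B(1) by linarith
  have "norm E \<le> norm (z * of_real u) ^ 3 * exp (norm (z * of_real u))"
    unfolding E_def by (rule exp_quadratic_remainder)
  also have "\<dots> = norm z ^ 3 * (\<bar>u\<bar> ^ 3 * exp (norm z * \<bar>u\<bar>))"
    by (simp add: norm_mult power_mult_distrib)
  also have "\<dots> \<le> norm z ^ 3 * (B ^ 3 * exp B)"
    using B(1) B0 z mult_mono[of "norm z" 1 "\<bar>u\<bar>" B]
    by (intro mult_left_mono mult_mono power_mono) auto
  finally have E: "norm E \<le> norm z ^ 3 * (B ^ 3 * exp B)" .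
  have g: "norm g \<le> 1 + B + B"
  proof -
    have "norm g \<le> norm (1 + z * of_real a) + norm (z ^ 2 * of_real b)"
      unfolding g_def by (rule norm_triangle_ineq)
    also have "\<dots> \<le> norm (1::'b) + norm (z * of_real a) + norm (z ^ 2 * of_real b)"
      by (intro add_right_mono norm_triangle_ineq)
    also have "norm (z * of_real a) \<le> 1 * B"
      unfolding norm_mult using B z B0 by (intro mult_mono) auto
    also have "norm (z ^ 2 * of_real b) \<le> 1 * B"
      unfolding norm_mult norm_power using B z B0 by (intro mult_mono power_le_one) auto
    finally show ?thesis by simp
  qed
  have eq: "exp (z * of_real u) * g
      - (1 + z * of_real (u + a) + z ^ 2 * of_real (u ^ 2 / 2 + u * a + b))
      = E * g + z ^ 3 * of_real (u * b + u ^ 2 * a / 2) + z ^ 4 * of_real (u ^ 2 * b / 2)"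
  proof -
    have "exp (z * of_real u) = E + (1 + z * of_real u + (z * of_real u) ^ 2 / 2)"
      by (simp add: E_def)
    then have "exp (z * of_real u) * g = E * g + (1 + z * of_real u + (z * of_real u) ^ 2 / 2) * g"
      by (simp add: distrib_right)
    moreover have "(1 + z * of_real u + (z * of_real u) ^ 2 / 2) * g
      = (1 + z * of_real (u + a) + z ^ 2 * of_real (u ^ 2 / 2 + u * a + b))
      + z ^ 3 * of_real (u * b + u ^ 2 * a / 2) + z ^ 4 * of_real (u ^ 2 * b / 2)"
      unfolding g_def by (simp add: field_simps power2_eq_square power3_eq_cube power4_eq_xxxx)
    ultimately show ?thesis by simp
  qed
  have "norm (E * g + z ^ 3 * of_real (u * b + u ^ 2 * a / 2) + z ^ 4 * of_real (u ^ 2 * b / 2))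
    \<le> norm (E * g) + norm (z ^ 3 * of_real (u * b + u ^ 2 * a / 2) :: 'b) + norm (z ^ 4 * of_real (u ^ 2 * b / 2) :: 'b)"
    by (intro norm_triangle_le add_right_mono order_refl norm_triangle_ineq)
  also have "norm (E * g) \<le> norm z ^ 3 * (B ^ 3 * exp B) * (1 + B + B)"
    unfolding norm_mult using E g B0 by (intro mult_mono) auto
  also have "norm (z ^ 3 * of_real (u * b + u ^ 2 * a / 2) :: 'b) \<le> norm z ^ 3 * (B * B + B ^ 2 * B)"
  proof -
    have "\<bar>u * b + u ^ 2 * a / 2\<bar> \<le> \<bar>u * b\<bar> + \<bar>u ^ 2 * a\<bar> / 2"
      by (rule order.trans[OF abs_triangle_ineq]) simp
    also have "\<dots> \<le> \<bar>u * b\<bar> + \<bar>u ^ 2 * a\<bar>" by simp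
    also have "\<dots> \<le> B * B + B ^ 2 * B"
      unfolding abs_mult power_abs using B B0 by (intro add_mono mult_mono power_mono) auto
    finally show ?thesis
      unfolding norm_mult norm_power norm_of_real by (intro mult_left_mono) auto
  qed
  also have "norm (z ^ 4 * of_real (u ^ 2 * b / 2) :: 'b) \<le> norm z ^ 3 * (B ^ 2 * B)"
  proof -
    have "\<bar>u ^ 2 * b / 2\<bar> \<le> \<bar>u ^ 2 * b\<bar>" by simp
    also have "\<dots> \<le> B ^ 2 * B"
      unfolding abs_mult power_abs using B B0 by (intro mult_mono power_mono) auto
    finally show ?thesis
      unfolding norm_mult norm_power norm_of_real using z by (intro mult_mono power_decreasing) auto
  qed
  finally show ?thesis unfolding eq[unfolded g_def] g_def by (simp add: algebra_simps)
qed

context random_walk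
begin

lemma step_avg_pow_diff:
  "bounded_borel f \<Longrightarrow> bounded_borel g \<Longrightarrow>
    (step_avg ^^ k) (\<lambda>x. f x - g x) y = (step_avg ^^ k) f y - (step_avg ^^ k) g y"
proof (induction k arbitrary: y)
  case (Suc k)
  have "(step_avg ^^ Suc k) (\<lambda>x. f x - g x) y = step_avg (\<lambda>x. (step_avg ^^ k) f x - (step_avg ^^ k) g x) y"
    unfolding funpow.simps comp_def by (rule step_avg_cong) (rule Suc.IH[OF Suc.prems])
  also have "\<dots> = (step_avg ^^ Suc k) f y - (step_avg ^^ Suc k) g y"
    using Suc.prems by (simp add: step_avg_diff bounded_borel_step_avg_pow)
  finally show ?case .
qed simp

lemma step_avg_pow_norm_le:
  assumes "bounded_borel f" "\<And>x. norm (f x) \<le> B" shows "norm ((step_avg ^^ k) f x) \<le> B"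
proof (induction k arbitrary: x)
  case (Suc k)
  then show ?case using step_avg_norm_le[of "(step_avg ^^ k) f" B x] assms(1)
    by (simp add: bounded_borel_step_avg_pow)
qed (simp add: assms)

text \<open>Uniform convergence of \<open>P\<^sup>n g\<close> to the mean, without a rate. Unlike
  bounded variation this is closed under uniform limits, and it is all that the second-order
  corrector needs.\<close>

definition mixing :: "(real \<Rightarrow> real) \<Rightarrow> bool" where
  "mixing g \<longleftrightarrow> bounded_borel g \<and> (\<forall>x. g (x + 1) = g x) \<and>
    (\<forall>\<epsilon>>0. \<exists>n0. \<forall>n\<ge>n0. \<forall>x. \<bar>(step_avg ^^ n) g x - (LINT y|unif. g y)\<bar> \<le> \<epsilon>)"

lemma mixing_uniform_limit:
  assumes g: "bounded_borel g" and per: "\<And>x. g (x + 1) = g x"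
    and approx: "\<And>\<epsilon>. 0 < \<epsilon> \<Longrightarrow> \<exists>h. mixing h \<and> (\<forall>x. \<bar>g x - h x\<bar> \<le> \<epsilon>)"
  shows "mixing g"
  unfolding mixing_def
proof (intro conjI allI impI g per)
  fix \<epsilon> :: real assume "0 < \<epsilon>"
  then obtain h where h: "mixing h" and gh: "\<And>x. \<bar>g x - h x\<bar> \<le> \<epsilon> / 3"
    using approx[of "\<epsilon> / 3"] by auto
  have hb: "bounded_borel h" using h by (simp add: mixing_def)
  obtain n0 where n0: "\<And>n x. n \<ge> n0 \<Longrightarrow> \<bar>(step_avg ^^ n) h x - (LINT y|unif. h y)\<bar> \<le> \<epsilon> / 3"
    using h \<open>0 < \<epsilon>\<close> unfolding mixing_def by (meson divide_pos_pos zero_less_numeral)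
  have d1: "\<bar>(step_avg ^^ n) g x - (step_avg ^^ n) h x\<bar> \<le> \<epsilon> / 3" for n x
    using step_avg_pow_norm_le[OF bounded_borel_diff[OF g hb], of "\<epsilon> / 3" n x] gh
    by (simp add: step_avg_pow_diff[OF g hb])
  have d2: "\<bar>(LINT y|unif. g y) - (LINT y|unif. h y)\<bar> \<le> \<epsilon> / 3"
  proof -
    have "(LINT y|unif. g y) - (LINT y|unif. h y) = (LINT y|unif. g y - h y)"
      using g hb by (simp add: bounded_borel_unif_integrable)
    also have "\<bar>\<dots>\<bar> \<le> (LINT y|unif. \<bar>g y - h y\<bar>)" by (rule integral_abs_bound)
    also have "\<dots> \<le> (LINT y|unif. \<epsilon> / 3)"
      using g hb gh by (intro integral_mono integrable_abs Bochner_Integration.integrable_diff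
          bounded_borel_unif_integrable bounded_borel_const) auto
    finally show ?thesis using unif.prob_space by simp
  qed
  have "\<bar>(step_avg ^^ n) g x - (LINT y|unif. g y)\<bar> \<le> \<epsilon>" if "n \<ge> n0" for n x
    using n0[OF that, of x] d1[of n x] d2 unfolding abs_le_iff by linarith
  then show "\<exists>n0. \<forall>n\<ge>n0. \<forall>x. \<bar>(step_avg ^^ n) g x - (LINT y|unif. g y)\<bar> \<le> \<epsilon>" by blast
qed

end

locale equidistributed_walk = random_walk +
  fixes \<psi> :: "nat \<Rightarrow> real"
  assumes summable_\<psi>: "summable \<psi>"
    and discrepancy_le: "\<And>k t. 0 \<le> t \<Longrightarrow> t \<le> 1 \<Longrightarrow>
      \<bar>measure \<Omega> {w\<in>space \<Omega>. frac (walk_pos k 0 w) \<le> t} - t\<bar> \<le> \<psi> k"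
begin

text \<open>Koksma's inequality applied to the translate of \<open>f\<close> by the starting
  point, whose variation and mean are those of \<open>f\<close>.\<close>

lemma step_avg_pow_rate:
  assumes per: "\<And>x. f (x + 1) = f x" and K: "unit_variation_le K f"
  shows "\<bar>(step_avg ^^ k) f x - (LINT y|unif. f y)\<bar> \<le> 3 * K * \<psi> k"
proof -
  note [measurable] = borel_measurable_unit_variation[of f, OF per K]
  have bb: "bounded_borel f"
    by (rule bounded_borelI[of _ "\<bar>f 0\<bar> + K"]) (use unit_variation_bounded[of f, OF per K] in auto)
  have "\<bar>(LINT w|\<Omega>. f (x + walk_pos k 0 w)) - (LINT y|unif. f (x + y))\<bar> \<le> 3 * K * \<psi> k"
  proof (rule koksma[where f = "\<lambda>y. f (x + y)"])
    show "prob_space \<Omega>" by (rule path.prob_space_axioms)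
    show "(\<lambda>w. walk_pos k 0 w) \<in> borel_measurable \<Omega>" by measurable
    show "f (x + (y + 1)) = f (x + y)" for y using per[of "x + y"] by (simp add: add.assoc)
  qed (use discrepancy_le unit_variation_le_translate[OF K] in auto)
  also have "(LINT w|\<Omega>. f (x + walk_pos k 0 w)) = (step_avg ^^ k) f x"
    using integral_walk_pos[OF bb, of k x] by (simp add: walk_pos_shift[of k x])
  also have "(LINT y|unif. f (x + y)) = (LINT y|unif. f y)"
    by (rule integral_unif_translate[of f, OF per]) simp
  finally show ?thesis .
qed

lemma unit_variation_mixing:
  assumes per: "\<And>x. f (x + 1) = f x" and K: "unit_variation_le K f"
  shows "mixing f"
  unfolding mixing_def
proof (intro conjI allI impI per)
  show "bounded_borel f" using unit_variation_bounded_borel[of f, OF per K] .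
  fix \<epsilon> :: real assume "0 < \<epsilon>"
  have "(\<lambda>k. 3 * K * \<psi> k) \<longlonglongrightarrow> 3 * K * 0"
    by (intro tendsto_intros summable_LIMSEQ_zero summable_\<psi>)
  then have "eventually (\<lambda>k. 3 * K * \<psi> k < \<epsilon>) sequentially"
    using \<open>0 < \<epsilon>\<close> by (intro order_tendstoD(2)) auto
  then obtain n0 where "\<And>n. n \<ge> n0 \<Longrightarrow> 3 * K * \<psi> n < \<epsilon>"
    unfolding eventually_sequentially by blast
  then show "\<exists>n0. \<forall>n\<ge>n0. \<forall>x. \<bar>(step_avg ^^ n) f x - (LINT y|unif. f y)\<bar> \<le> \<epsilon>"
    using step_avg_pow_rate[of f, OF per K] by (meson order.trans less_imp_le)
qed

end

locale centered_observable = equidistributed_walk +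
  fixes f :: "real \<Rightarrow> real" and K :: real
  assumes periodic: "\<And>x. f (x + 1) = f x"
    and variation: "unit_variation_le K f"
    and centered: "(LINT x|unif. f x) = 0"
begin

lemma bounded_borel_f [bb_intros]: "bounded_borel f"
  using unit_variation_bounded_borel[of f, OF periodic variation] .

lemma measurable_f [measurable]: "f \<in> borel_measurable borel"
  by (rule bounded_borel_measurable[OF bounded_borel_f])

lemma step_avg_pow_f_le: "\<bar>(step_avg ^^ k) f x\<bar> \<le> 3 * K * \<psi> k"
  using step_avg_pow_rate[of f, OF periodic variation] centered by simp

text \<open>The solution \<open>a\<close> of the Poisson equation \<open>P (f + a) = a\<close>.
  The term \<open>k = 0\<close> is left out because the sums below start at time 1.\<close>

definition corrector :: "real \<Rightarrow> real" where
  "corrector x = (\<Sum>k. (step_avg ^^ Suc k) f x)"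

lemma summable_step_avg_pow: "summable (\<lambda>k. \<bar>(step_avg ^^ Suc k) f x\<bar>)"
proof (rule summable_comparison_test'[of "\<lambda>k. 3 * K * \<psi> (Suc k)" 0])
  show "summable (\<lambda>k. 3 * K * \<psi> (Suc k))"
    using summable_\<psi> by (intro summable_mult) (simp add: summable_Suc_iff)
qed (use step_avg_pow_f_le in \<open>auto simp del: funpow.simps\<close>)

lemma summable_step_avg_pow': "summable (\<lambda>k. (step_avg ^^ Suc k) f x)"
  using summable_step_avg_pow by (rule summable_rabs_cancel)

lemma corrector_tail:
  "\<bar>corrector x - (\<Sum>k<n. (step_avg ^^ Suc k) f x)\<bar> \<le> (\<Sum>k. 3 * K * \<psi> (Suc (k + n)))"
proof -
  have s: "summable (\<lambda>k. 3 * K * \<psi> (Suc (k + n)))"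
    using summable_\<psi> by (intro summable_mult) (simp add: summable_iff_shift flip: add_Suc_right)
  have "corrector x - (\<Sum>k<n. (step_avg ^^ Suc k) f x) = (\<Sum>k. (step_avg ^^ Suc (k + n)) f x)"
    unfolding corrector_def
    by (subst suminf_split_initial_segment[OF summable_step_avg_pow', of _ n]) simp
  also have "\<bar>\<dots>\<bar> \<le> (\<Sum>k. \<bar>(step_avg ^^ Suc (k + n)) f x\<bar>)"
    by (rule summable_rabs) (rule summable_ignore_initial_segment[OF summable_step_avg_pow])
  also have "\<dots> \<le> (\<Sum>k. 3 * K * \<psi> (Suc (k + n)))"
    by (rule suminf_le[OF step_avg_pow_f_le _ s])
       (rule summable_ignore_initial_segment[OF summable_step_avg_pow])
  finally show ?thesis .
qed

lemma corrector_approx: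
  assumes "0 < \<epsilon>"
  obtains n where "\<And>x. \<bar>corrector x - (\<Sum>k<n. (step_avg ^^ Suc k) f x)\<bar> \<le> \<epsilon>"
proof -
  have "summable (\<lambda>k. 3 * K * \<psi> (Suc k))"
    using summable_\<psi> by (intro summable_mult) (simp add: summable_Suc_iff)
  from suminf_exist_split[OF assms this] obtain n where
    "norm (\<Sum>k. 3 * K * \<psi> (Suc (k + n))) < \<epsilon>" by blast
  then have le: "(\<Sum>k. 3 * K * \<psi> (Suc (k + n))) \<le> \<epsilon>"
    unfolding real_norm_def by linarith
  show ?thesis by (rule that) (rule order.trans[OF corrector_tail le])
qed

lemma bounded_borel_corrector [bb_intros]: "bounded_borel corrector"
proof (rule bounded_borelI)
  show "norm (corrector x) \<le> (\<Sum>k. 3 * K * \<psi> (Suc (k + 0)))" for x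
    using corrector_tail[of x 0] by simp
  have [measurable]: "(\<lambda>x. (step_avg ^^ Suc k) f x) \<in> borel_measurable borel" for k
    by (rule bounded_borel_measurable) (rule bb_intros)+
  show "corrector \<in> borel_measurable borel"
    unfolding corrector_def[abs_def] by measurable
qed

lemma corrector_periodic: "corrector (x + 1) = corrector x"
  unfolding corrector_def using step_avg_pow_periodic[of f, OF periodic] by (simp del: funpow.simps)

lemma summable_step_avg_integrals:
  "summable (\<lambda>k. LINT s|\<mu>. norm ((step_avg ^^ Suc k) f (x + s)))"
proof (rule summable_comparison_test'[of "\<lambda>k. 3 * K * \<psi> (Suc k)" 0])
  show "summable (\<lambda>k. 3 * K * \<psi> (Suc k))"
    using summable_\<psi> by (intro summable_mult) (simp add: summable_Suc_iff)
  fix k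
  have "(LINT s|\<mu>. norm ((step_avg ^^ Suc k) f (x + s))) \<le> (LINT s|\<mu>. 3 * K * \<psi> (Suc k))"
    using step_avg_pow_f_le integrable_step[OF bounded_borel_step_avg_pow[OF bounded_borel_f], of "Suc k" x]
    by (intro integral_mono integrable_norm) (auto simp del: funpow.simps)
  then show "norm (LINT s|\<mu>. norm ((step_avg ^^ Suc k) f (x + s))) \<le> 3 * K * \<psi> (Suc k)"
    by (simp del: funpow.simps)
qed

lemma step_avg_corrector: "step_avg corrector x = corrector x - step_avg f x"
proof -
  have "step_avg corrector x = (LINT s|\<mu>. (\<Sum>k. (step_avg ^^ Suc k) f (x + s)))"
    unfolding step_avg_def[of corrector] corrector_def ..
  also have "\<dots> = (\<Sum>k. LINT s|\<mu>. (step_avg ^^ Suc k) f (x + s))"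
    using summable_step_avg_pow summable_step_avg_integrals
      integrable_step[OF bounded_borel_step_avg_pow[OF bounded_borel_f]]
    by (intro integral_suminf) (auto simp del: funpow.simps)
  also have "\<dots> = (\<Sum>k. (step_avg ^^ Suc (Suc k)) f x)"
    by (simp add: step_avg_def)
  also have "\<dots> = corrector x - (step_avg ^^ Suc 0) f x"
    unfolding corrector_def using suminf_split_head[OF summable_step_avg_pow'] by simp
  finally show ?thesis by simp
qed

lemma poisson: "step_avg (\<lambda>x. f x + corrector x) y = corrector y"
  by (simp add: step_avg_add bounded_borel_f bounded_borel_corrector step_avg_corrector)

text \<open>The coefficient of \<open>z\<^sup>2\<close> in \<open>e\<^sup>z\<^sup>f (1 + z
  a)\<close>.\<close>

definition quad :: "real \<Rightarrow> real" where
  "quad x = f x ^ 2 / 2 + f x * corrector x"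

definition sigma2 :: real where
  "sigma2 = (LINT x|unif. f x ^ 2 + 2 * (f x * corrector x))"

lemma bounded_borel_quad [bb_intros]: "bounded_borel quad"
  unfolding quad_def[abs_def] by (intro bb_intros)

lemma integral_quad: "(LINT x|unif. quad x) = sigma2 / 2"
proof -
  have "quad = (\<lambda>x. (f x ^ 2 + 2 * (f x * corrector x)) / 2)" by (auto simp: quad_def)
  then show ?thesis by (simp add: sigma2_def del: add_divide_distrib)
qed

text \<open>The corrector need not be of bounded variation, but its partial sums are. Hence
  \<open>quad\<close> is a uniform limit of functions of bounded variation, which are
  mixing.\<close>

lemma mixing_quad: "mixing quad"
proof (rule mixing_uniform_limit)
  show "bounded_borel quad" by (rule bb_intros)
  show "quad (x + 1) = quad x" for x by (simp add: quad_def periodic corrector_periodic)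
  fix \<epsilon> :: real assume "0 < \<epsilon>"
  obtain B where B: "B > 0" "\<And>x. norm (f x) \<le> B" by (rule bounded_borel_bound[OF bounded_borel_f]) blast
  \<comment> \<open>\<open>quad = f (f / 2 + a)\<close>, so an error \<open>\<epsilon> / B\<close>
    in \<open>a\<close> becomes at most \<open>\<epsilon>\<close>.\<close>
  obtain n where n: "\<And>x. \<bar>corrector x - (\<Sum>k<n. (step_avg ^^ Suc k) f x)\<bar> \<le> \<epsilon> / B"
    using corrector_approx[of "\<epsilon> / B"] \<open>0 < \<epsilon>\<close> B by auto
  define g where "g x = f x / 2 + (\<Sum>k<n. (step_avg ^^ Suc k) f x)" for x
  have gb: "bounded_borel g" unfolding g_def[abs_def] by (intro bb_intros)
  obtain C where C: "\<And>x. norm (g x) \<le> C" by (rule bounded_borel_bound[OF gb]) blast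
  have sumv: "\<exists>L. unit_variation_le L (\<lambda>x. \<Sum>k<m. (step_avg ^^ Suc k) f x)" for m
  proof (induction m)
    case 0 show ?case by (rule exI[of _ 0]) (simp add: unit_variation_le_def)
  next
    case (Suc m)
    then obtain L where "unit_variation_le L (\<lambda>x. \<Sum>k<m. (step_avg ^^ Suc k) f x)" by blast
    from unit_variation_le_add[OF this unit_variation_le_step_avg_pow[OF bounded_borel_f variation, of "Suc m"]]
    show ?case by auto
  qed
  then obtain L where L: "unit_variation_le L (\<lambda>x. \<Sum>k<n. (step_avg ^^ Suc k) f x)" by blast
  have "unit_variation_le ((1/2) * K + B * 0) (\<lambda>x. f x * (1/2))"
    by (rule unit_variation_le_mult[OF variation]) (use B in \<open>auto simp: unit_variation_le_def\<close>)
  from unit_variation_le_add[OF this L] obtain L' where L': "unit_variation_le L' g"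
    by (auto simp: g_def[abs_def])
  have vg: "unit_variation_le (C * K + B * L') (\<lambda>x. f x * g x)"
    by (rule unit_variation_le_mult[OF variation _ L']) (use B C in auto)
  have "mixing (\<lambda>x. f x * g x)"
    by (rule unit_variation_mixing[OF _ vg])
       (simp add: g_def periodic step_avg_pow_periodic[of f, OF periodic] del: funpow.simps)
  moreover have "\<bar>quad x - f x * g x\<bar> \<le> \<epsilon>" for x
  proof -
    have "quad x - f x * g x = f x * (corrector x - (\<Sum>k<n. (step_avg ^^ Suc k) f x))"
      by (simp add: quad_def g_def power2_eq_square algebra_simps del: funpow.simps)
    also have "\<bar>\<dots>\<bar> \<le> B * (\<epsilon> / B)"
      unfolding abs_mult using B n[of x] by (intro mult_mono) auto
    finally show ?thesis using B by simp
  qed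
  ultimately show "\<exists>h. mixing h \<and> (\<forall>x. \<bar>quad x - h x\<bar> \<le> \<epsilon>)" by blast
qed

text \<open>The finite sum \<open>b = P q + \<dots> + P\<^sup>n q\<close> with \<open>q =
  quad\<close> telescopes: \<open>P (q + b) - b = P\<^sup>n\<^sup>+\<^sup>1 q\<close>, which is
  uniformly close to the mean \<open>\<sigma>\<^sup>2 / 2\<close> of \<open>q\<close>. The sum is
  finite because the convergence in \<open>mixing_quad\<close> comes without a rate.\<close>

lemma second_corrector:
  assumes "0 < \<epsilon>"
  obtains b where "bounded_borel b"
    "\<And>x. \<bar>step_avg (\<lambda>y. quad y + b y) x - (b x + sigma2 / 2)\<bar> \<le> \<epsilon>"
proof -
  obtain n where n: "\<And>m x. m \<ge> n \<Longrightarrow> \<bar>(step_avg ^^ m) quad x - sigma2 / 2\<bar> \<le> \<epsilon>"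
    using mixing_quad assms unfolding mixing_def integral_quad by blast
  define b where "b x = (\<Sum>k<n. (step_avg ^^ Suc k) quad x)" for x
  have bb: "bounded_borel b" unfolding b_def[abs_def] by (intro bb_intros)
  moreover have "\<bar>step_avg (\<lambda>y. quad y + b y) x - (b x + sigma2 / 2)\<bar> \<le> \<epsilon>" for x
  proof -
    have "step_avg b x = (\<Sum>k<n. (step_avg ^^ Suc (Suc k)) quad x)"
      unfolding b_def[abs_def] by (subst step_avg_sum) (auto intro: bb_intros)
    moreover have "(\<Sum>k<Suc n. (step_avg ^^ Suc k) quad x)
        = step_avg quad x + (\<Sum>k<n. (step_avg ^^ Suc (Suc k)) quad x)"
      by (subst sum.lessThan_Suc_shift) simp
    ultimately have "step_avg (\<lambda>y. quad y + b y) x = b x + (step_avg ^^ Suc n) quad x"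
      by (simp add: step_avg_add[OF bounded_borel_quad bb]) (simp add: b_def)
    then show ?thesis using n[of "Suc n" x] by simp
  qed
  ultimately show ?thesis by (rule that)
qed

definition perturbed :: "(real \<Rightarrow> real) \<Rightarrow> 'b \<Rightarrow> real \<Rightarrow> 'b::{real_normed_field, banach, second_countable_topology}" where
  "perturbed b z x = 1 + z * of_real (corrector x) + z ^ 2 * of_real (b x)"

text \<open>The function \<open>b\<close> is chosen before the scalar \<open>z\<close>, so that
  for fixed \<open>\<epsilon>\<close> the error is small relative to \<open>z\<^sup>2\<close>
  uniformly in \<open>x\<close>.\<close>

lemma perturbed_eigenfunction:
  assumes "0 < \<epsilon>"
  obtains b where "bounded_borel b"
    "\<exists>r>0. \<forall>(z :: 'b::{real_normed_field, banach, second_countable_topology}) x. norm z \<le> r \<longrightarrow>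
      norm (step_avg (\<lambda>y. exp (z * of_real (f y)) * perturbed b z y) x
        - (1 + z ^ 2 * of_real (sigma2 / 2)) * perturbed b z x) \<le> \<epsilon> * norm z ^ 2"
proof -
  obtain b where b: "bounded_borel b"
    and be: "\<And>x. \<bar>step_avg (\<lambda>y. quad y + b y) x - (b x + sigma2 / 2)\<bar> \<le> \<epsilon> / 2"
    using second_corrector[of "\<epsilon> / 2"] assms by (metis half_gt_zero)
  obtain B1 where B1: "B1 > 0" "\<And>x. norm (f x) \<le> B1" by (rule bounded_borel_bound[OF bounded_borel_f]) blast
  obtain B2 where B2: "B2 > 0" "\<And>x. norm (corrector x) \<le> B2" by (rule bounded_borel_bound[OF bounded_borel_corrector]) blast
  obtain B3 where B3: "B3 > 0" "\<And>x. norm (b x) \<le> B3" by (rule bounded_borel_bound[OF b]) blast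
  define B where "B = B1 + B2 + B3"
  have B: "B > 0" "\<bar>f x\<bar> \<le> B" "\<bar>corrector x\<bar> \<le> B" "\<bar>b x\<bar> \<le> B" for x
    using B1(1) B1(2)[of x] B2(1) B2(2)[of x] B3(1) B3(2)[of x] by (auto simp: B_def)
  define C where "C = B ^ 3 * exp B * (1 + B + B) + (B * B + B ^ 2 * B) + B ^ 2 * B"
  define s where "s = sigma2 / 2"
  define D where "D = C + 2 * \<bar>s\<bar> * B"
  have C: "0 \<le> C" using B(1) by (simp add: C_def)
  have D: "0 \<le> D" using C B(1) by (simp add: D_def)
  define r where "r = min 1 (\<epsilon> / 2 / (D + 1))"
  have r: "0 < r" "r \<le> 1" "r * D \<le> \<epsilon> / 2"
  proof -
    show "0 < r" "r \<le> 1" using assms D by (auto simp: r_def)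
    have "r * D \<le> \<epsilon> / 2 / (D + 1) * D" using D by (intro mult_right_mono) (auto simp: r_def)
    also have "\<dots> \<le> \<epsilon> / 2" using D assms by (simp add: field_simps)
    finally show "r * D \<le> \<epsilon> / 2" .
  qed
  have "norm (step_avg (\<lambda>y. exp (z * of_real (f y)) * perturbed b z y) x
        - (1 + z ^ 2 * of_real s) * perturbed b z x) \<le> \<epsilon> * norm z ^ 2"
    if z: "norm z \<le> r" for z :: 'b and x
  proof -
    define M where "M y = 1 + z * of_real (f y + corrector y) + z ^ 2 * of_real (quad y + b y)" for y
    define R where "R y = exp (z * of_real (f y)) * perturbed b z y - M y" for y
    have z1: "norm z \<le> 1" using z r by linarith
    have Mb: "bounded_borel M" unfolding M_def[abs_def] using b by (intro bb_intros)
    have Eb: "bounded_borel (\<lambda>y. exp (z * of_real (f y)) * perturbed b z y)"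
      unfolding perturbed_def using b by (intro bb_intros)
    have Rb: "bounded_borel R" unfolding R_def[abs_def] by (intro bb_intros Mb Eb)
    have Rle: "norm (R y) \<le> norm z ^ 3 * C" for y
      unfolding R_def M_def perturbed_def quad_def C_def
      by (rule tilted_expansion) (use B z1 in auto)
    have "step_avg M x = 1 + z * of_real (corrector x) + z ^ 2 * of_real (step_avg (\<lambda>y. quad y + b y) x)"
      unfolding M_def[abs_def] using b
      by (simp only: step_avg_add step_avg_cmult step_avg_of_real step_avg_const poisson bb_intros)
    moreover have "step_avg (\<lambda>y. exp (z * of_real (f y)) * perturbed b z y) x = step_avg M x + step_avg R x"
      using step_avg_add[OF Mb Rb, of x] by (simp add: R_def)
    ultimately have "step_avg (\<lambda>y. exp (z * of_real (f y)) * perturbed b z y) x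
        - (1 + z ^ 2 * of_real s) * perturbed b z x
      = z ^ 2 * of_real (step_avg (\<lambda>y. quad y + b y) x - (b x + s)) + step_avg R x
        - z ^ 3 * of_real (s * corrector x) - z ^ 4 * of_real (s * b x)"
      by (simp add: perturbed_def algebra_simps power2_eq_square power3_eq_cube power4_eq_xxxx)
    also have "norm \<dots> \<le> norm (z ^ 2 * of_real (step_avg (\<lambda>y. quad y + b y) x - (b x + s)) :: 'b)
        + norm (step_avg R x) + norm (z ^ 3 * of_real (s * corrector x) :: 'b)
        + norm (z ^ 4 * of_real (s * b x) :: 'b)"
      by (intro norm_triangle_le norm_triangle_le_diff add_right_mono order_refl norm_triangle_ineq)
    also have "\<dots> \<le> norm z ^ 2 * (\<epsilon> / 2) + norm z ^ 3 * C + norm z ^ 3 * (\<bar>s\<bar> * B) + norm z ^ 3 * (\<bar>s\<bar> * B)"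
    proof (intro add_mono)
      show "norm (z ^ 2 * of_real (step_avg (\<lambda>y. quad y + b y) x - (b x + s)) :: 'b) \<le> norm z ^ 2 * (\<epsilon> / 2)"
        unfolding norm_mult norm_power norm_of_real using be[of x] by (intro mult_left_mono) (auto simp: s_def)
      show "norm (step_avg R x) \<le> norm z ^ 3 * C" by (rule step_avg_norm_le[OF Rb Rle])
      show "norm (z ^ 3 * of_real (s * corrector x) :: 'b) \<le> norm z ^ 3 * (\<bar>s\<bar> * B)"
        unfolding norm_mult norm_power norm_of_real abs_mult using B by (intro mult_left_mono) auto
      show "norm (z ^ 4 * of_real (s * b x) :: 'b) \<le> norm z ^ 3 * (\<bar>s\<bar> * B)"
        unfolding norm_mult norm_power norm_of_real abs_mult using B z1
        by (intro mult_mono mult_left_mono power_decreasing) auto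
    qed
    also have "\<dots> = norm z ^ 2 * (\<epsilon> / 2 + norm z * D)"
      by (simp add: D_def power2_eq_square power3_eq_cube algebra_simps)
    also have "\<dots> \<le> norm z ^ 2 * \<epsilon>"
      using mult_right_mono[OF z D] r(3) by (intro mult_left_mono) auto
    finally show ?thesis by (simp add: mult.commute)
  qed
  then show ?thesis using b r(1) by (intro that[of b]) (auto simp: s_def)
qed

end

section \<open>The limiting variance\<close>

context random_walk
begin

lemma jensen_square:
  fixes h :: "real \<Rightarrow> real"
  assumes "bounded_borel h" shows "(step_avg h x - c) ^ 2 \<le> (LINT s|\<mu>. (h (x + s) - c) ^ 2)"
proof -
  have i: "integrable \<mu> (\<lambda>s. h (x + s))" "integrable \<mu> (\<lambda>s. h (x + s) ^ 2)"
    using integrable_step[OF assms, of x] integrable_step[OF bounded_borel_power[OF assms], of x 2] by auto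
  let ?m = "step_avg h x"
  have "0 \<le> (LINT s|\<mu>. (h (x + s) - ?m) ^ 2)" by simp
  also have "(LINT s|\<mu>. (h (x + s) - ?m) ^ 2) = (LINT s|\<mu>. h (x + s) ^ 2 - 2 * ?m * h (x + s) + ?m ^ 2)"
    by (simp add: power2_diff algebra_simps)
  also have "\<dots> = (LINT s|\<mu>. h (x + s) ^ 2) - ?m ^ 2"
    using i by (simp add: step_avg_def[symmetric] power2_eq_square)
  finally have "?m ^ 2 \<le> (LINT s|\<mu>. h (x + s) ^ 2)" by simp
  moreover have "(LINT s|\<mu>. (h (x + s) - c) ^ 2) = (LINT s|\<mu>. h (x + s) ^ 2 - 2 * c * h (x + s) + c ^ 2)"
    by (simp add: power2_diff algebra_simps)
  moreover have "\<dots> = (LINT s|\<mu>. h (x + s) ^ 2) - 2 * c * ?m + c ^ 2"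
    using i by (simp add: step_avg_def[symmetric])
  ultimately show ?thesis by (simp add: power2_diff algebra_simps)
qed

definition step_var :: "(real \<Rightarrow> real) \<Rightarrow> real \<Rightarrow> real" where
  "step_var h x = (LINT s|\<mu>. (h (x + s) - step_avg h x) ^ 2)"

lemma step_var_eq:
  assumes "bounded_borel h" shows "step_var h x = step_avg (\<lambda>y. h y ^ 2) x - step_avg h x ^ 2"
proof -
  have i: "integrable \<mu> (\<lambda>s. h (x + s))" "integrable \<mu> (\<lambda>s. h (x + s) ^ 2)"
    using integrable_step[OF assms, of x] integrable_step[OF bounded_borel_power[OF assms], of x 2] by auto
  have "step_var h x = (LINT s|\<mu>. h (x + s) ^ 2 - 2 * step_avg h x * h (x + s) + step_avg h x ^ 2)"
    unfolding step_var_def by (simp add: power2_diff algebra_simps)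
  also have "\<dots> = (LINT s|\<mu>. h (x + s) ^ 2) - step_avg h x ^ 2"
    using i by (simp add: step_avg_def[symmetric] power2_eq_square)
  finally show ?thesis by (simp add: step_avg_def)
qed

lemma step_var_nonneg: "0 \<le> step_var h x"
  by (simp add: step_var_def)

lemma bounded_borel_step_var [bb_intros]: "bounded_borel h \<Longrightarrow> bounded_borel (step_var h)"
proof -
  assume h: "bounded_borel h"
  then have eq: "step_var h = (\<lambda>x. step_avg (\<lambda>y. h y ^ 2) x - step_avg h x ^ 2)"
    by (intro ext step_var_eq)
  show ?thesis unfolding eq by (intro bb_intros h)
qed

text \<open>The increment \<open>P h (x + s) - P (P h) x\<close> is the average over
  \<open>t\<close> of \<open>h (x + t + s) - P h (x + t)\<close>, since addition is commutative.
  Jensen's inequality for the square, followed by Fubini, gives the claim.\<close>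

lemma step_var_step_avg_le:
  assumes h: "bounded_borel h" shows "step_var (step_avg h) x \<le> step_avg (step_var h) x"
proof -
  interpret pair_prob_space \<mu> \<mu> ..
  have ph: "bounded_borel (step_avg h)" by (rule bounded_borel_step_avg[OF h])
  note [measurable] = bounded_borel_measurable[OF h] bounded_borel_measurable[OF ph]
  obtain B where B: "B > 0" "\<And>x. norm (h x) \<le> B" by (rule bounded_borel_bound[OF h]) blast
  have B': "norm (step_avg h x) \<le> B" for x by (rule step_avg_norm_le[OF h B(2)])
  have int: "integrable (\<mu> \<Otimes>\<^sub>M \<mu>) (\<lambda>(s, t). (h (x + s + t) - step_avg h (x + t)) ^ 2)"
  proof (rule P.integrable_const_bound[of _ "(2 * B) ^ 2"])
    have "\<bar>h (x + s + t) - step_avg h (x + t)\<bar> \<le> 2 * B" for s t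
      using B(2)[of "x + s + t"] B'[of "x + t"] by simp
    then have "(h (x + s + t) - step_avg h (x + t)) ^ 2 \<le> (2 * B) ^ 2" for s t
      by (metis power2_abs power_mono abs_ge_zero)
    then show "AE st in \<mu> \<Otimes>\<^sub>M \<mu>. norm (case st of (s, t) \<Rightarrow> (h (x + s + t) - step_avg h (x + t)) ^ 2) \<le> (2 * B) ^ 2"
      by (auto intro!: AE_I2)
  qed measurable
  have "step_var (step_avg h) x \<le> (LINT s|\<mu>. (LINT t|\<mu>. (h (x + s + t) - step_avg h (x + t)) ^ 2))"
    unfolding step_var_def[of "step_avg h"]
  proof (rule integral_mono)
    show "integrable \<mu> (\<lambda>s. (step_avg h (x + s) - step_avg (step_avg h) x) ^ 2)"
      by (rule integrable_step[of "\<lambda>y. (step_avg h y - step_avg (step_avg h) x) ^ 2"])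
         (intro bb_intros h)
    show "integrable \<mu> (\<lambda>s. LINT t|\<mu>. (h (x + s + t) - step_avg h (x + t)) ^ 2)"
      using integrable_fst'[OF int] by simp
    fix s
    define d where "d y = h (y + s) - step_avg h y" for y
    have hs: "bounded_borel (\<lambda>y. h (y + s))"
      using B by (intro bounded_borelI[of _ B]) auto
    have db: "bounded_borel d" unfolding d_def[abs_def] by (intro bb_intros hs h)
    have "step_avg d x = step_avg (\<lambda>y. h (y + s)) x - step_avg (step_avg h) x"
      unfolding d_def[abs_def] by (rule step_avg_diff[OF hs ph])
    also have "step_avg (\<lambda>y. h (y + s)) x = step_avg h (x + s)"
      unfolding step_avg_def by (simp add: ac_simps)
    finally have "(step_avg h (x + s) - step_avg (step_avg h) x) ^ 2 = (step_avg d x - 0) ^ 2" by simp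
    also have "\<dots> \<le> (LINT t|\<mu>. (d (x + t) - 0) ^ 2)" by (rule jensen_square[OF db])
    finally show "(step_avg h (x + s) - step_avg (step_avg h) x) ^ 2
        \<le> (LINT t|\<mu>. (h (x + s + t) - step_avg h (x + t)) ^ 2)"
      by (simp add: d_def ac_simps)
  qed
  also have "\<dots> = (LINT t|\<mu>. (LINT s|\<mu>. (h (x + s + t) - step_avg h (x + t)) ^ 2))"
    by (rule Fubini_integral[OF int, symmetric])
  also have "\<dots> = step_avg (step_var h) x"
    unfolding step_avg_def[of "step_var h"] step_var_def by (simp add: ac_simps)
  finally show ?thesis .
qed

text \<open>The loss of squared L2 norm when \<open>P\<close> is applied to \<open>h\<close>, see
  \<open>dissipation_eq\<close>.\<close>

definition dissipation :: "(real \<Rightarrow> real) \<Rightarrow> real" where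
  "dissipation h = (LINT x|unif. step_var h x)"

lemma dissipation_nonneg: "0 \<le> dissipation h"
  by (simp add: dissipation_def step_var_nonneg Bochner_Integration.integral_nonneg)

lemma dissipation_eq:
  assumes h: "bounded_borel h" and per: "\<And>x. h (x + 1) = h x"
  shows "dissipation h = (LINT x|unif. h x ^ 2) - (LINT x|unif. step_avg h x ^ 2)"
proof -
  have "dissipation h = (LINT x|unif. step_avg (\<lambda>y. h y ^ 2) x - step_avg h x ^ 2)"
    unfolding dissipation_def by (intro Bochner_Integration.integral_cong refl step_var_eq h)
  also have "\<dots> = (LINT x|unif. step_avg (\<lambda>y. h y ^ 2) x) - (LINT x|unif. step_avg h x ^ 2)"
    using h by (intro Bochner_Integration.integral_diff bounded_borel_unif_integrable bb_intros)
  also have "(LINT x|unif. step_avg (\<lambda>y. h y ^ 2) x) = (LINT x|unif. h x ^ 2)"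
    by (rule unif_integral_step_avg) (use h per in \<open>auto intro: bb_intros\<close>)
  finally show ?thesis .
qed

lemma dissipation_step_avg_le:
  assumes h: "bounded_borel h" and per: "\<And>x. h (x + 1) = h x"
  shows "dissipation (step_avg h) \<le> dissipation h"
proof -
  have "dissipation (step_avg h) \<le> (LINT x|unif. step_avg (step_var h) x)"
    unfolding dissipation_def using h
    by (intro integral_mono step_var_step_avg_le bounded_borel_unif_integrable bb_intros)
  also have "\<dots> = dissipation h"
    unfolding dissipation_def
  proof (rule unif_integral_step_avg)
    show "step_var h (x + 1) = step_var h x" for x
      by (simp add: step_var_eq[OF h] step_avg_periodic per)
  qed (use h in \<open>intro bb_intros\<close>)
  finally show ?thesis .
qed

lemma dissipation_zero_invariant:
  assumes h: "bounded_borel h" and per: "\<And>x. h (x + 1) = h x" and 0: "dissipation h = 0"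
  shows "(LINT x|unif. (step_avg ^^ n) h x ^ 2) = (LINT x|unif. h x ^ 2)"
proof -
  have d: "dissipation ((step_avg ^^ n) h) = 0" for n
  proof (induction n)
    case (Suc n)
    then show ?case
      using dissipation_step_avg_le[of "(step_avg ^^ n) h"] h dissipation_nonneg[of "(step_avg ^^ Suc n) h"]
      by (simp add: bounded_borel_step_avg_pow step_avg_pow_periodic per)
  qed (simp add: 0)
  show ?thesis
  proof (induction n)
    case (Suc n)
    then show ?case
      using dissipation_eq[of "(step_avg ^^ n) h"] d[of n] h
      by (simp add: bounded_borel_step_avg_pow step_avg_pow_periodic per)
  qed simp
qed

end

context centered_observable
begin

text \<open>Since \<open>P (f + a) = a\<close>, the integrand \<open>f\<^sup>2 + 2 f a\<close>
  equals \<open>h\<^sup>2 - (P h)\<^sup>2\<close> for \<open>h = f + a\<close>.\<close>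

lemma sigma2_dissipation: "sigma2 = dissipation (\<lambda>x. f x + corrector x)"
proof -
  have "dissipation (\<lambda>x. f x + corrector x)
      = (LINT x|unif. (f x + corrector x) ^ 2) - (LINT x|unif. corrector x ^ 2)"
    by (subst dissipation_eq) (auto intro!: bb_intros simp: periodic corrector_periodic poisson)
  also have "\<dots> = (LINT x|unif. (f x + corrector x) ^ 2 - corrector x ^ 2)"
    by (intro Bochner_Integration.integral_diff[symmetric] bounded_borel_unif_integrable bb_intros)
  also have "\<dots> = sigma2"
    unfolding sigma2_def by (simp add: power2_sum algebra_simps)
  finally show ?thesis ..
qed

lemma sigma2_nonneg: "0 \<le> sigma2"
  unfolding sigma2_dissipation by (rule dissipation_nonneg)

lemma step_avg_pow_corrector:
  "(step_avg ^^ n) corrector x = corrector x - (\<Sum>k<n. (step_avg ^^ Suc k) f x)"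
proof (induction n arbitrary: x)
  case (Suc n)
  have "(step_avg ^^ Suc n) corrector x = step_avg (\<lambda>x. corrector x - (\<Sum>k<n. (step_avg ^^ Suc k) f x)) x"
    using Suc unfolding funpow.simps comp_def by (intro step_avg_cong)
  also have "\<dots> = step_avg corrector x - (\<Sum>k<n. step_avg ((step_avg ^^ Suc k) f) x)"
    by (subst step_avg_diff, (intro bb_intros)+, subst step_avg_sum) (auto intro: bb_intros)
  also have "\<dots> = corrector x - (\<Sum>k<Suc n. (step_avg ^^ Suc k) f x)"
    by (subst sum.lessThan_Suc_shift) (simp add: step_avg_corrector)
  finally show ?case .
qed simp

text \<open>Without dissipation all \<open>P\<^sup>n h\<close> have the L2 norm of \<open>h = f +
  a\<close>. For \<open>n \<ge> 1\<close> they are the tails of the series defining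
  \<open>a\<close>, which tend to 0 uniformly; so \<open>h\<close> and \<open>a = P h\<close>
  vanish almost everywhere.\<close>

lemma sigma2_zero_imp_null:
  assumes 0: "sigma2 = 0" shows "AE x in unif. f x = 0"
proof -
  define h where "h x = f x + corrector x" for x
  have hb: "bounded_borel h" unfolding h_def[abs_def] by (intro bb_intros)
  have hper: "h (x + 1) = h x" for x by (simp add: h_def periodic corrector_periodic)
  have hd: "dissipation h = 0" using 0 sigma2_dissipation by (simp add: h_def[abs_def])
  have ph: "step_avg h = corrector" unfolding h_def[abs_def] by (rule ext) (rule poisson)
  note inv = dissipation_zero_invariant[OF hb hper hd]
  have pow: "(step_avg ^^ Suc n) h = (step_avg ^^ n) corrector" for n
    by (simp add: ph funpow_swap1)
  have le: "(LINT x|unif. h x ^ 2) \<le> \<epsilon> ^ 2" if e: "0 < \<epsilon>" for \<epsilon>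
  proof -
    obtain n where n: "\<And>x. \<bar>(step_avg ^^ n) corrector x\<bar> \<le> \<epsilon>"
      unfolding step_avg_pow_corrector by (rule corrector_approx[OF e]) blast
    have "(LINT x|unif. h x ^ 2) = (LINT x|unif. (step_avg ^^ n) corrector x ^ 2)"
      using inv[of "Suc n"] unfolding pow by simp
    also have "\<dots> \<le> (LINT x|unif. \<epsilon> ^ 2)"
    proof (rule integral_mono)
      show "(step_avg ^^ n) corrector x ^ 2 \<le> \<epsilon> ^ 2" for x
        using n[of x] by (metis power2_abs power_mono abs_ge_zero)
    qed (intro bounded_borel_unif_integrable bb_intros)+
    also have "\<dots> = \<epsilon> ^ 2" using unif.prob_space by simp
    finally show ?thesis .
  qed
  have "(LINT x|unif. h x ^ 2) \<le> 0"
  proof (rule field_le_epsilon)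
    fix e :: real assume "0 < e"
    then show "(LINT x|unif. h x ^ 2) \<le> 0 + e" using le[of "sqrt e"] by simp
  qed
  then have h0: "(LINT x|unif. h x ^ 2) = 0"
    by (intro antisym) (auto intro: Bochner_Integration.integral_nonneg)
  then have c0: "(LINT x|unif. corrector x ^ 2) = 0"
    using inv[of "Suc 0"] by (simp add: ph)
  have *: "AE x in unif. g x = 0" if "bounded_borel g" "(LINT x|unif. g x ^ 2) = 0" for g :: "real \<Rightarrow> real"
    using integral_nonneg_eq_0_iff_AE[of unif "\<lambda>x. g x ^ 2"] that
    by (simp add: bounded_borel_unif_integrable bounded_borel_power)
  show ?thesis
    using *[OF hb h0] *[OF bounded_borel_corrector c0] by eventually_elim (simp add: h_def)
qed

lemma sigma2_series:
  "sigma2 = (LINT x|unif. f x * f x) + 2 * (\<Sum>k. LINT x|unif. f x * (step_avg ^^ Suc k) f x)"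
proof -
  obtain B where B: "B > 0" "\<And>x. norm (f x) \<le> B" by (rule bounded_borel_bound[OF bounded_borel_f]) blast
  have bb: "bounded_borel (\<lambda>x. f x * (step_avg ^^ Suc k) f x)" for k by (intro bb_intros)
  have le: "\<bar>f x * (step_avg ^^ Suc k) f x\<bar> \<le> B * (3 * K * \<psi> (Suc k))" for k x
    unfolding abs_mult using B step_avg_pow_f_le[of "Suc k" x] by (intro mult_mono) auto
  have s: "summable (\<lambda>k. B * (3 * K * \<psi> (Suc k)))"
    using summable_\<psi> by (intro summable_mult) (simp add: summable_Suc_iff)
  have "(\<Sum>k. LINT x|unif. f x * (step_avg ^^ Suc k) f x) = (LINT x|unif. (\<Sum>k. f x * (step_avg ^^ Suc k) f x))"
  proof (rule integral_suminf[symmetric])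
    show "AE x in unif. summable (\<lambda>k. norm (f x * (step_avg ^^ Suc k) f x))"
      by (intro AE_I2 summable_comparison_test'[OF s, of 0]) (use le in auto)
    show "summable (\<lambda>k. LINT x|unif. norm (f x * (step_avg ^^ Suc k) f x))"
    proof (rule summable_comparison_test'[OF s, of 0])
      fix k
      have "(LINT x|unif. norm (f x * (step_avg ^^ Suc k) f x)) \<le> (LINT x|unif. B * (3 * K * \<psi> (Suc k)))"
        using le[of _ k] by (intro integral_mono integrable_norm bounded_borel_unif_integrable[OF bb]) auto
      also have "\<dots> = B * (3 * K * \<psi> (Suc k))" using unif.prob_space by simp
      finally show "norm (LINT x|unif. norm (f x * (step_avg ^^ Suc k) f x)) \<le> B * (3 * K * \<psi> (Suc k))"
        by (simp del: funpow.simps)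
    qed
  qed (rule bounded_borel_unif_integrable[OF bb])
  also have "\<dots> = (LINT x|unif. f x * corrector x)"
    unfolding corrector_def by (simp only: suminf_mult[OF summable_step_avg_pow'])
  finally have "(\<Sum>k. LINT x|unif. f x * (step_avg ^^ Suc k) f x) = (LINT x|unif. f x * corrector x)" .
  moreover have "sigma2 = (LINT x|unif. f x * f x) + 2 * (LINT x|unif. f x * corrector x)"
    unfolding sigma2_def power2_eq_square
    by (subst Bochner_Integration.integral_add) (auto intro!: bounded_borel_unif_integrable bb_intros)
  ultimately show ?thesis by simp
qed

text \<open>The operator whose powers give the Laplace and Fourier transforms of the additive
  functional, see \<open>integral_exp_walk_sum\<close>.\<close>

definition tilt :: "'b \<Rightarrow> (real \<Rightarrow> 'b) \<Rightarrow> real \<Rightarrow> 'b::{real_normed_field, banach, second_countable_topology}" where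
  "tilt z g = step_avg (\<lambda>y. exp (z * of_real (f y)) * g y)"

lemma bounded_borel_tilt [bb_intros]: "bounded_borel g \<Longrightarrow> bounded_borel (tilt z g)"
  unfolding tilt_def by (intro bb_intros)

lemma bounded_borel_tilt_pow [bb_intros]: "bounded_borel g \<Longrightarrow> bounded_borel ((tilt z ^^ n) g)"
  by (induction n) (auto intro: bb_intros)

lemma bounded_borel_perturbed [bb_intros]: "bounded_borel b \<Longrightarrow> bounded_borel (perturbed b z)"
  unfolding perturbed_def[abs_def] by (intro bb_intros)

lemma norm_exp_walk_sum_le:
  fixes z :: "'b::{real_normed_field, banach, second_countable_topology}"
  assumes "\<And>x. norm (f x) \<le> B"
  shows "norm (exp (z * of_real (walk_sum f n x w))) \<le> exp (norm z * (real n * B))"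
proof -
  have "\<bar>walk_sum f n x w\<bar> \<le> real n * B"
  proof (induction n arbitrary: x w)
    case (Suc n)
    show ?case using Suc[of "x + shd w" "stl w"] assms[of "x + shd w"] by (simp add: algebra_simps)
  qed simp
  then have "norm z * \<bar>walk_sum f n x w\<bar> \<le> norm z * (real n * B)" by (intro mult_left_mono) auto
  then show ?thesis
    by (intro order.trans[OF norm_exp]) (simp add: norm_mult)
qed

lemma integral_exp_walk_sum:
  fixes z :: "'b::{real_normed_field, banach, second_countable_topology}"
  assumes g: "bounded_borel g"
  shows "(LINT w|\<Omega>. exp (z * of_real (walk_sum f n x w)) * g (walk_pos n x w)) = (tilt z ^^ n) g x"
proof (induction n arbitrary: x)
  case 0 show ?case by simp
next
  case (Suc n)
  obtain B where B: "B > 0" "\<And>x. norm (f x) \<le> B" by (rule bounded_borel_bound[OF bounded_borel_f]) blast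
  obtain C where C: "C > 0" "\<And>x. norm (g x) \<le> C" by (rule bounded_borel_bound[OF g]) blast
  note [measurable] = bounded_borel_measurable[OF g]
  have [measurable]: "(exp :: 'b \<Rightarrow> 'b) \<in> borel_measurable borel"
    by (intro borel_measurable_continuous_onI continuous_intros)
  let ?F = "\<lambda>n x w. exp (z * of_real (walk_sum f n x w)) * g (walk_pos n x w)"
  have "norm (?F (Suc n) x w) \<le> exp (norm z * (real (Suc n) * B)) * C" for w
    unfolding norm_mult by (intro mult_mono norm_exp_walk_sum_le B(2) C(2)) auto
  then have "(LINT w|\<Omega>. ?F (Suc n) x w) = (LINT s|\<mu>. (LINT w|\<Omega>. ?F (Suc n) x (s ## w)))"
    by (intro integral_first_step) measurable
  also have "\<dots> = (LINT s|\<mu>. exp (z * of_real (f (x + s))) * (LINT w|\<Omega>. ?F n (x + s) w))"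
    by (simp add: distrib_left exp_add mult.assoc)
  also have "\<dots> = (tilt z ^^ Suc n) g x"
    unfolding Suc funpow.simps comp_def tilt_def[of z "(tilt z ^^ n) g"] step_avg_def ..
  finally show ?case .
qed

end

section \<open>Central limit theorem and exponential bounds\<close>

lemma exp_le_quadratic:
  fixes v :: real
  assumes "\<bar>v\<bar> \<le> 1 / 6" shows "exp v \<le> 1 + v + v ^ 2"
proof -
  have "\<bar>exp v - (1 + v + v ^ 2 / 2)\<bar> \<le> \<bar>v\<bar> ^ 3 * exp \<bar>v\<bar>"
    using exp_quadratic_remainder[of v] by simp
  also have "\<dots> = v ^ 2 * (\<bar>v\<bar> * exp \<bar>v\<bar>)"
    by (simp add: power3_eq_cube power2_eq_square flip: abs_mult)
  also have "\<dots> \<le> v ^ 2 * (1 / 6 * exp 1)"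
    using assms by (intro mult_left_mono mult_mono) auto
  also have "\<dots> \<le> v ^ 2 * (1 / 2)"
    using exp_le by (intro mult_left_mono) auto
  finally show ?thesis using abs_le_D1 by fastforce
qed

context centered_observable
begin

lemma tilt_norm_le:
  fixes z :: "'b::{real_normed_field, banach, second_countable_topology}"
  assumes "bounded_borel g" "\<And>x. norm (exp (z * of_real (f x))) \<le> 1" "\<And>x. norm (g x) \<le> B"
  shows "norm (tilt z g x) \<le> B"
  unfolding tilt_def
proof (rule step_avg_norm_le)
  fix y
  have "norm (exp (z * of_real (f y)) * g y) \<le> 1 * B"
    unfolding norm_mult using assms(2,3) order.trans[OF norm_ge_zero assms(3)]
    by (intro mult_mono) auto
  then show "norm (exp (z * of_real (f y)) * g y) \<le> B" by simp
qed (intro bb_intros assms)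

lemma tilt_pow_norm_le:
  fixes z :: "'b::{real_normed_field, banach, second_countable_topology}"
  assumes "bounded_borel g" "\<And>x. norm (exp (z * of_real (f x))) \<le> 1" "\<And>x. norm (g x) \<le> B"
  shows "norm ((tilt z ^^ n) g x) \<le> B"
proof (induction n arbitrary: x)
  case (Suc n)
  then show ?case using tilt_norm_le[of "(tilt z ^^ n) g" z B x] assms
    by (simp add: bounded_borel_tilt_pow)
qed (simp add: assms)

lemma tilt_diff:
  fixes z :: "'b::{real_normed_field, banach, second_countable_topology}"
  assumes "bounded_borel g" "bounded_borel h"
  shows "tilt z (\<lambda>x. g x - h x) x = tilt z g x - tilt z h x"
proof -
  have "tilt z (\<lambda>x. g x - h x) x
      = step_avg (\<lambda>y. exp (z * of_real (f y)) * g y - exp (z * of_real (f y)) * h y) x"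
    unfolding tilt_def by (rule step_avg_cong) (simp add: algebra_simps)
  also have "\<dots> = tilt z g x - tilt z h x"
    unfolding tilt_def by (rule step_avg_diff) (intro bb_intros assms)+
  finally show ?thesis .
qed

lemma tilt_pow_diff:
  fixes z :: "'b::{real_normed_field, banach, second_countable_topology}"
  assumes "bounded_borel g" "bounded_borel h"
  shows "(tilt z ^^ n) (\<lambda>x. g x - h x) x = (tilt z ^^ n) g x - (tilt z ^^ n) h x"
proof (induction n arbitrary: x)
  case (Suc n)
  then have "(tilt z ^^ n) (\<lambda>x. g x - h x) = (\<lambda>x. (tilt z ^^ n) g x - (tilt z ^^ n) h x)" by (rule ext)
  then show ?case
    using tilt_diff[of "(tilt z ^^ n) g" "(tilt z ^^ n) h" z x] assms by (simp add: bounded_borel_tilt_pow)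
qed simp

lemma tilt_cmult:
  fixes z :: "'b::{real_normed_field, banach, second_countable_topology}"
  shows "tilt z (\<lambda>x. c * g x) x = c * tilt z g x"
proof -
  have "tilt z (\<lambda>x. c * g x) x = step_avg (\<lambda>y. c * (exp (z * of_real (f y)) * g y)) x"
    unfolding tilt_def by (rule step_avg_cong) (simp add: algebra_simps)
  then show ?thesis unfolding step_avg_cmult tilt_def .
qed

text \<open>Errors only add up over \<open>n\<close> steps, because neither the operator nor the
  multiplier increases norms. This is the case for imaginary \<open>z\<close>.\<close>

lemma tilt_pow_approx_eigenfunction:
  fixes z :: "'b::{real_normed_field, banach, second_countable_topology}"
  assumes g: "bounded_borel g" and e: "\<And>x. norm (exp (z * of_real (f x))) \<le> 1"
    and \<rho>: "norm \<rho> \<le> 1" and d: "\<And>x. norm (tilt z g x - \<rho> * g x) \<le> d"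
  shows "norm ((tilt z ^^ n) g x - \<rho> ^ n * g x) \<le> real n * d"
proof (induction n arbitrary: x)
  case (Suc n)
  have d0: "0 \<le> d" using d[of 0] norm_ge_zero order.trans by blast
  have b1: "bounded_borel ((tilt z ^^ n) g)" by (intro bb_intros g)
  have b2: "bounded_borel (\<lambda>x. \<rho> ^ n * g x)" by (intro bounded_borel_mult bounded_borel_const g)
  have "(tilt z ^^ Suc n) g x - \<rho> ^ Suc n * g x
      = tilt z (\<lambda>x. (tilt z ^^ n) g x - \<rho> ^ n * g x) x + \<rho> ^ n * (tilt z g x - \<rho> * g x)"
    unfolding tilt_diff[OF b1 b2] tilt_cmult funpow.simps comp_def by (simp add: algebra_simps)
  also have "norm \<dots> \<le> norm (tilt z (\<lambda>x. (tilt z ^^ n) g x - \<rho> ^ n * g x) x)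
      + norm (\<rho> ^ n * (tilt z g x - \<rho> * g x))" by (rule norm_triangle_ineq)
  also have "\<dots> \<le> real n * d + 1 * d"
  proof (rule add_mono)
    show "norm (tilt z (\<lambda>x. (tilt z ^^ n) g x - \<rho> ^ n * g x) x) \<le> real n * d"
      by (intro tilt_norm_le bounded_borel_diff b1 b2 e Suc)
    show "norm (\<rho> ^ n * (tilt z g x - \<rho> * g x)) \<le> 1 * d"
      unfolding norm_mult norm_power using \<rho> d by (intro mult_mono power_le_one) auto
  qed
  finally show ?case by (simp add: algebra_simps)
qed simp

text \<open>With \<open>z = \<i> t / sqrt n\<close> each step costs \<open>\<epsilon> t\<^sup>2 /
  n\<close>, hence \<open>n\<close> steps cost \<open>\<epsilon> t\<^sup>2\<close>. The
  approximate eigenfunction tends to 1, and the \<open>n\<close>-th power of the eigenvalue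
  \<open>1 - \<sigma>\<^sup>2 t\<^sup>2 / (2 n)\<close> tends to the Gaussian.\<close>

lemma char_walk_sum_tendsto:
  "(\<lambda>n. LINT w|\<Omega>. exp (\<i> * of_real (t / sqrt (real n)) * of_real (walk_sum f n x w)))
    \<longlonglongrightarrow> of_real (exp (- (sigma2 * t ^ 2 / 2)))"
  (is "?\<phi> \<longlonglongrightarrow> ?L")
proof -
  have "\<forall>\<^sub>F n in sequentially. norm (?\<phi> n - ?L) < e" if "0 < e" for e
  proof -
    define \<epsilon> where "\<epsilon> = e / (4 * (t ^ 2 + 1))"
    have \<epsilon>: "0 < \<epsilon>" using that by (simp add: \<epsilon>_def add_nonneg_pos)
    obtain b where b: "bounded_borel b" and
      "\<exists>r>0. \<forall>(z :: complex) x. norm z \<le> r \<longrightarrow>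
      norm (step_avg (\<lambda>y. exp (z * of_real (f y)) * perturbed b z y) x
        - (1 + z ^ 2 * of_real (sigma2 / 2)) * perturbed b z x) \<le> \<epsilon> * norm z ^ 2"
      by (rule perturbed_eigenfunction[OF \<epsilon>, where 'b = complex]) blast
    then obtain r where r: "0 < r" and eig: "\<And>(z :: complex) x. norm z \<le> r \<Longrightarrow>
      norm (tilt z (perturbed b z) x - (1 + z ^ 2 * of_real (sigma2 / 2)) * perturbed b z x) \<le> \<epsilon> * norm z ^ 2"
      unfolding tilt_def by blast
    obtain A where A: "A > 0" "\<And>x. norm (corrector x) \<le> A" by (rule bounded_borel_bound[OF bounded_borel_corrector]) blast
    obtain C where C: "C > 0" "\<And>x. norm (b x) \<le> C" by (rule bounded_borel_bound[OF b]) blast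
    define \<theta> where "\<theta> n = t / sqrt (real n)" for n
    define \<rho> where "\<rho> n = 1 + (- (sigma2 * t ^ 2 / 2)) / real n" for n
    define \<eta> where "\<eta> n = \<bar>\<theta> n\<bar> * A + \<theta> n ^ 2 * C" for n
    have \<theta>0: "\<theta> \<longlonglongrightarrow> 0" unfolding \<theta>_def by real_asymp
    have \<eta>0: "(\<lambda>n. 2 * \<eta> n) \<longlonglongrightarrow> 2 * (\<bar>0\<bar> * A + 0 ^ 2 * C)"
      unfolding \<eta>_def by (intro tendsto_intros \<theta>0)
    have pw: "(\<lambda>n. \<rho> n ^ n) \<longlonglongrightarrow> exp (- (sigma2 * t ^ 2 / 2))"
      unfolding \<rho>_def by (rule tendsto_exp_limit_sequentially)
    have "(\<lambda>n. 1 + (- (sigma2 * t ^ 2 / 2)) / real n) \<longlonglongrightarrow> 1 + 0"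
      by (intro tendsto_add tendsto_const lim_const_over_n)
    then have \<rho>1: "\<rho> \<longlonglongrightarrow> 1" unfolding \<rho>_def by simp
    have ev1: "\<forall>\<^sub>F n in sequentially. norm (\<theta> n) < r"
      using tendstoD[OF \<theta>0 r] by (simp add: dist_norm)
    have ev2: "\<forall>\<^sub>F n in sequentially. 0 < \<rho> n" using order_tendstoD(1)[OF \<rho>1, of 0] by simp
    have ev3: "\<forall>\<^sub>F n in sequentially. 2 * \<eta> n < e / 4" using order_tendstoD(2)[OF \<eta>0, of "e / 4"] that by simp
    have ev4: "\<forall>\<^sub>F n in sequentially. \<bar>\<rho> n ^ n - exp (- (sigma2 * t ^ 2 / 2))\<bar> < e / 4"
      using tendstoD[OF pw, of "e / 4"] that by (simp add: dist_norm)
    show ?thesis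
      using ev1 ev2 ev3 ev4 eventually_gt_at_top[of 0]
    proof eventually_elim
      case (elim n)
      define z where "z = \<i> * of_real (\<theta> n)"
      define g where "g = perturbed b z"
      have gb: "bounded_borel g" unfolding g_def by (intro bb_intros b)
      have nz: "norm z = \<bar>\<theta> n\<bar>" by (simp add: z_def norm_mult)
      have z2: "z ^ 2 = of_real (- (\<theta> n ^ 2))" by (simp add: z_def power_mult_distrib)
      have n\<theta>: "real n * \<theta> n ^ 2 = t ^ 2" using elim(5) by (simp add: \<theta>_def power_divide)
      have \<rho>eq: "1 + z ^ 2 * of_real (sigma2 / 2) = of_real (\<rho> n)"
      proof -
        have "\<rho> n = 1 + - (\<theta> n ^ 2) * (sigma2 / 2)"
          using elim(5) by (simp add: \<rho>_def \<theta>_def power_divide mult_ac)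
        then show ?thesis unfolding z2 by (simp only: of_real_add of_real_mult of_real_1)
      qed
      have \<rho>le: "\<bar>\<rho> n\<bar> \<le> 1" using elim(2) sigma2_nonneg by (simp add: \<rho>_def)
      have e1: "norm (exp (z * of_real (f x))) \<le> 1" for x
        by (simp add: z_def norm_exp_eq_Re)
      have g1: "norm (1 - g x) \<le> \<eta> n" for x
      proof -
        have "norm (1 - g x) = norm (z * of_real (corrector x) + z ^ 2 * of_real (b x))"
          unfolding norm_minus_commute[of 1] by (simp add: g_def perturbed_def add.assoc)
        also have "\<dots> \<le> norm (z * of_real (corrector x)) + norm (z ^ 2 * of_real (b x) :: complex)"
          by (rule norm_triangle_ineq)
        also have "\<dots> = \<bar>\<theta> n\<bar> * \<bar>corrector x\<bar> + \<theta> n ^ 2 * \<bar>b x\<bar>"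
          by (simp add: norm_mult norm_power nz)
        also have "\<dots> \<le> \<eta> n"
          unfolding \<eta>_def using A C by (intro add_mono mult_left_mono) auto
        finally show ?thesis .
      qed
      have \<phi>: "?\<phi> n = (tilt z ^^ n) (\<lambda>_. 1) x"
        using integral_exp_walk_sum[OF bounded_borel_const[of 1], of z n x] by (simp add: z_def \<theta>_def)
      have n1: "norm ((tilt z ^^ n) (\<lambda>_. 1) x - (tilt z ^^ n) g x) \<le> \<eta> n"
        using tilt_pow_norm_le[of "\<lambda>x. 1 - g x" z "\<eta> n" n x] e1 g1 gb
        by (simp add: tilt_pow_diff bb_intros)
      have n2: "norm ((tilt z ^^ n) g x - of_real (\<rho> n) ^ n * g x) \<le> real n * (\<epsilon> * \<theta> n ^ 2)"
      proof (rule tilt_pow_approx_eigenfunction[OF gb e1])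
        show "norm (of_real (\<rho> n) :: complex) \<le> 1" using \<rho>le by simp
        show "norm (tilt z g x - of_real (\<rho> n) * g x) \<le> \<epsilon> * \<theta> n ^ 2" for x
          using eig[of z x] elim(1) unfolding \<rho>eq g_def nz by simp
      qed
      have n3: "norm (of_real (\<rho> n) ^ n * g x - of_real (\<rho> n ^ n)) \<le> \<eta> n"
      proof -
        have "norm (of_real (\<rho> n) ^ n * g x - of_real (\<rho> n ^ n)) = \<bar>\<rho> n\<bar> ^ n * norm (1 - g x)"
          using norm_mult[of "of_real (\<rho> n) ^ n" "g x - 1"]
          by (simp add: norm_power norm_minus_commute[of 1] right_diff_distrib)
        also have "\<dots> \<le> 1 * \<eta> n" using \<rho>le g1 by (intro mult_mono power_le_one) auto
        finally show ?thesis by simp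
      qed
      have n4: "norm (of_real (\<rho> n ^ n) - ?L) < e / 4"
        using elim(4) by (simp flip: of_real_diff of_real_power)
      have n5: "real n * (\<epsilon> * \<theta> n ^ 2) \<le> e / 4"
      proof -
        have "real n * (\<epsilon> * \<theta> n ^ 2) = \<epsilon> * t ^ 2" using n\<theta> by (simp add: mult_ac)
        also have "\<dots> \<le> \<epsilon> * (t ^ 2 + 1)" using \<epsilon> by (intro mult_left_mono) auto
        also have "\<dots> = e / 4" by (simp add: \<epsilon>_def add_nonneg_pos field_simps add_nonneg_eq_0_iff)
        finally show ?thesis .
      qed
      have "norm (p + q + u + v) \<le> norm p + norm q + norm u + norm v" for p q u v :: complex
        by (intro norm_triangle_le add_right_mono order_refl norm_triangle_ineq)
      from this[of "(tilt z ^^ n) (\<lambda>_. 1) x - (tilt z ^^ n) g x" "(tilt z ^^ n) g x - of_real (\<rho> n) ^ n * g x"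
          "of_real (\<rho> n) ^ n * g x - of_real (\<rho> n ^ n)" "of_real (\<rho> n ^ n) - ?L"]
      have "norm ((tilt z ^^ n) (\<lambda>_. 1) x - ?L)
          \<le> norm ((tilt z ^^ n) (\<lambda>_. 1) x - (tilt z ^^ n) g x) + norm ((tilt z ^^ n) g x - of_real (\<rho> n) ^ n * g x)
          + norm (of_real (\<rho> n) ^ n * g x - of_real (\<rho> n ^ n)) + norm (of_real (\<rho> n ^ n) - ?L)"
        by simp
      also have "\<dots> \<le> \<eta> n + e / 4 + \<eta> n + e / 4"
        using n1 order.trans[OF n2 n5] n3 less_imp_le[OF n4] by (intro add_mono)
      also have "\<dots> < e" using elim(3) \<open>0 < e\<close> by simp
      finally have "norm ((tilt z ^^ n) (\<lambda>_. 1) x - ?L) < e" .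
      then show "norm (?\<phi> n - ?L) < e" unfolding \<phi> .
    qed
  qed
  then show ?thesis by (intro tendstoI) (simp add: dist_norm)
qed

text \<open>For real \<open>z\<close> the approximate eigenfunction lies between 1/2 and 2, so the
  additive error can be absorbed into the exponent. The bounds become multiplicative and can be
  iterated.\<close>

lemma real_eigenfunction_bounds:
  assumes "0 < \<epsilon>"
  obtains r where "r > 0" "\<And>z :: real. \<bar>z\<bar> \<le> r \<Longrightarrow> \<exists>g. bounded_borel g \<and>
    (\<forall>x. 1 / 2 \<le> g x \<and> g x \<le> 2 \<and> exp (z ^ 2 * (sigma2 / 2 - \<epsilon>)) * g x \<le> tilt z g x
      \<and> tilt z g x \<le> exp (z ^ 2 * (sigma2 / 2 + \<epsilon>)) * g x)"
proof -
  define s where "s = sigma2 / 2"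
  have s0: "0 \<le> s" using sigma2_nonneg by (simp add: s_def)
  obtain b where b: "bounded_borel b" and
    "\<exists>r>0. \<forall>(z :: real) x. norm z \<le> r \<longrightarrow>
      norm (step_avg (\<lambda>y. exp (z * of_real (f y)) * perturbed b z y) x
        - (1 + z ^ 2 * of_real (sigma2 / 2)) * perturbed b z x) \<le> \<epsilon> / 4 * norm z ^ 2"
    by (rule perturbed_eigenfunction[of "\<epsilon> / 4", where 'b = real]) (use assms in auto)
  then obtain r0 where r0: "0 < r0" and eig: "\<And>(z :: real) x. norm z \<le> r0 \<Longrightarrow>
      norm (tilt z (perturbed b z) x - (1 + z ^ 2 * of_real (sigma2 / 2)) * perturbed b z x) \<le> \<epsilon> / 4 * norm z ^ 2"
    unfolding tilt_def by blast
  obtain A where A: "A > 0" "\<And>x. norm (corrector x) \<le> A" by (rule bounded_borel_bound[OF bounded_borel_corrector]) blast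
  obtain C where C: "C > 0" "\<And>x. norm (b x) \<le> C" by (rule bounded_borel_bound[OF b]) blast
  define w where "w = \<bar>s - \<epsilon>\<bar>"
  have "\<exists>r>0. r \<le> r0 \<and> r \<le> 1 \<and> r * (A + C) \<le> 1 / 2 \<and> r ^ 2 * w \<le> 1 / 6 \<and> r ^ 2 * w ^ 2 \<le> \<epsilon> / 2"
  proof -
    have "\<forall>\<^sub>F r in at_right 0. r * (A + C) < 1 / 2" "\<forall>\<^sub>F r in at_right 0. r ^ 2 * w < 1 / 6"
      "\<forall>\<^sub>F r in at_right 0. r ^ 2 * w ^ 2 < \<epsilon> / 2"
      using assms by (auto intro!: order_tendstoD(2)[of _ 0] tendsto_eq_intros)
    moreover have "\<forall>\<^sub>F r in at_right 0. (0::real) < r" by (rule eventually_at_right_less)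
    moreover have "\<forall>\<^sub>F r in at_right 0. r < min r0 1"
      using r0 by (intro order_tendstoD(2)[of _ 0] tendsto_eq_intros) auto
    ultimately have "\<forall>\<^sub>F r in at_right 0. r > 0 \<and> r \<le> r0 \<and> r \<le> 1 \<and> r * (A + C) \<le> 1 / 2 \<and> r ^ 2 * w \<le> 1 / 6 \<and> r ^ 2 * w ^ 2 \<le> \<epsilon> / 2"
      by eventually_elim auto
    then show ?thesis by (rule eventually_happens[THEN mp[rotated]]) auto
  qed
  then obtain r where r: "0 < r" "r \<le> r0" "r \<le> 1" "r * (A + C) \<le> 1 / 2" "r ^ 2 * w \<le> 1 / 6" "r ^ 2 * w ^ 2 \<le> \<epsilon> / 2"
    by blast
  show ?thesis
  proof (rule that[OF r(1)])
    fix z :: real assume z: "\<bar>z\<bar> \<le> r"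
    define g where "g = perturbed b z"
    have gb: "bounded_borel g" unfolding g_def by (intro bb_intros b)
    have z2: "z ^ 2 \<le> r ^ 2" using z r(1) by (metis power2_abs power_mono abs_ge_zero)
    have g1: "1 / 2 \<le> g x \<and> g x \<le> 2" for x
    proof -
      have "\<bar>z * corrector x + z ^ 2 * b x\<bar> \<le> \<bar>z * corrector x\<bar> + \<bar>z ^ 2 * b x\<bar>"
        by (rule abs_triangle_ineq)
      also have "\<dots> \<le> r * A + r * C"
      proof (rule add_mono)
        show "\<bar>z * corrector x\<bar> \<le> r * A" unfolding abs_mult using z A(1) A(2)[of x] r(1) by (intro mult_mono) auto
        have "z ^ 2 \<le> r" using z2 r(1,3) by (smt (verit) mult_left_le power2_eq_square)
        then show "\<bar>z ^ 2 * b x\<bar> \<le> r * C" unfolding abs_mult using C(1) C(2)[of x] r(1) by (intro mult_mono) auto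
      qed
      also have "\<dots> \<le> 1 / 2" using r(4) by (simp add: distrib_left)
      finally have "\<bar>g x - 1\<bar> \<le> 1 / 2" by (simp add: g_def perturbed_def add.assoc)
      then show ?thesis by linarith
    qed
    have err: "\<bar>tilt z g x - (1 + z ^ 2 * s) * g x\<bar> \<le> z ^ 2 * (\<epsilon> / 2) * g x" for x
    proof -
      have "\<bar>tilt z g x - (1 + z ^ 2 * s) * g x\<bar> \<le> \<epsilon> / 4 * z ^ 2"
        using eig[of z x] z r(2) by (simp add: g_def s_def)
      also have "\<dots> = z ^ 2 * (\<epsilon> / 2) * (1 / 2)" by simp
      also have "\<dots> \<le> z ^ 2 * (\<epsilon> / 2) * g x" using g1[of x] assms by (intro mult_left_mono) auto
      finally show ?thesis .
    qed
    have up: "tilt z g x \<le> exp (z ^ 2 * (s + \<epsilon>)) * g x" for x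
    proof -
      have "tilt z g x \<le> (1 + z ^ 2 * s) * g x + z ^ 2 * (\<epsilon> / 2) * g x"
        using err[of x] by linarith
      also have "\<dots> = (1 + z ^ 2 * (s + \<epsilon> / 2)) * g x" by (simp add: algebra_simps)
      also have "\<dots> \<le> exp (z ^ 2 * (s + \<epsilon>)) * g x"
      proof (rule mult_right_mono)
        have "1 + z ^ 2 * (s + \<epsilon> / 2) \<le> 1 + z ^ 2 * (s + \<epsilon>)"
          using assms by (intro add_left_mono mult_left_mono) auto
        also have "\<dots> \<le> exp (z ^ 2 * (s + \<epsilon>))" by (rule exp_ge_add_one_self)
        finally show "1 + z ^ 2 * (s + \<epsilon> / 2) \<le> exp (z ^ 2 * (s + \<epsilon>))" .
      qed (use g1[of x] in auto)
      finally show ?thesis .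
    qed
    have lo: "exp (z ^ 2 * (s - \<epsilon>)) * g x \<le> tilt z g x" for x
    proof -
      define v where "v = z ^ 2 * (s - \<epsilon>)"
      have av: "\<bar>v\<bar> = z ^ 2 * w" by (simp add: v_def w_def abs_mult)
      have "z ^ 2 * w \<le> r ^ 2 * w" using z2 by (intro mult_right_mono) (auto simp: w_def)
      then have "\<bar>v\<bar> \<le> 1 / 6" using r(5) av by linarith
      then have "exp v \<le> 1 + v + v ^ 2" by (rule exp_le_quadratic)
      also have "v ^ 2 = z ^ 2 * (z ^ 2 * w ^ 2)"
        by (simp add: v_def w_def power2_eq_square mult_ac flip: abs_mult)
      also have "z ^ 2 * (z ^ 2 * w ^ 2) \<le> z ^ 2 * (\<epsilon> / 2)"
        using mult_right_mono[OF z2, of "w ^ 2"] r(6) by (intro mult_left_mono) auto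
      finally have "exp v \<le> 1 + z ^ 2 * s - z ^ 2 * (\<epsilon> / 2)" by (simp add: v_def algebra_simps)
      then have "exp v * g x \<le> (1 + z ^ 2 * s - z ^ 2 * (\<epsilon> / 2)) * g x"
        using g1[of x] by (intro mult_right_mono) auto
      also have "\<dots> \<le> tilt z g x" using abs_le_D2[OF err[of x]] by (simp add: algebra_simps)
      finally show ?thesis by (simp add: v_def)
    qed
    show "\<exists>g. bounded_borel g \<and>
      (\<forall>x. 1 / 2 \<le> g x \<and> g x \<le> 2 \<and> exp (z ^ 2 * (sigma2 / 2 - \<epsilon>)) * g x \<le> tilt z g x
      \<and> tilt z g x \<le> exp (z ^ 2 * (sigma2 / 2 + \<epsilon>)) * g x)"
      using gb g1 up lo by (intro exI[of _ g]) (simp add: s_def)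
  qed
qed

lemma tilt_mono:
  fixes z :: real
  assumes "bounded_borel g" "bounded_borel h" "\<And>x. g x \<le> h x" shows "tilt z g x \<le> tilt z h x"
  unfolding tilt_def using assms by (intro step_avg_mono bb_intros mult_left_mono) auto

lemma tilt_pow_upper:
  fixes z :: real
  assumes g: "bounded_borel g" and \<rho>: "0 \<le> \<rho>" "\<And>x. tilt z g x \<le> \<rho> * g x"
  shows "(tilt z ^^ n) g x \<le> \<rho> ^ n * g x"
proof (induction n arbitrary: x)
  case (Suc n)
  have "(tilt z ^^ Suc n) g x \<le> tilt z (\<lambda>x. \<rho> ^ n * g x) x"
    unfolding funpow.simps comp_def using g by (intro tilt_mono bb_intros Suc)
  also have "\<dots> \<le> \<rho> ^ n * (\<rho> * g x)" unfolding tilt_cmult using \<rho> by (intro mult_left_mono) auto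
  finally show ?case by (simp add: mult_ac)
qed simp

lemma tilt_pow_lower:
  fixes z :: real
  assumes g: "bounded_borel g" and \<rho>: "0 \<le> \<rho>" "\<And>x. \<rho> * g x \<le> tilt z g x"
  shows "\<rho> ^ n * g x \<le> (tilt z ^^ n) g x"
proof (induction n arbitrary: x)
  case (Suc n)
  have "\<rho> ^ n * (\<rho> * g x) \<le> tilt z (\<lambda>x. \<rho> ^ n * g x) x"
    unfolding tilt_cmult using \<rho> by (intro mult_left_mono) auto
  also have "\<dots> \<le> (tilt z ^^ Suc n) g x"
    unfolding funpow.simps comp_def using g by (intro tilt_mono bb_intros Suc)
  finally show ?case by (simp add: mult_ac)
qed simp

lemma integrable_exp_walk_sum: "integrable \<Omega> (\<lambda>w. exp (z * walk_sum f n x w))"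
proof -
  obtain B where B: "B > 0" "\<And>x. norm (f x) \<le> B" by (rule bounded_borel_bound[OF bounded_borel_f]) blast
  show ?thesis
    using norm_exp_walk_sum_le[OF B(2), of z n x]
    by (intro path.integrable_const_bound[of _ "exp (norm z * (real n * B))"]) auto
qed

lemma mgf_walk_sum:
  assumes "0 < \<epsilon>"
  obtains r where "r > 0"
    "\<And>z n x. \<bar>z\<bar> \<le> r \<Longrightarrow> (LINT w|\<Omega>. exp (z * walk_sum f n x w)) \<le> 4 * exp (real n * z ^ 2 * (sigma2 / 2 + \<epsilon>))"
    "\<And>z n x. \<bar>z\<bar> \<le> r \<Longrightarrow> exp (real n * z ^ 2 * (sigma2 / 2 - \<epsilon>)) / 4 \<le> (LINT w|\<Omega>. exp (z * walk_sum f n x w))"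
proof -
  obtain r where r: "r > 0" and ex: "\<And>z :: real. \<bar>z\<bar> \<le> r \<Longrightarrow> \<exists>g. bounded_borel g \<and>
    (\<forall>x. 1 / 2 \<le> g x \<and> g x \<le> 2 \<and> exp (z ^ 2 * (sigma2 / 2 - \<epsilon>)) * g x \<le> tilt z g x
      \<and> tilt z g x \<le> exp (z ^ 2 * (sigma2 / 2 + \<epsilon>)) * g x)"
    by (rule real_eigenfunction_bounds[OF assms]) blast
  have main: "(LINT w|\<Omega>. exp (z * walk_sum f n x w)) \<le> 4 * exp (real n * z ^ 2 * (sigma2 / 2 + \<epsilon>)) \<and>
     exp (real n * z ^ 2 * (sigma2 / 2 - \<epsilon>)) / 4 \<le> (LINT w|\<Omega>. exp (z * walk_sum f n x w))"
    if z: "\<bar>z\<bar> \<le> r" for z n x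
  proof -
    obtain g where g: "bounded_borel g" "\<And>x. 1 / 2 \<le> g x" "\<And>x. g x \<le> 2"
      "\<And>x. exp (z ^ 2 * (sigma2 / 2 - \<epsilon>)) * g x \<le> tilt z g x"
      "\<And>x. tilt z g x \<le> exp (z ^ 2 * (sigma2 / 2 + \<epsilon>)) * g x"
      using ex[OF z] by blast
    note [measurable] = bounded_borel_measurable[OF g(1)]
    let ?e = "\<lambda>w. exp (z * walk_sum f n x w)"
    let ?G = "\<lambda>w. ?e w * g (walk_pos n x w)"
    have G: "(LINT w|\<Omega>. ?G w) = (tilt z ^^ n) g x"
      using integral_exp_walk_sum[OF g(1), of z n x] by simp
    have Gle: "?e w * (1 / 2) \<le> ?G w" "?G w \<le> ?e w * 2" for w
      using g(2,3) by (intro mult_left_mono; simp)+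
    have intG: "integrable \<Omega> ?G"
    proof (rule Bochner_Integration.integrable_bound)
      show "integrable \<Omega> (\<lambda>w. ?e w * 2)" using integrable_exp_walk_sum by simp
      show "AE w in \<Omega>. norm (?G w) \<le> norm (?e w * 2)"
      proof (rule AE_I2)
        fix w show "norm (?G w) \<le> norm (?e w * 2)"
          using Gle[of w] exp_gt_zero[of "z * walk_sum f n x w"] by simp
      qed
    qed measurable
    have "(LINT w|\<Omega>. ?e w * (1 / 2)) \<le> (LINT w|\<Omega>. ?G w)"
      using integrable_exp_walk_sum intG Gle(1) by (intro integral_mono) auto
    also have "\<dots> \<le> exp (z ^ 2 * (sigma2 / 2 + \<epsilon>)) ^ n * g x"
      unfolding G by (rule tilt_pow_upper[OF g(1) _ g(5)]) simp
    also have "\<dots> \<le> exp (z ^ 2 * (sigma2 / 2 + \<epsilon>)) ^ n * 2" using g(3) by (intro mult_left_mono) auto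
    finally have 1: "(LINT w|\<Omega>. ?e w) \<le> 4 * exp (real n * z ^ 2 * (sigma2 / 2 + \<epsilon>))"
      by (simp add: exp_of_nat_mult[symmetric] mult.assoc)
    have "exp (z ^ 2 * (sigma2 / 2 - \<epsilon>)) ^ n * (1 / 2) \<le> exp (z ^ 2 * (sigma2 / 2 - \<epsilon>)) ^ n * g x"
      using g(2) by (intro mult_left_mono) auto
    also have "\<dots> \<le> (LINT w|\<Omega>. ?G w)"
      unfolding G by (rule tilt_pow_lower[OF g(1) _ g(4)]) simp
    also have "\<dots> \<le> (LINT w|\<Omega>. ?e w * 2)"
      using integrable_exp_walk_sum intG Gle(2) by (intro integral_mono) auto
    finally have 2: "exp (real n * z ^ 2 * (sigma2 / 2 - \<epsilon>)) / 4 \<le> (LINT w|\<Omega>. ?e w)"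
      by (simp add: exp_of_nat_mult[symmetric] mult.assoc)
    show ?thesis using 1 2 by simp
  qed
  show ?thesis by (rule that[OF r]) (use main in auto)
qed

text \<open>First-step analysis of the first passage above \<open>y\<close>: the right-hand side
  dominates the indicator at the time of passage, where \<open>2 * g x \<ge> 1\<close>, and it
  reproduces itself under one step of the walk since \<open>g\<close> is a supersolution. This is
  optional stopping in inductive form.\<close>

lemma maximal_inequality_of_supersolution:
  assumes g: "bounded_borel g" "\<And>x. 1 / 2 \<le> g x" and z: "0 \<le> z"
    and \<rho>: "1 \<le> \<rho>" "\<And>x. tilt z g x \<le> \<rho> * g x"
  shows "measure \<Omega> {w\<in>space \<Omega>. \<exists>k\<le>n. y \<le> walk_sum f k x w} \<le> 2 * exp (- z * y) * \<rho> ^ n * g x"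
proof (induction n arbitrary: x y)
  case 0
  have "1 \<le> 2 * exp (- z * y) * g x" if "y \<le> 0"
    using mult_mono[of 1 "exp (- z * y)" "1 / 2" "g x"] g(2)[of x] z that by (simp add: mult_nonneg_nonpos)
  moreover have "0 \<le> g x" using g(2)[of x] by simp
  ultimately show ?case by (auto simp: path.prob_le_1 not_le)
next
  case (Suc n)
  show ?case
  proof (cases "y \<le> 0")
    case True
    have "1 * 1 * (1 / 2) \<le> exp (- z * y) * \<rho> ^ Suc n * g x"
      using True z \<rho>(1) g(2)[of x]
      by (intro mult_mono one_le_power) (auto simp: mult_nonneg_nonpos)
    then have "1 \<le> 2 * exp (- z * y) * \<rho> ^ Suc n * g x" by (simp add: mult.assoc)
    then show ?thesis using path.prob_le_1 by (rule order.trans[rotated])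
  next
    case False
    let ?E = "\<lambda>n y x. {w\<in>space \<Omega>. \<exists>k\<le>n. y \<le> walk_sum f k x w}"
    have [measurable]: "?E n y x \<in> sets \<Omega>" for n y x by measurable
    have set: "s ## w \<in> ?E (Suc n) y x \<longleftrightarrow> w \<in> ?E n (y - f (x + s)) (x + s)" for s w
    proof -
      have "(\<exists>k\<le>Suc n. y \<le> walk_sum f k x (s ## w)) \<longleftrightarrow> (\<exists>k\<le>n. y \<le> walk_sum f (Suc k) x (s ## w))"
      proof
        assume "\<exists>k\<le>Suc n. y \<le> walk_sum f k x (s ## w)"
        then obtain k where "k \<le> Suc n" "y \<le> walk_sum f k x (s ## w)" by blast
        then show "\<exists>k\<le>n. y \<le> walk_sum f (Suc k) x (s ## w)" using False by (cases k) auto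
      qed auto
      then show ?thesis by (simp add: algebra_simps)
    qed
    have "measure \<Omega> (?E (Suc n) y x) = (LINT w|\<Omega>. indicator (?E (Suc n) y x) w)"
      by simp
    also have "\<dots> = (LINT s|\<mu>. (LINT w|\<Omega>. indicator (?E (Suc n) y x) (s ## w)))"
      by (rule integral_first_step[where B = 1]) (auto simp: indicator_def)
    also have "\<dots> = (LINT s|\<mu>. (LINT w|\<Omega>. indicator (?E n (y - f (x + s)) (x + s)) w))"
      using set by (simp add: indicator_def)
    also have "\<dots> = (LINT s|\<mu>. measure \<Omega> (?E n (y - f (x + s)) (x + s)))"
      by simp
    also have "\<dots> \<le> (LINT s|\<mu>. 2 * exp (- z * (y - f (x + s))) * \<rho> ^ n * g (x + s))"
    proof (rule integral_mono')
      have "integrable \<mu> (\<lambda>s. (2 * exp (- z * y) * \<rho> ^ n) * (exp (z * of_real (f (x + s))) * g (x + s)))"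
        by (intro integrable_mult_right integrable_step[of "\<lambda>y. exp (z * of_real (f y)) * g y"] bb_intros g)
      then show "integrable \<mu> (\<lambda>s. 2 * exp (- z * (y - f (x + s))) * \<rho> ^ n * g (x + s))"
        by (simp add: right_diff_distrib exp_diff exp_minus field_simps)
      fix s
      have "0 \<le> g (x + s)" using g(2)[of "x + s"] by simp
      then show "0 \<le> 2 * exp (- z * (y - f (x + s))) * \<rho> ^ n * g (x + s)" using \<rho>(1) by simp
    qed (rule Suc)
    also have "\<dots> = (LINT s|\<mu>. (2 * exp (- z * y) * \<rho> ^ n) * (exp (z * of_real (f (x + s))) * g (x + s)))"
      by (simp add: right_diff_distrib exp_diff exp_minus field_simps)
    also have "\<dots> = (2 * exp (- z * y) * \<rho> ^ n) * tilt z g x"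
      by (simp add: tilt_def step_avg_def)
    also have "\<dots> \<le> (2 * exp (- z * y) * \<rho> ^ n) * (\<rho> * g x)"
      using \<rho> by (intro mult_left_mono) auto
    finally show ?thesis by (simp add: mult_ac)
  qed
qed

lemma maximal_inequality:
  assumes "0 < \<epsilon>"
  obtains r where "r > 0" "\<And>z n y x t. 0 \<le> z \<Longrightarrow> z \<le> r \<Longrightarrow> real n \<le> t \<Longrightarrow>
    measure \<Omega> {w\<in>space \<Omega>. \<exists>k\<le>n. y \<le> walk_sum f k x w} \<le> 4 * exp (t * z ^ 2 * (sigma2 / 2 + \<epsilon>) - z * y)"
proof -
  obtain r where r: "r > 0" and ex: "\<And>z :: real. \<bar>z\<bar> \<le> r \<Longrightarrow> \<exists>g. bounded_borel g \<and>
    (\<forall>x. 1 / 2 \<le> g x \<and> g x \<le> 2 \<and> exp (z ^ 2 * (sigma2 / 2 - \<epsilon>)) * g x \<le> tilt z g x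
      \<and> tilt z g x \<le> exp (z ^ 2 * (sigma2 / 2 + \<epsilon>)) * g x)"
    by (rule real_eigenfunction_bounds[OF assms]) blast
  show ?thesis
  proof (rule that[OF r])
    fix z t y x :: real and n :: nat assume z: "0 \<le> z" "z \<le> r" and t: "real n \<le> t"
    obtain g where g: "bounded_borel g" "\<And>x. 1 / 2 \<le> g x" "\<And>x. g x \<le> 2"
      "\<And>x. tilt z g x \<le> exp (z ^ 2 * (sigma2 / 2 + \<epsilon>)) * g x"
      using ex[of z] z by auto
    define q where "q = z ^ 2 * (sigma2 / 2 + \<epsilon>)"
    have q: "0 \<le> q" using assms sigma2_nonneg by (simp add: q_def)
    have "measure \<Omega> {w\<in>space \<Omega>. \<exists>k\<le>n. y \<le> walk_sum f k x w} \<le> 2 * exp (- z * y) * exp q ^ n * g x"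
      by (rule maximal_inequality_of_supersolution[OF g(1,2) z(1)]) (use q g(4) in \<open>auto simp: q_def\<close>)
    also have "\<dots> \<le> 2 * exp (- z * y) * exp q ^ n * 2"
      using g(3) by (intro mult_left_mono) auto
    also have "\<dots> = 4 * (exp (- z * y) * exp (real n * q))" by (simp add: exp_of_nat_mult)
    also have "\<dots> \<le> 4 * (exp (- z * y) * exp (t * q))"
      using t q by (intro mult_left_mono) (auto intro: mult_right_mono)
    also have "\<dots> = 4 * exp (t * z ^ 2 * (sigma2 / 2 + \<epsilon>) - z * y)"
      by (simp add: q_def mult.assoc flip: exp_add)
    finally show "measure \<Omega> {w\<in>space \<Omega>. \<exists>k\<le>n. y \<le> walk_sum f k x w}
      \<le> 4 * exp (t * z ^ 2 * (sigma2 / 2 + \<epsilon>) - z * y)" .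
  qed
qed

end

section \<open>Upper half of the law of the iterated logarithm and tail estimates\<close>

lemma walk_pos_cong: "(\<And>i. i < k \<Longrightarrow> w !! i = w' !! i) \<Longrightarrow> walk_pos k x w = walk_pos k x w'"
  unfolding walk_pos_eq by simp

lemma walk_sum_cong:
  assumes "\<And>i. i < k \<Longrightarrow> w !! i = w' !! i" shows "walk_sum f k x w = walk_sum f k x w'"
proof -
  have "walk_pos j x w = walk_pos j x w'" if "j \<le> k" for j
    using that assms by (intro walk_pos_cong) auto
  then show ?thesis unfolding walk_sum_eq by simp
qed

lemma walk_sum_prefix: "k \<le> m \<Longrightarrow> walk_sum f k x (stake m w @- w') = walk_sum f k x w"
  by (rule walk_sum_cong) (simp add: shift_snth_less)

lemma geometric_block:
  fixes q :: real
  assumes "1 < q" "q ^ n0 \<le> k"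
  obtains n where "n0 \<le> n" "q ^ n \<le> k" "k < q ^ Suc n"
proof -
  have k: "1 \<le> k" using assms one_le_power[of q n0] by linarith
  define n where "n = nat \<lfloor>log q k\<rfloor>"
  have l0: "0 \<le> log q k" using assms k by simp
  have n1: "real n \<le> log q k" "log q k < real n + 1" using l0 unfolding n_def by linarith+
  have "q ^ n = q powr n" using assms by (simp add: powr_realpow)
  also have "\<dots> \<le> q powr (log q k)" using n1 assms by (intro powr_mono) auto
  also have "\<dots> = k" using assms k by simp
  finally have 1: "q ^ n \<le> k" .
  have "k = q powr (log q k)" using assms k by simp
  also have "\<dots> < q powr (real (Suc n))" using n1 assms by (intro powr_less_mono) auto
  also have "\<dots> = q ^ Suc n" using assms by (simp only: powr_realpow)
  finally have 2: "k < q ^ Suc n" .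
  have "n0 \<le> n"
  proof (rule ccontr)
    assume "\<not> n0 \<le> n"
    then have "q ^ Suc n \<le> q ^ n0" using assms by (intro power_increasing) auto
    then show False using 2 assms by linarith
  qed
  then show ?thesis using that 1 2 by blast
qed

context centered_observable
begin

text \<open>On a geometric sequence of times the maximal inequality, used with the optimal
  \<open>z\<close>, gives probabilities of order \<open>n\<close> to the power \<open>-
  \<beta>\<close>, where \<open>\<beta> = c\<^sup>2 / (q v) > 1\<close> and \<open>v\<close> lies
  between \<open>\<sigma>\<^sup>2\<close> and \<open>c\<^sup>2\<close>. The threshold belongs to
  the left end of the block, so it is below the boundary throughout the block.\<close>

lemma lil_upper:
  assumes c: "0 < c" "sigma2 < c ^ 2"
  shows "AE w in \<Omega>. \<forall>\<^sub>F n in sequentially. walk_sum f n x w \<le> c * sqrt (2 * real n * ln (ln (real n)))"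
proof -
  define v where "v = sigma2 + (c ^ 2 - sigma2) / 4"
  define \<epsilon> where "\<epsilon> = (c ^ 2 - sigma2) / 8"
  have \<epsilon>: "0 < \<epsilon>" "sigma2 / 2 + \<epsilon> = v / 2" using c by (auto simp: \<epsilon>_def v_def)
  have "v = (3 * sigma2 + c ^ 2) / 4" by (simp add: v_def field_simps)
  then have v: "0 < v" "v < c ^ 2" using c sigma2_nonneg by (auto simp: add_nonneg_pos)
  \<comment> \<open>The midpoint of 1 and \<open>c\<^sup>2 / v\<close>, so that \<open>q v <
    c\<^sup>2\<close>.\<close>
  define q where "q = (1 + c ^ 2 / v) / 2"
  have q: "1 < q" "q * v < c ^ 2"
  proof -
    have "1 < c ^ 2 / v" using v by simp
    then show "1 < q" by (simp add: q_def)
    have "q * v = (v + c ^ 2) / 2" using v by (simp add: q_def field_simps)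
    then show "q * v < c ^ 2" using v by simp
  qed
  define l where "l = ln q"
  have l: "0 < l" using q by (simp add: l_def)
  define \<beta> where "\<beta> = c ^ 2 / (q * v)"
  have \<beta>: "1 < \<beta>" using q v by (simp add: \<beta>_def)
  obtain r where r: "r > 0" and mx: "\<And>z n y x t. 0 \<le> z \<Longrightarrow> z \<le> r \<Longrightarrow> real n \<le> t \<Longrightarrow>
    measure \<Omega> {w\<in>space \<Omega>. \<exists>k\<le>n. y \<le> walk_sum f k x w} \<le> 4 * exp (t * z ^ 2 * (sigma2 / 2 + \<epsilon>) - z * y)"
    by (rule maximal_inequality[OF \<epsilon>(1)]) blast
  define y where "y n = c * sqrt (2 * q ^ n * ln (real n * l))" for n
  define N where "N n = nat \<lfloor>q ^ Suc n\<rfloor>" for n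
  define A where "A n = {w\<in>space \<Omega>. \<exists>k\<le>N n. y n \<le> walk_sum f k x w}" for n
  have Nle: "real (N n) \<le> q ^ Suc n" for n
  proof -
    have "0 \<le> q ^ Suc n" using q by simp
    then show ?thesis unfolding N_def by linarith
  qed
  have ev_l: "\<forall>\<^sub>F n in sequentially. 1 \<le> real n * l"
    using l by real_asymp
  have z0: "(\<lambda>n. sqrt (2 * ln (real n * l) * (c ^ 2 / (q ^ n * (q * v) ^ 2)))) \<longlonglongrightarrow> sqrt 0"
    using q(1) v(1) l by (intro tendsto_intros) real_asymp
  have "\<forall>\<^sub>F n in sequentially. y n / (q ^ Suc n * v) \<le> r"
  proof -
    have "\<forall>\<^sub>F n in sequentially. sqrt (2 * ln (real n * l) * (c ^ 2 / (q ^ n * (q * v) ^ 2))) < r"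
      using order_tendstoD(2)[OF z0, of r] r by simp
    then show ?thesis
    proof eventually_elim
      case (elim n)
      have "y n / (q ^ Suc n * v) = sqrt ((y n / (q ^ Suc n * v)) ^ 2)" if "0 \<le> y n"
        using that q v by (simp add: real_sqrt_abs)
      have "sqrt (2 * ln (real n * l) * (c ^ 2 / (q ^ n * (q * v) ^ 2)))
          = sqrt ((2 * q ^ n * ln (real n * l)) * (c / (q ^ Suc n * v)) ^ 2)"
        using q v by (intro arg_cong[where f = sqrt]) (simp add: field_simps power2_eq_square)
      also have "\<dots> = sqrt (2 * q ^ n * ln (real n * l)) * (c / (q ^ Suc n * v))"
        unfolding real_sqrt_mult using q v c by (simp add: real_sqrt_abs)
      also have "\<dots> = y n / (q ^ Suc n * v)" by (simp add: y_def)
      finally show ?case using elim by simp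
    qed
  qed
  then have "\<forall>\<^sub>F n in sequentially. norm (measure \<Omega> (A n)) \<le> 4 * (l powr - \<beta> * real n powr - \<beta>)"
    using ev_l eventually_gt_at_top[of 0]
  proof eventually_elim
    case (elim n)
    define z where "z = y n / (q ^ Suc n * v)"
    have ln0: "0 \<le> ln (real n * l)" using elim(2) by simp
    have y0: "0 \<le> y n" using c q ln0 by (simp add: y_def)
    have z: "0 \<le> z" "z \<le> r" using elim(1) y0 q v by (auto simp: z_def)
    have y2: "y n ^ 2 = c ^ 2 * (2 * q ^ n * ln (real n * l))"
      using q ln0 by (simp add: y_def power_mult_distrib)
    have "measure \<Omega> (A n) \<le> 4 * exp (q ^ Suc n * z ^ 2 * (v / 2) - z * y n)"
      unfolding A_def \<epsilon>(2)[symmetric] by (rule mx[OF z Nle])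
    also have "q ^ Suc n * z ^ 2 * (v / 2) - z * y n = - (y n ^ 2 / (2 * (q ^ Suc n * v)))"
      using q v by (simp add: z_def field_simps power2_eq_square)
    also have "y n ^ 2 / (2 * (q ^ Suc n * v)) = \<beta> * ln (real n * l)"
      unfolding y2 using q v by (simp add: \<beta>_def field_simps)
    also have "exp (- (\<beta> * ln (real n * l))) = l powr - \<beta> * real n powr - \<beta>"
      using elim(3) l by (simp add: powr_def ln_mult distrib_left flip: exp_add)
    finally show ?case by simp
  qed
  moreover have "summable (\<lambda>n. 4 * (l powr - \<beta> * real n powr - \<beta>))"
    using \<beta> by (intro summable_mult) (simp add: summable_real_powr_iff)
  ultimately have "summable (\<lambda>n. measure \<Omega> (A n))"
    by (rule summable_comparison_test_ev)
  then have "AE w in \<Omega>. \<forall>\<^sub>F n in sequentially. w \<in> space \<Omega> - A n"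
  proof (rule borel_cantelli_AE1[rotated 2])
    show "A n \<in> sets \<Omega>" for n unfolding A_def by measurable
  qed (simp add: path.emeasure_eq_measure)
  then show ?thesis
  proof eventually_elim
    case (elim w)
    from elim ev_l have "\<forall>\<^sub>F n in sequentially. w \<notin> A n \<and> 1 \<le> real n * l"
      by eventually_elim auto
    then obtain n0 where n0: "\<And>n. n \<ge> n0 \<Longrightarrow> w \<notin> A n \<and> 1 \<le> real n * l"
      unfolding eventually_sequentially by blast
    have "\<forall>\<^sub>F k in sequentially. q ^ n0 \<le> real k"
      using filterlim_real_sequentially unfolding filterlim_at_top by blast
    then show ?case
    proof eventually_elim
      case (elim k)
      obtain n where n: "n0 \<le> n" "q ^ n \<le> real k" "real k < q ^ Suc n"
        by (rule geometric_block[OF q(1) elim])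
      have "k \<le> N n" unfolding N_def using n(3) by linarith
      moreover have "\<not> (\<exists>k\<le>N n. y n \<le> walk_sum f k x w)" using n0[OF n(1)] unfolding A_def by simp
      ultimately have "walk_sum f k x w < y n" by (meson not_le)
      also have "y n \<le> c * sqrt (2 * real k * ln (ln (real k)))"
      proof -
        have nl: "1 \<le> real n * l" using n0[OF n(1)] by simp
        have qn: "0 < q ^ n" using q by simp
        have "real n * l = ln (q ^ n)" using q by (simp add: l_def ln_realpow)
        also have "\<dots> \<le> ln (real k)" using n(2) qn by (subst ln_le_cancel_iff) auto
        finally have "ln (real n * l) \<le> ln (ln (real k))" using nl by (subst ln_le_cancel_iff) auto
        moreover have "0 \<le> ln (real n * l)" using nl by simp
        ultimately have "2 * q ^ n * ln (real n * l) \<le> 2 * real k * ln (ln (real k))"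
          using n(2) qn by (intro mult_mono) auto
        then show ?thesis unfolding y_def using c by simp
      qed
      finally show ?case by simp
    qed
  qed
qed

text \<open>Outside \<open>[c, d]\<close> the exponential weight is bounded by weights with
  smaller or larger parameter. In expectation these two terms are negligible if the tilted law
  concentrates inside \<open>[c, d]\<close>.\<close>

lemma tilting_pointwise:
  fixes T Z :: real
  assumes T: "0 \<le> T" and a: "0 \<le> a" and \<rho>: "0 \<le> \<rho>"
  shows "exp (2 * a * T * Z) \<le> exp (2 * a * T * d) * (if c \<le> Z then 1 else 0)
    + exp (2 * \<rho> * T * c) * exp (2 * (a - \<rho>) * T * Z) + exp (- (2 * \<rho> * T * d)) * exp (2 * (a + \<rho>) * T * Z)"
proof -
  consider "Z < c" | "d < Z" | "c \<le> Z" "Z \<le> d" by linarith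
  then show ?thesis
  proof cases
    case 1
    have "2 * \<rho> * T * Z \<le> 2 * \<rho> * T * c" using 1 T \<rho> by (intro mult_left_mono) auto
    then have "exp (2 * a * T * Z) \<le> exp (2 * \<rho> * T * c + 2 * (a - \<rho>) * T * Z)"
      by (simp add: algebra_simps)
    then show ?thesis using 1 by (simp add: exp_add add_increasing2)
  next
    case 2
    have "2 * \<rho> * T * d \<le> 2 * \<rho> * T * Z" using 2 T \<rho> by (intro mult_left_mono) auto
    then have "exp (2 * a * T * Z) \<le> exp (- (2 * \<rho> * T * d) + 2 * (a + \<rho>) * T * Z)"
      by (simp add: algebra_simps)
    then have "exp (2 * a * T * Z) \<le> exp (- (2 * \<rho> * T * d)) * exp (2 * (a + \<rho>) * T * Z)"
      by (simp only: exp_add)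
    then show ?thesis by (intro order.trans[OF _ add_increasing[OF _ order_refl]]) auto
  next
    case 3
    have "2 * a * T * Z \<le> 2 * a * T * d" using 3 T a by (intro mult_left_mono) auto
    then have "exp (2 * a * T * Z) \<le> exp (2 * a * T * d)" by simp
    then show ?thesis using 3 by (simp add: add_increasing2)
  qed
qed

text \<open>Moderate deviations from bounds on the moment generating function alone. In the scale
  \<open>Z = S / sqrt (2 n T)\<close> the law tilted by \<open>2 a T\<close> concentrates near
  \<open>a \<sigma>\<^sup>2 = c + k\<close>; leaving the window of radius \<open>k\<close> costs
  \<open>k\<^sup>2 / \<sigma>\<^sup>2\<close> in the exponent, which exceeds the loss through
  \<open>\<epsilon>\<close>. Undoing the tilt costs \<open>\<gamma> T\<close> with \<open>\<gamma>
  \<le> (c + 2 k)\<^sup>2 / \<sigma>\<^sup>2 < 1\<close>.\<close>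

lemma tail_lower_bound:
  assumes s: "0 < sigma2" and c: "0 < c" "c < sqrt sigma2"
  obtains \<gamma> \<kappa> T\<^sub>0 \<eta> where "\<gamma> < 1" "0 < \<kappa>" "0 < \<eta>"
    "\<And>T n x. T\<^sub>0 \<le> T \<Longrightarrow> 0 < T \<Longrightarrow> T \<le> \<eta> * real n \<Longrightarrow>
      \<kappa> * exp (- (\<gamma> * T)) \<le> measure \<Omega> {w\<in>space \<Omega>. c * sqrt (2 * real n * T) \<le> walk_sum f n x w}"
proof -
  define s where "s = sigma2"
  have s0: "0 < s" using s by (simp add: s_def)
  \<comment> \<open>The radius of the window: \<open>c + 2 k\<close> is the midpoint of
    \<open>c\<close> and \<open>\<sigma>\<close>.\<close>
  define k where "k = (sqrt s - c) / 4"
  have k: "0 < k" "c + 2 * k < sqrt s" using c by (auto simp: k_def s_def field_simps)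
  define a where "a = (c + k) / s"
  define \<rho> where "\<rho> = k / s"
  have a\<rho>: "0 < a" "0 < \<rho>" "0 \<le> a - \<rho>" "a * s = c + k" "\<rho> * s = k"
    using k c s0 by (auto simp: a_def \<rho>_def field_simps)
  define \<epsilon> where "\<epsilon> = k ^ 2 / (8 * s * (a + \<rho>) ^ 2)"
  have \<epsilon>: "0 < \<epsilon>" using k s0 a\<rho> by (simp add: \<epsilon>_def)
  have \<epsilon>le: "2 * \<epsilon> * b ^ 2 \<le> k ^ 2 / (4 * s)" if "0 \<le> b" "b \<le> a + \<rho>" for b
  proof -
    have "2 * \<epsilon> * b ^ 2 \<le> 2 * \<epsilon> * (a + \<rho>) ^ 2" using that \<epsilon> by (intro mult_left_mono power_mono) auto
    also have "\<dots> = k ^ 2 / (4 * s)" using a\<rho> s0 by (simp add: \<epsilon>_def field_simps)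
    finally show ?thesis .
  qed
  obtain r where r: "r > 0"
    and mgf_up: "\<And>z n x. \<bar>z\<bar> \<le> r \<Longrightarrow> (LINT w|\<Omega>. exp (z * walk_sum f n x w)) \<le> 4 * exp (real n * z ^ 2 * (sigma2 / 2 + \<epsilon>))"
    and mgf_lo: "\<And>z n x. \<bar>z\<bar> \<le> r \<Longrightarrow> exp (real n * z ^ 2 * (sigma2 / 2 - \<epsilon>)) / 4 \<le> (LINT w|\<Omega>. exp (z * walk_sum f n x w))"
    by (rule mgf_walk_sum[OF \<epsilon>]) blast
  define \<eta> where "\<eta> = r ^ 2 / (2 * (a + \<rho>) ^ 2)"
  have \<eta>: "0 < \<eta>" using r a\<rho> by (simp add: \<eta>_def)
  define \<gamma> where "\<gamma> = (2 * a * (c + 2 * k) - a ^ 2 * s) + k ^ 2 / (4 * s)"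
  define d where "d = k ^ 2 / (4 * s)"
  have d: "0 < d" using k s0 by (simp add: d_def)
  have "\<gamma> < 1"
  proof -
    have "\<gamma> = ((c + k) ^ 2 + 2 * k * (c + k) + k ^ 2 / 4) / s"
      using s0 by (simp add: \<gamma>_def a_def field_simps power2_eq_square)
    also have "\<dots> \<le> (c + 2 * k) ^ 2 / s"
      using s0 by (intro divide_right_mono) (auto simp: power2_eq_square algebra_simps)
    also have "\<dots> < (sqrt s) ^ 2 / s" using k c s0 by (intro divide_strict_right_mono power_strict_mono) auto
    also have "\<dots> = 1" using s0 by simp
    finally show ?thesis .
  qed
  moreover have "1 / 8 * exp (- (\<gamma> * T)) \<le> measure \<Omega> {w\<in>space \<Omega>. c * sqrt (2 * real n * T) \<le> walk_sum f n x w}"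
    if T: "ln 64 / (2 * d) \<le> T" "0 < T" "T \<le> \<eta> * real n" for T n x
  proof -
    have n: "0 < real n" using T \<eta> by (metis less_le_trans mult_zero_right of_nat_0_le_iff order_less_le)
    define S where "S = sqrt (2 * T / real n)"
    define W where "W = sqrt (2 * real n * T)"
    have W: "0 < W" using n T by (simp add: W_def)
    have "S * W = sqrt ((2 * T) ^ 2)"
      unfolding S_def W_def real_sqrt_mult[symmetric] using n by (simp add: power2_eq_square)
    then have SW: "S * W = 2 * T" using T by (simp only: real_sqrt_abs)
    have S: "0 \<le> S" "real n * S ^ 2 = 2 * T" using n T by (auto simp: S_def)
    have bS: "\<bar>b * S\<bar> \<le> r" if "0 \<le> b" "b \<le> a + \<rho>" for b
    proof -
      have "(b * S) ^ 2 \<le> (a + \<rho>) ^ 2 * S ^ 2"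
        unfolding power_mult_distrib using that by (intro mult_right_mono power_mono) auto
      also have "S ^ 2 = 2 * T / real n" using n T by (simp add: S_def)
      also have "\<dots> \<le> 2 * \<eta>" using T n by (simp add: field_simps)
      also have "(a + \<rho>) ^ 2 * (2 * \<eta>) = r ^ 2" using a\<rho> by (simp add: \<eta>_def)
      finally have "(a + \<rho>) ^ 2 * 0 + (b * S) ^ 2 \<le> r ^ 2" by (simp add: mult_left_mono)
      then show ?thesis using r abs_le_square_iff[of "b * S" r] by simp
    qed
    have up: "(LINT w|\<Omega>. exp ((b * S) * walk_sum f n x w)) \<le> 4 * exp (T * (b ^ 2 * s + d))"
      if "0 \<le> b" "b \<le> a + \<rho>" for b
    proof -
      have "real n * (b * S) ^ 2 = b ^ 2 * (2 * T)" using S(2) by (simp add: power_mult_distrib mult_ac)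
      then have "real n * (b * S) ^ 2 * (sigma2 / 2 + \<epsilon>) = b ^ 2 * (2 * T) * (sigma2 / 2 + \<epsilon>)"
        by (simp only:)
      also have "\<dots> = T * (b ^ 2 * s + 2 * \<epsilon> * b ^ 2)" by (simp add: s_def algebra_simps)
      also have "\<dots> \<le> T * (b ^ 2 * s + d)" using \<epsilon>le[OF that] T by (intro mult_left_mono) (auto simp: d_def)
      finally show ?thesis using mgf_up[OF bS[OF that], of n x] by (smt (verit) exp_le_cancel_iff)
    qed
    have lo: "exp (T * (a ^ 2 * s - d)) / 4 \<le> (LINT w|\<Omega>. exp ((a * S) * walk_sum f n x w))"
    proof -
      have ab: "0 \<le> a" "a \<le> a + \<rho>" using a\<rho> by auto
      have "real n * (a * S) ^ 2 = a ^ 2 * (2 * T)" using S(2) by (simp add: power_mult_distrib mult_ac)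
      then have "real n * (a * S) ^ 2 * (sigma2 / 2 - \<epsilon>) = a ^ 2 * (2 * T) * (sigma2 / 2 - \<epsilon>)"
        by (simp only:)
      also have "\<dots> = T * (a ^ 2 * s - 2 * \<epsilon> * a ^ 2)" by (simp add: s_def algebra_simps)
      finally have e1: "real n * (a * S) ^ 2 * (sigma2 / 2 - \<epsilon>) = T * (a ^ 2 * s - 2 * \<epsilon> * a ^ 2)" .
      moreover have "T * (a ^ 2 * s - d) \<le> T * (a ^ 2 * s - 2 * \<epsilon> * a ^ 2)"
        using \<epsilon>le[OF ab] T by (intro mult_left_mono) (auto simp: d_def)
      ultimately show ?thesis using mgf_lo[OF bS[OF ab], of n x] by (smt (verit) exp_le_cancel_iff divide_right_mono)
    qed
    define E where "E = {w\<in>space \<Omega>. c * W \<le> walk_sum f n x w}"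
    let ?M = "\<lambda>w. walk_sum f n x w"
    have pw: "exp ((a * S) * ?M w) \<le> exp (2 * a * T * (c + 2 * k)) * indicator E w
      + exp (2 * \<rho> * T * c) * exp (((a - \<rho>) * S) * ?M w)
      + exp (- (2 * \<rho> * T * (c + 2 * k))) * exp (((a + \<rho>) * S) * ?M w)" for w
    proof -
      have e: "2 * b * T * (?M w / W) = (b * S) * ?M w" for b
      proof -
        have "2 * b * T * (?M w / W) = b * (S * W) * (?M w / W)" by (simp add: SW)
        then show ?thesis using W by simp
      qed
      have "(c \<le> ?M w / W) = (w \<in> E)" using W by (simp add: E_def field_simps)
      then show ?thesis
        using tilting_pointwise[of T a \<rho> "?M w / W" "c + 2 * k" c] T a\<rho> unfolding e
        by (auto simp: indicator_def)
    qed
    have mE: "E \<in> sets \<Omega>" unfolding E_def by measurable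
    have int: "integrable \<Omega> (\<lambda>w. exp (z * ?M w))" for z by (rule integrable_exp_walk_sum)
    have intE: "integrable \<Omega> (indicator E :: _ \<Rightarrow> real)"
      using mE by (simp add: path.emeasure_eq_measure)
    have "(LINT w|\<Omega>. exp ((a * S) * ?M w)) \<le> (LINT w|\<Omega>. exp (2 * a * T * (c + 2 * k)) * indicator E w
      + exp (2 * \<rho> * T * c) * exp (((a - \<rho>) * S) * ?M w)
      + exp (- (2 * \<rho> * T * (c + 2 * k))) * exp (((a + \<rho>) * S) * ?M w))"
      by (intro integral_mono pw int Bochner_Integration.integrable_add integrable_mult_right intE)
    also have "\<dots> = exp (2 * a * T * (c + 2 * k)) * measure \<Omega> E
      + exp (2 * \<rho> * T * c) * (LINT w|\<Omega>. exp (((a - \<rho>) * S) * ?M w))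
      + exp (- (2 * \<rho> * T * (c + 2 * k))) * (LINT w|\<Omega>. exp (((a + \<rho>) * S) * ?M w))"
      using mE by (simp add: int intE)
    also have "\<dots> \<le> exp (2 * a * T * (c + 2 * k)) * measure \<Omega> E
      + exp (2 * \<rho> * T * c) * (4 * exp (T * ((a - \<rho>) ^ 2 * s + d)))
      + exp (- (2 * \<rho> * T * (c + 2 * k))) * (4 * exp (T * ((a + \<rho>) ^ 2 * s + d)))"
      using a\<rho> by (intro add_mono mult_left_mono up order_refl) auto
    also have "exp (2 * \<rho> * T * c) * (4 * exp (T * ((a - \<rho>) ^ 2 * s + d))) = 4 * exp (T * (a ^ 2 * s - 3 * d))"
    proof -
      have "2 * \<rho> * c + (a - \<rho>) ^ 2 * s + d = a ^ 2 * s - 3 * d"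
        using s0 by (simp add: a_def \<rho>_def d_def field_simps power2_eq_square)
      then have "2 * \<rho> * T * c + T * ((a - \<rho>) ^ 2 * s + d) = T * (a ^ 2 * s - 3 * d)"
        by (metis (no_types, opaque_lifting) add.assoc distrib_left mult.commute mult.left_commute)
      then show ?thesis by (simp flip: exp_add)
    qed
    also have "exp (- (2 * \<rho> * T * (c + 2 * k))) * (4 * exp (T * ((a + \<rho>) ^ 2 * s + d))) = 4 * exp (T * (a ^ 2 * s - 3 * d))"
    proof -
      have "- (2 * \<rho> * (c + 2 * k)) + ((a + \<rho>) ^ 2 * s + d) = a ^ 2 * s - 3 * d"
        using s0 by (simp add: a_def \<rho>_def d_def field_simps power2_eq_square)
      moreover have "- (2 * \<rho> * T * (c + 2 * k)) + T * ((a + \<rho>) ^ 2 * s + d)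
          = T * (- (2 * \<rho> * (c + 2 * k)) + ((a + \<rho>) ^ 2 * s + d))" by (simp add: algebra_simps)
      ultimately have "- (2 * \<rho> * T * (c + 2 * k)) + T * ((a + \<rho>) ^ 2 * s + d) = T * (a ^ 2 * s - 3 * d)"
        by (simp only:)
      then show ?thesis by (simp flip: exp_add)
    qed
    finally have "exp (T * (a ^ 2 * s - d)) / 4 \<le> exp (2 * a * T * (c + 2 * k)) * measure \<Omega> E + 8 * exp (T * (a ^ 2 * s - 3 * d))"
      using lo by simp
    moreover have "8 * exp (T * (a ^ 2 * s - 3 * d)) \<le> exp (T * (a ^ 2 * s - d)) / 8"
    proof -
      have "ln 64 \<le> T * (2 * d)" using T(1) d by (simp add: pos_divide_le_eq)
      then have "64 \<le> exp (T * (2 * d))" by (metis exp_le_cancel_iff exp_ln zero_less_numeral)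
      then have "64 * exp (T * (a ^ 2 * s - 3 * d)) \<le> exp (T * (2 * d)) * exp (T * (a ^ 2 * s - 3 * d))"
        by (intro mult_right_mono) auto
      also have "\<dots> = exp (T * (a ^ 2 * s - d))" by (simp add: algebra_simps flip: exp_add)
      finally show ?thesis by simp
    qed
    ultimately have "1 / 8 * exp (T * (a ^ 2 * s - d)) \<le> exp (2 * a * T * (c + 2 * k)) * measure \<Omega> E" by simp
    then have "exp (- (2 * a * T * (c + 2 * k))) * (1 / 8 * exp (T * (a ^ 2 * s - d)))
        \<le> exp (- (2 * a * T * (c + 2 * k))) * (exp (2 * a * T * (c + 2 * k)) * measure \<Omega> E)"
      by (intro mult_left_mono) auto
    also have "\<dots> = measure \<Omega> E" by (simp add: exp_minus)
    also have "exp (- (2 * a * T * (c + 2 * k))) * (1 / 8 * exp (T * (a ^ 2 * s - d))) = 1 / 8 * exp (- (\<gamma> * T))"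
    proof -
      have "- (2 * a * T * (c + 2 * k)) + T * (a ^ 2 * s - d) = - (\<gamma> * T)"
        by (simp add: \<gamma>_def d_def algebra_simps)
      then show ?thesis by (simp flip: exp_add)
    qed
    finally show ?thesis unfolding E_def W_def .
  qed
  ultimately show ?thesis using \<eta> by (intro that[of \<gamma> "1 / 8" \<eta> "ln 64 / (2 * d)"]) auto
qed

end

section \<open>Lower half of the law of the iterated logarithm\<close>

context centered_observable
begin

text \<open>Induction on the number of blocks. By the Markov property at the beginning of the last
  block, its increment is that of a fresh walk from a random position, and \<open>p\<close> bounds
  the chance of success from every position.\<close>

lemma prob_no_large_block_le:
  assumes N: "incseq N" and p: "\<And>n x. m \<le> n \<Longrightarrow> p n \<le> measure \<Omega> {w\<in>space \<Omega>. y n \<le> walk_sum f (N (Suc n) - N n) x w}"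
  shows "measure \<Omega> {w\<in>space \<Omega>. \<forall>n\<in>{m..<m + j}. walk_sum f (N (Suc n)) x w - walk_sum f (N n) x w < y n}
    \<le> (\<Prod>n\<in>{m..<m + j}. 1 - p n)"
proof (induction j)
  case 0 then show ?case by simp
next
  case (Suc j)
  define F where "F j = {w\<in>space \<Omega>. \<forall>n\<in>{m..<m + j}. walk_sum f (N (Suc n)) x w - walk_sum f (N n) x w < y n}" for j
  have mF[measurable]: "F j \<in> sets \<Omega>" for j unfolding F_def by measurable
  define k where "k = m + j"
  define L where "L = N (Suc k) - N k"
  have NL: "N (Suc k) = N k + L" using incseqD[OF N, of k "Suc k"] by (simp add: L_def)
  define H where "H z = {w\<in>space \<Omega>. walk_sum f L z w < y k}" for z
  have mH: "H z \<in> sets \<Omega>" for z unfolding H_def by measurable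
  have H: "measure \<Omega> (H z) \<le> 1 - p k" for z
  proof -
    have "H z = space \<Omega> - {w\<in>space \<Omega>. y k \<le> walk_sum f L z w}" by (auto simp: H_def)
    then have "measure \<Omega> (H z) = 1 - measure \<Omega> {w\<in>space \<Omega>. y k \<le> walk_sum f L z w}"
      by (simp only:) (rule path.prob_compl, measurable)
    then show ?thesis using p[of k z] by (simp add: k_def L_def)
  qed
  have split: "(stake (N k) w @- w') \<in> F (Suc j) \<longleftrightarrow> w \<in> F j \<and> w' \<in> H (walk_pos (N k) x w)" for w w'
  proof -
    let ?w = "stake (N k) w @- w'"
    have old: "walk_sum f (N i) x ?w = walk_sum f (N i) x w" if "i \<le> k" for i
      using incseqD[OF N that] by (rule walk_sum_prefix)
    have new: "walk_sum f (N (Suc k)) x ?w - walk_sum f (N k) x ?w = walk_sum f L (walk_pos (N k) x w) w'"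
      unfolding NL walk_sum_add by (simp add: sdrop_shift)
    have "(\<forall>n\<in>{m..<m + Suc j}. walk_sum f (N (Suc n)) x ?w - walk_sum f (N n) x ?w < y n)
      \<longleftrightarrow> (\<forall>n\<in>{m..<m + j}. walk_sum f (N (Suc n)) x ?w - walk_sum f (N n) x ?w < y n)
        \<and> walk_sum f (N (Suc k)) x ?w - walk_sum f (N k) x ?w < y k"
    proof -
      have "{m..<m + Suc j} = insert k {m..<m + j}" by (auto simp: k_def)
      show ?thesis unfolding \<open>{m..<m + Suc j} = insert k {m..<m + j}\<close> by blast
    qed
    also have "(\<forall>n\<in>{m..<m + j}. walk_sum f (N (Suc n)) x ?w - walk_sum f (N n) x ?w < y n)
      \<longleftrightarrow> (\<forall>n\<in>{m..<m + j}. walk_sum f (N (Suc n)) x w - walk_sum f (N n) x w < y n)"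
    proof (intro ball_cong refl)
      fix n assume "n \<in> {m..<m + j}"
      then have "n \<le> k" "Suc n \<le> k" by (auto simp: k_def)
      then show "(walk_sum f (N (Suc n)) x ?w - walk_sum f (N n) x ?w < y n)
        = (walk_sum f (N (Suc n)) x w - walk_sum f (N n) x w < y n)"
        by (simp only: old)
    qed
    finally show ?thesis unfolding new by (simp add: F_def H_def)
  qed
  have "measure \<Omega> (F (Suc j)) = (LINT w|\<Omega>. indicator (F (Suc j)) w)" by simp
  also have "\<dots> = (LINT w|\<Omega>. (LINT w'|\<Omega>. indicator (F (Suc j)) (stake (N k) w @- w')))"
    by (rule integral_markov[where B = 1]) (auto simp: indicator_def)
  also have "\<dots> = (LINT w|\<Omega>. (LINT w'|\<Omega>. indicator (F j) w * indicator (H (walk_pos (N k) x w)) w'))"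
    unfolding indicator_def split by (simp add: of_bool_conj)
  also have "\<dots> = (LINT w|\<Omega>. indicator (F j) w * measure \<Omega> (H (walk_pos (N k) x w)))"
    using mH by simp
  also have "\<dots> \<le> (LINT w|\<Omega>. indicator (F j) w * (1 - p k))"
  proof (rule integral_mono')
    show "integrable \<Omega> (\<lambda>w. indicator (F j) w * (1 - p k))"
      by (intro integrable_mult_left) (simp add: path.emeasure_eq_measure)
    show "indicator (F j) w * measure \<Omega> (H (walk_pos (N k) x w)) \<le> indicator (F j) w * (1 - p k)" for w
      using H by (intro mult_left_mono) auto
    show "0 \<le> indicator (F j) w * (1 - p k)" for w
      using order.trans[OF measure_nonneg H] by simp
  qed
  also have "\<dots> = measure \<Omega> (F j) * (1 - p k)" by simp
  also have "\<dots> \<le> (\<Prod>n\<in>{m..<m + j}. 1 - p n) * (1 - p k)"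
    using Suc.IH order.trans[OF measure_nonneg H] unfolding F_def by (intro mult_right_mono) auto
  also have "\<dots> = (\<Prod>n\<in>{m..<m + Suc j}. 1 - p n)" by (simp add: k_def)
  finally show ?case unfolding F_def .
qed

text \<open>The second Borel-Cantelli lemma for events that are not independent but have success
  probabilities bounded below uniformly in the past.\<close>

lemma frequently_large_block:
  assumes N: "incseq N" and p0: "\<And>n. m0 \<le> n \<Longrightarrow> 0 \<le> p n" and div: "\<not> summable p"
    and p: "\<And>n x. m0 \<le> n \<Longrightarrow> p n \<le> measure \<Omega> {w\<in>space \<Omega>. y n \<le> walk_sum f (N (Suc n) - N n) x w}"
  shows "AE w in \<Omega>. \<exists>\<^sub>F n in sequentially. y n \<le> walk_sum f (N (Suc n)) x w - walk_sum f (N n) x w"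
proof -
  define F where "F m j = {w\<in>space \<Omega>. \<forall>n\<in>{m..<m + j}. walk_sum f (N (Suc n)) x w - walk_sum f (N n) x w < y n}" for m j
  have mF[measurable]: "F m j \<in> sets \<Omega>" for m j unfolding F_def by measurable
  have null: "AE w in \<Omega>. \<exists>j. w \<notin> F m j" if m: "m0 \<le> m" for m
  proof -
    have p1: "p n \<le> 1" if "m \<le> n" for n using p[of n] path.prob_le_1 m that order.trans by (meson le_trans)
    have le: "measure \<Omega> (F m j) \<le> exp (- (\<Sum>n\<in>{m..<m + j}. p n))" for j
    proof -
      have "measure \<Omega> (F m j) \<le> (\<Prod>n\<in>{m..<m + j}. 1 - p n)"
        unfolding F_def by (rule prob_no_large_block_le[OF N p]) (use m in simp)
      also have "\<dots> \<le> (\<Prod>n\<in>{m..<m + j}. exp (- p n))"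
        using p1 exp_ge_add_one_self[of "- p n" for n] by (intro prod_mono) (auto simp: algebra_simps)
      also have "\<dots> = exp (- (\<Sum>n\<in>{m..<m + j}. p n))" by (simp add: exp_sum flip: sum_negf)
      finally show ?thesis .
    qed
    have "\<exists>j. C < (\<Sum>n\<in>{m..<m + j}. p n)" for C
    proof (rule ccontr)
      assume "\<not> (\<exists>j. C < (\<Sum>n\<in>{m..<m + j}. p n))"
      moreover have "(\<Sum>n<j. p (n + m)) = (\<Sum>n\<in>{m..<m + j}. p n)" for j
        using sum.shift_bounds_nat_ivl[of p 0 m j] by (simp add: lessThan_atLeast0 add.commute)
      ultimately have "(\<Sum>n<j. p (n + m)) \<le> C" for j by (simp add: not_less)
      then have "summable (\<lambda>n. p (n + m))" using p0 m
        by (intro summableI_nonneg_bounded[where x = C]) auto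
      then show False using div by (simp add: summable_iff_shift)
    qed
    note unb = this
    have "emeasure \<Omega> (\<Inter>j. F m j) = 0"
    proof -
      have "measure \<Omega> (\<Inter>j. F m j) \<le> 0 + e" if "0 < e" for e
      proof -
        obtain j where j: "- ln e < (\<Sum>n\<in>{m..<m + j}. p n)" using unb by blast
        have "measure \<Omega> (\<Inter>j. F m j) \<le> measure \<Omega> (F m j)"
          by (rule path.finite_measure_mono) auto
        also have "\<dots> \<le> exp (ln e)" using j by (intro order.trans[OF le]) simp
        finally show ?thesis using that by simp
      qed
      then have "measure \<Omega> (\<Inter>j. F m j) \<le> 0" by (rule field_le_epsilon)
      then show ?thesis by (simp add: path.emeasure_eq_measure measure_le_0_iff)
    qed
    then have "AE w in \<Omega>. w \<notin> (\<Inter>j. F m j)" by (intro AE_not_in) (auto simp: null_sets_def)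
    then show ?thesis by eventually_elim auto
  qed
  have "AE w in \<Omega>. \<forall>m\<ge>m0. \<exists>j. w \<notin> F m j"
    unfolding AE_all_countable using null by (intro allI) (auto intro: AE_I2)
  then show ?thesis
  proof eventually_elim
    case (elim w)
    show ?case unfolding frequently_sequentially
    proof
      fix M
      obtain j where "w \<notin> F (max M m0) j" using elim by (metis max.cobounded2)
      then obtain n where "n \<in> {max M m0..<max M m0 + j}" "y n \<le> walk_sum f (N (Suc n)) x w - walk_sum f (N n) x w"
        unfolding F_def by (auto simp: not_less)
      then show "\<exists>n\<ge>M. y n \<le> walk_sum f (N (Suc n)) x w - walk_sum f (N n) x w" by auto
    qed
  qed
qed

lemma neg_observable: "centered_observable \<mu> \<psi> (\<lambda>x. - f x) K"
proof unfold_locales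
  show "- f (x + 1) = - f x" for x by (simp add: periodic)
  show "unit_variation_le K (\<lambda>x. - f x)"
    using variation unfolding unit_variation_le_def by (simp add: abs_minus_commute)
  show "(LINT x|unif. - f x) = 0" by (simp add: centered)
qed

lemma step_avg_pow_minus: "(step_avg ^^ k) (\<lambda>x. - f x) x = - (step_avg ^^ k) f x"
  using step_avg_pow_diff[OF bounded_borel_const[of 0] bounded_borel_f, of k x]
    step_avg_pow_norm_le[OF bounded_borel_const[of 0], of 0 k x] by simp

lemma neg_sigma2: "centered_observable.sigma2 \<mu> (\<lambda>x. - f x) = sigma2"
proof -
  interpret neg: centered_observable \<mu> \<psi> "\<lambda>x. - f x" K by (rule neg_observable)
  have "neg.corrector x = - corrector x" for x
    unfolding neg.corrector_def corrector_def step_avg_pow_minus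
    by (rule suminf_minus) (rule summable_step_avg_pow')
  then show ?thesis by (simp add: neg.sigma2_def sigma2_def)
qed

text \<open>On blocks from \<open>q ^ n\<close> to \<open>q ^ Suc n\<close> with \<open>q\<close>
  large, an increment of almost maximal size occurs infinitely often. The past of the block has
  length \<open>q ^ n\<close> only and is, by the upper half for \<open>- f\<close>, too small to
  spoil it. If \<open>\<sigma> = 0\<close>, then \<open>d\<close> is negative, and the upper half
  for \<open>- f\<close> is the claim.\<close>

lemma lil_lower:
  assumes d: "d < sqrt sigma2"
  shows "AE w in \<Omega>. \<exists>\<^sub>F n in sequentially. d * sqrt (2 * real n * ln (ln (real n))) \<le> walk_sum f n x w"
proof -
  interpret neg: centered_observable \<mu> \<psi> "\<lambda>x. - f x" K by (rule neg_observable)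
  have neg_upper: "AE w in \<Omega>. \<forall>\<^sub>F n in sequentially. - walk_sum f n x w \<le> c * sqrt (2 * real n * ln (ln (real n)))"
    if "0 < c" "sigma2 < c ^ 2" for c
    using neg.lil_upper[of c x] that by (simp add: neg_sigma2 walk_sum_minus)
  show ?thesis
  proof (cases "sigma2 = 0")
    case True
    then have "0 < - d" using d by simp
    then have "AE w in \<Omega>. \<forall>\<^sub>F n in sequentially. - walk_sum f n x w \<le> (- d) * sqrt (2 * real n * ln (ln (real n)))"
      by (intro neg_upper) (auto simp: True)
    then show ?thesis
    proof eventually_elim
      case (elim w)
      then have "\<forall>\<^sub>F n in sequentially. d * sqrt (2 * real n * ln (ln (real n))) \<le> walk_sum f n x w"
        by eventually_elim simp
      then show ?case by (rule eventually_frequently[rotated]) simp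
    qed
  next
    case False
    then have s: "0 < sigma2" using sigma2_nonneg by simp
    define \<sigma> where "\<sigma> = sqrt sigma2"
    have \<sigma>: "0 < \<sigma>" "d < \<sigma>" using s d by (auto simp: \<sigma>_def)
    \<comment> \<open>A positive level, as \<open>tail_lower_bound\<close> requires.\<close>
    define d' where "d' = max d (\<sigma> / 2)"
    have d': "d \<le> d'" "0 < d'" "d' < \<sigma>" using \<sigma> by (auto simp: d'_def)
    define c where "c = (d' + \<sigma>) / 2"
    have c: "d' < c" "0 < c" "c < \<sigma>" using d' by (auto simp: c_def)
    have "(\<lambda>q::nat. c * sqrt (1 - 1 / real q) - (\<sigma> + 1) / sqrt (real q)) \<longlonglongrightarrow> c * sqrt (1 - 0) - 0"
      by (intro tendsto_intros) real_asymp+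
    then have "(\<lambda>q::nat. c * sqrt (1 - 1 / real q) - (\<sigma> + 1) / sqrt (real q)) \<longlonglongrightarrow> c" by simp
    then have "\<forall>\<^sub>F q in sequentially. d' < c * sqrt (1 - 1 / real q) - (\<sigma> + 1) / sqrt (real q)"
      using c by (intro order_tendstoD(1)) auto
    then have "\<forall>\<^sub>F q in sequentially. d' < c * sqrt (1 - 1 / real q) - (\<sigma> + 1) / sqrt (real q) \<and> 2 \<le> q"
      using eventually_ge_at_top[of 2] by eventually_elim auto
    then obtain q :: nat where q: "d' < c * sqrt (1 - 1 / real q) - (\<sigma> + 1) / sqrt (real q)" "2 \<le> q"
      unfolding eventually_sequentially by blast
    define l where "l = ln (real q)"
    have l: "0 < l" using q by (simp add: l_def)
    define N where "N n = q ^ n" for n :: nat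
    have N: "incseq N" using q by (auto simp: N_def incseq_def intro!: power_increasing)
    have L: "real (N (Suc n) - N n) = real q ^ n * (real q - 1)" for n
    proof -
      have "N n \<le> N (Suc n)" using N by (auto simp: incseq_def)
      then have "real (N (Suc n) - N n) = real (N (Suc n)) - real (N n)" by (rule of_nat_diff)
      then show ?thesis by (simp add: N_def algebra_simps)
    qed
    define y where "y n = c * sqrt (2 * real (N (Suc n) - N n) * ln (real n))" for n
    obtain \<gamma> \<kappa> T\<^sub>0 \<eta> where g: "\<gamma> < 1" "0 < \<kappa>" "0 < \<eta>" and tail:
      "\<And>T n x. T\<^sub>0 \<le> T \<Longrightarrow> 0 < T \<Longrightarrow> T \<le> \<eta> * real n \<Longrightarrow>
        \<kappa> * exp (- (\<gamma> * T)) \<le> measure \<Omega> {w\<in>space \<Omega>. c * sqrt (2 * real n * T) \<le> walk_sum f n x w}"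
      by (rule tail_lower_bound[OF s c(2) c(3)[unfolded \<sigma>_def]]) blast
    have q1: "1 < real q" using q by simp
    have t1: "\<forall>\<^sub>F n in sequentially. T\<^sub>0 \<le> ln (real n)" by real_asymp
    have t2: "\<forall>\<^sub>F n in sequentially. 0 < ln (real n)" by real_asymp
    have t3: "\<forall>\<^sub>F n in sequentially. ln (real n) \<le> \<eta> * (real q ^ n * (real q - 1))"
      using q1 g(3) by real_asymp
    from t1 t2 t3 eventually_gt_at_top[of 0]
    have "\<forall>\<^sub>F n in sequentially. T\<^sub>0 \<le> ln (real n) \<and> 0 < ln (real n) \<and> ln (real n) \<le> \<eta> * (real q ^ n * (real q - 1)) \<and> 0 < n"
      by eventually_elim auto
    then obtain m0 where m0: "\<And>n. m0 \<le> n \<Longrightarrow>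
        T\<^sub>0 \<le> ln (real n) \<and> 0 < ln (real n) \<and> ln (real n) \<le> \<eta> * (real q ^ n * (real q - 1)) \<and> 0 < n"
      unfolding eventually_sequentially by blast
    have large: "AE w in \<Omega>. \<exists>\<^sub>F n in sequentially. y n \<le> walk_sum f (N (Suc n)) x w - walk_sum f (N n) x w"
    proof (rule frequently_large_block[OF N, of m0 "\<lambda>n. \<kappa> * real n powr (- \<gamma>)"])
      show "0 \<le> \<kappa> * real n powr (- \<gamma>)" for n using g by simp
      show "\<not> summable (\<lambda>n. \<kappa> * real n powr (- \<gamma>))"
        using g by (simp add: summable_cmult_iff summable_real_powr_iff)
      fix n x assume "m0 \<le> n"
      from m0[OF this] have m: "T\<^sub>0 \<le> ln (real n)" "0 < ln (real n)" "ln (real n) \<le> \<eta> * real (N (Suc n) - N n)" "0 < n"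
        unfolding L by auto
      from tail[OF m(1-3)] m(4)
      show "\<kappa> * real n powr (- \<gamma>) \<le> measure \<Omega> {w\<in>space \<Omega>. y n \<le> walk_sum f (N (Suc n) - N n) x w}"
        by (simp add: y_def powr_def)
    qed
    have upper: "AE w in \<Omega>. \<forall>\<^sub>F n in sequentially. - walk_sum f n x w \<le> (\<sigma> + 1) * sqrt (2 * real n * ln (ln (real n)))"
    proof (rule neg_upper)
      show "sigma2 < (\<sigma> + 1) ^ 2"
        using \<sigma> s by (simp add: power2_eq_square algebra_simps \<sigma>_def add_pos_nonneg)
    qed (use \<sigma> in simp)
    \<comment> \<open>The blocks are normalised by \<open>ln n\<close>, the claim by \<open>ln (ln
      (q ^ n)) = ln (n l)\<close>; these ratios tend to 1.\<close>
    define A where "A n = sqrt (ln (real n * l) / ln (real n))" for n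
    define B where "B n = sqrt (ln (real (Suc n) * l) / ln (real n))" for n
    have AB: "A \<longlonglongrightarrow> 1" "B \<longlonglongrightarrow> 1"
      unfolding A_def B_def using l by real_asymp+
    have "(\<lambda>n. c * sqrt (1 - 1 / real q) - (\<sigma> + 1) / sqrt (real q) * A n - d' * B n)
        \<longlonglongrightarrow> c * sqrt (1 - 1 / real q) - (\<sigma> + 1) / sqrt (real q) * 1 - d' * 1"
      by (intro tendsto_intros AB)
    then have ev_pos: "\<forall>\<^sub>F n in sequentially. 0 < c * sqrt (1 - 1 / real q) - (\<sigma> + 1) / sqrt (real q) * A n - d' * B n"
      using q(1) by (intro order_tendstoD(1)) auto
    have ev_l: "\<forall>\<^sub>F n in sequentially. 1 \<le> real n * l" using l by real_asymp
    have main: "\<forall>\<^sub>F n in sequentially. d' * sqrt (2 * real (N (Suc n)) * ln (ln (real (N (Suc n)))))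
        \<le> y n - (\<sigma> + 1) * sqrt (2 * real (N n) * ln (ln (real (N n))))"
      using ev_pos t2 ev_l
    proof eventually_elim
      case (elim n)
      define R where "R = sqrt (2 * real q ^ Suc n * ln (real n))"
      have lnn: "0 < ln (real n)" by (rule elim(2))
      have llN: "ln (ln (real (N k))) = ln (real k * l)" for k
        by (simp add: N_def l_def ln_realpow)
      have y: "y n = c * (sqrt (1 - 1 / real q) * R)"
      proof -
        have "2 * real (N (Suc n) - N n) * ln (real n) = (1 - 1 / real q) * (2 * real q ^ Suc n * ln (real n))"
          unfolding L using q1 by (simp add: field_simps)
        then show ?thesis unfolding y_def R_def by (simp only: real_sqrt_mult[symmetric])
      qed
      have up: "sqrt (2 * real (N n) * ln (ln (real (N n)))) = A n / sqrt (real q) * R"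
      proof -
        have "2 * real (N n) * ln (real n * l) = ln (real n * l) / ln (real n) / real q * (2 * real q ^ Suc n * ln (real n))"
          using q1 lnn by (simp add: N_def)
        then show ?thesis unfolding llN A_def R_def by (simp only: real_sqrt_mult[symmetric] real_sqrt_divide[symmetric])
      qed
      have tot: "sqrt (2 * real (N (Suc n)) * ln (ln (real (N (Suc n))))) = B n * R"
      proof -
        have "2 * real (N (Suc n)) * ln (real (Suc n) * l) = ln (real (Suc n) * l) / ln (real n) * (2 * real q ^ Suc n * ln (real n))"
          using q1 lnn by (simp add: N_def)
        then show ?thesis unfolding llN B_def R_def by (simp only: real_sqrt_mult[symmetric])
      qed
      have "0 \<le> R" unfolding R_def using lnn by simp
      then have "0 \<le> (c * sqrt (1 - 1 / real q) - (\<sigma> + 1) / sqrt (real q) * A n - d' * B n) * R"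
        using elim(1) by simp
      then show ?case unfolding y up tot by (simp add: algebra_simps)
    qed
    have Ntop: "filterlim N at_top sequentially"
    proof (rule filterlim_subseq)
      show "strict_mono N" using q unfolding N_def by (intro strict_monoI power_strict_increasing) auto
    qed
    have NStop: "filterlim (\<lambda>n. N (Suc n)) at_top sequentially"
      by (rule filterlim_compose[OF Ntop filterlim_Suc])
    show ?thesis
      using large upper
    proof eventually_elim
      case (elim w)
      have "\<forall>\<^sub>F n in sequentially. - walk_sum f (N n) x w \<le> (\<sigma> + 1) * sqrt (2 * real (N n) * ln (ln (real (N n))))"
        by (rule eventually_compose_filterlim[OF elim(2) Ntop])
      then have ev: "\<forall>\<^sub>F n in sequentially. y n \<le> walk_sum f (N (Suc n)) x w - walk_sum f (N n) x w \<longrightarrow>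
        d' * sqrt (2 * real (N (Suc n)) * ln (ln (real (N (Suc n))))) \<le> walk_sum f (N (Suc n)) x w"
        using main by eventually_elim linarith
      have fr: "\<exists>\<^sub>F n in sequentially. d' * sqrt (2 * real (N (Suc n)) * ln (ln (real (N (Suc n))))) \<le> walk_sum f (N (Suc n)) x w"
        by (rule frequently_mp[OF ev elim(1)])
      have fr': "\<exists>\<^sub>F n in sequentially. d' * sqrt (2 * real n * ln (ln (real n))) \<le> walk_sum f n x w"
      proof (rule ccontr)
        assume "\<not> ?thesis"
        then have "\<forall>\<^sub>F n in sequentially. \<not> d' * sqrt (2 * real n * ln (ln (real n))) \<le> walk_sum f n x w"
          by (simp add: frequently_def)
        from eventually_compose_filterlim[OF this NStop] fr show False
          by (simp add: frequently_def)
      qed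
      have "\<forall>\<^sub>F n in sequentially. d' * sqrt (2 * real n * ln (ln (real n))) \<le> walk_sum f n x w \<longrightarrow>
         d * sqrt (2 * real n * ln (ln (real n))) \<le> walk_sum f n x w"
      proof -
        have "\<forall>\<^sub>F n in sequentially. 0 \<le> 2 * real n * ln (ln (real n))" by real_asymp
        then show ?thesis
        proof eventually_elim
          case (elim n)
          then have "d * sqrt (2 * real n * ln (ln (real n))) \<le> d' * sqrt (2 * real n * ln (ln (real n)))"
            using d' by (intro mult_right_mono) auto
          then show ?case by linarith
        qed
      qed
      then show ?case by (rule frequently_mp[OF _ fr'])
    qed
  qed
qed

lemma law_of_iterated_logarithm:
  "AE w in \<Omega>. limsup (\<lambda>n. ereal (walk_sum f n x w / sqrt (2 * real n * ln (ln (real n))))) = ereal (sqrt sigma2)"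
proof -
  let ?X = "\<lambda>w n. ereal (walk_sum f n x w / sqrt (2 * real n * ln (ln (real n))))"
  define \<sigma> where "\<sigma> = sqrt sigma2"
  have \<sigma>0: "0 \<le> \<sigma>" "\<sigma> ^ 2 = sigma2" using sigma2_nonneg by (auto simp: \<sigma>_def)
  have ev: "\<forall>\<^sub>F n in sequentially. 0 < sqrt (2 * real n * ln (ln (real n)))" by real_asymp
  have "AE w in \<Omega>. \<forall>j::nat. \<forall>\<^sub>F n in sequentially.
      walk_sum f n x w \<le> (\<sigma> + 1 / real (Suc j)) * sqrt (2 * real n * ln (ln (real n)))"
    unfolding AE_all_countable
  proof
    fix j :: nat
    have p: "0 < 1 / real (Suc j)" by simp
    show "AE w in \<Omega>. \<forall>\<^sub>F n in sequentially.
      walk_sum f n x w \<le> (\<sigma> + 1 / real (Suc j)) * sqrt (2 * real n * ln (ln (real n)))"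
    proof (rule lil_upper)
      show "0 < \<sigma> + 1 / real (Suc j)" using \<sigma>0(1) p by linarith
      have "\<sigma> ^ 2 < (\<sigma> + 1 / real (Suc j)) ^ 2" using \<sigma>0(1) p by (intro power_strict_mono) auto
      then show "sigma2 < (\<sigma> + 1 / real (Suc j)) ^ 2" using \<sigma>0(2) by simp
    qed
  qed
  moreover have "AE w in \<Omega>. \<forall>j::nat. \<exists>\<^sub>F n in sequentially.
      (\<sigma> - 1 / real (Suc j)) * sqrt (2 * real n * ln (ln (real n))) \<le> walk_sum f n x w"
    unfolding AE_all_countable by (intro allI lil_lower) (simp add: \<sigma>_def)
  ultimately show ?thesis
  proof eventually_elim
    case (elim w)
    have up: "limsup (?X w) \<le> ereal (\<sigma> + 1 / real (Suc j))" for j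
    proof (rule Limsup_bounded)
      from elim(1) have "\<forall>\<^sub>F n in sequentially.
        walk_sum f n x w \<le> (\<sigma> + 1 / real (Suc j)) * sqrt (2 * real n * ln (ln (real n)))" by blast
      then show "\<forall>\<^sub>F n in sequentially. ?X w n \<le> ereal (\<sigma> + 1 / real (Suc j))"
        using ev by eventually_elim (simp add: pos_divide_le_eq)
    qed
    have lo: "ereal (\<sigma> - 1 / real (Suc j)) \<le> limsup (?X w)" for j
    proof (rule ccontr)
      assume "\<not> ereal (\<sigma> - 1 / real (Suc j)) \<le> limsup (?X w)"
      then have "\<forall>\<^sub>F n in sequentially. ?X w n < ereal (\<sigma> - 1 / real (Suc j))"
        by (intro Limsup_lessD) (simp add: not_le)
      then have "\<forall>\<^sub>F n in sequentially. \<not> (\<sigma> - 1 / real (Suc j)) * sqrt (2 * real n * ln (ln (real n))) \<le> walk_sum f n x w"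
        using ev by eventually_elim (simp add: pos_divide_less_eq not_le)
      moreover have "\<exists>\<^sub>F n in sequentially.
        (\<sigma> - 1 / real (Suc j)) * sqrt (2 * real n * ln (ln (real n))) \<le> walk_sum f n x w"
        using elim(2) by blast
      ultimately show False by (simp add: frequently_def)
    qed
    have l0: "(\<lambda>j. 1 / real (Suc j)) \<longlonglongrightarrow> 0" by real_asymp
    have "(\<lambda>j. ereal (\<sigma> + 1 / real (Suc j))) \<longlonglongrightarrow> ereal (\<sigma> + 0)"
      by (intro tendsto_ereal tendsto_intros l0)
    then have "limsup (?X w) \<le> ereal (\<sigma> + 0)" by (rule LIMSEQ_le_const) (use up in auto)
    moreover have "(\<lambda>j. ereal (\<sigma> - 1 / real (Suc j))) \<longlonglongrightarrow> ereal (\<sigma> - 0)"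
      by (intro tendsto_ereal tendsto_intros l0)
    then have "ereal (\<sigma> - 0) \<le> limsup (?X w)" by (rule LIMSEQ_le_const2) (use lo in auto)
    ultimately show ?case by (simp add: \<sigma>_def)
  qed
qed

end

section \<open>The covariance form and the passage to arbitrary probability spaces\<close>

context random_walk
begin

lemma step_avg_pow_linear:
  fixes f g :: "real \<Rightarrow> real"
  assumes "bounded_borel f" "bounded_borel g"
  shows "(step_avg ^^ k) (\<lambda>x. a * f x + b * g x) y = a * (step_avg ^^ k) f y + b * (step_avg ^^ k) g y"
proof (induction k arbitrary: y)
  case (Suc k)
  have "(step_avg ^^ Suc k) (\<lambda>x. a * f x + b * g x) y
      = step_avg (\<lambda>x. a * (step_avg ^^ k) f x + b * (step_avg ^^ k) g x) y"
    unfolding funpow.simps comp_def by (rule step_avg_cong) (rule Suc)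
  also have "\<dots> = a * (step_avg ^^ Suc k) f y + b * (step_avg ^^ Suc k) g y"
    unfolding funpow.simps comp_def
    by (subst step_avg_add) (auto intro!: bb_intros assms simp: step_avg_cmult)
  finally show ?case .
qed simp

end

lemma integral_unif:
  fixes f :: "real \<Rightarrow> real"
  assumes [measurable]: "f \<in> borel_measurable borel"
  shows "(LINT x|unif. f x) = (LINT x|lborel. indicator {0..1} x * f x)"
proof -
  have "unif = density lborel (\<lambda>x. ennreal (indicator {0..<1} x))"
    unfolding uniform_measure_def by (intro density_cong) (auto simp: indicator_def divide_ennreal_def)
  then have "(LINT x|unif. f x) = (LINT x|lborel. indicator {0..<1} x *\<^sub>R f x)"
    by (simp only:) (rule integral_density, auto)
  also have "\<dots> = (LINT x|lborel. indicator {0..1} x * f x)"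
  proof (rule integral_cong_AE)
    show "AE x in lborel. indicator {0..<1} x *\<^sub>R f x = indicator {0..1} x * f x"
      using AE_lborel_singleton[of 1] by eventually_elim (auto simp: indicator_def)
  qed auto
  finally show ?thesis .
qed

definition observable :: "(real \<Rightarrow> real) \<Rightarrow> bool" where
  "observable f \<longleftrightarrow> (\<forall>x. f (x + 1) = f x) \<and> (\<exists>K. unit_variation_le K f) \<and> (LINT x|unif. f x) = 0"

lemma observable_bounded_borel: "observable f \<Longrightarrow> bounded_borel f"
  unfolding observable_def by (blast intro: unit_variation_bounded_borel)

lemma class_F_observable:
  assumes "f \<in> class_F" shows "observable f"
proof -
  have per: "\<And>x. f (x + 1) = f x" and bv: "bounded_variation_on f 0 1" and i: "(f has_integral 0) {0..1}"
    using assms by (auto simp: class_F_def)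
  obtain K where K: "unit_variation_le K f"
    by (rule bounded_variation_imp_unit_variation[of f, OF per bv])
  have bb: "bounded_borel f" by (rule unit_variation_bounded_borel[of f, OF per K])
  note [measurable] = bounded_borel_measurable[OF bb]
  obtain B where B: "\<And>x. norm (f x) \<le> B" using bb unfolding bounded_borel_def by blast
  have "set_integrable lborel {0..1} f"
    unfolding set_integrable_def
  proof (rule Bochner_Integration.integrable_bound)
    show "integrable lborel (\<lambda>x. indicator {0..1::real} x *\<^sub>R B)" by simp
    show "AE x in lborel. norm (indicator {0..1} x *\<^sub>R f x) \<le> norm (indicator {0..1} x *\<^sub>R B)"
      using B order.trans[OF norm_ge_zero B] by (intro AE_I2) (auto simp: indicator_def)
  qed measurable
  from set_borel_integral_eq_integral(2)[OF this]
  have "(LINT x|unif. f x) = integral {0..1} f"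
    by (simp add: integral_unif set_lebesgue_integral_def)
  also have "\<dots> = 0" using i by (rule integral_unique)
  finally show ?thesis unfolding observable_def using per K by blast
qed

text \<open>The line is covered by countably many translates of \<open>[0, 1)\<close>.\<close>

lemma AE_unif_imp_AE_lborel:
  fixes f :: "real \<Rightarrow> real"
  assumes per: "\<And>x. f (x + 1) = f x" and [measurable]: "f \<in> borel_measurable borel"
    and AE: "AE x in unif. f x = 0"
  shows "AE x in lborel. f x = 0"
proof -
  have "AE x in lborel. x \<in> {0..<1} \<longrightarrow> f x = 0"
    using AE by (subst (asm) AE_uniform_measure) auto
  then have AE0: "AE x in distr lborel borel ((+) c). x \<in> {0..<1} \<longrightarrow> f x = 0" for c :: real
    unfolding lborel_distr_plus .
  have "AE x in lborel. c + x \<in> {0..<1} \<longrightarrow> f (c + x) = 0" for c :: real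
    using AE0[of c] by (subst (asm) AE_distr_iff) auto
  then have "AE x in lborel. \<forall>z::int. of_int z + x \<in> {0..<1} \<longrightarrow> f (of_int z + x) = 0"
    by (simp only: AE_all_countable) blast
  then show ?thesis
  proof eventually_elim
    case (elim x)
    have "of_int (- \<lfloor>x\<rfloor>) + x = frac x" by (simp add: frac_def)
    then have "f (frac x) = 0" using elim[rule_format, of "- \<lfloor>x\<rfloor>"] by (simp add: frac_ge_0 frac_lt_1)
    then show ?case using periodic_frac[of f x, OF per] by simp
  qed
qed

lemma AE_lborel_imp_AE_unif: "AE x in lborel. P x \<Longrightarrow> AE x in unif. P x"
  by (intro AE_uniform_measureI) (auto elim: eventually_mono)

context equidistributed_walk
begin

lemma centered_observableI:
  assumes "observable f" obtains K where "centered_observable \<mu> \<psi> f K"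
proof -
  from assms obtain K where "unit_variation_le K f" unfolding observable_def by blast
  then have "centered_observable \<mu> \<psi> f K"
    using assms by unfold_locales (auto simp: observable_def)
  then show ?thesis by (rule that)
qed

text \<open>The value of \<open>E f(U) g(U + S\<^sub>k)\<close>; the lag 0 gives the first term of
  the form.\<close>

definition lag_cov :: "(real \<Rightarrow> real) \<Rightarrow> (real \<Rightarrow> real) \<Rightarrow> nat \<Rightarrow> real" where
  "lag_cov f g k = (LINT x|unif. f x * (step_avg ^^ k) g x)"

definition limit_cov :: "(real \<Rightarrow> real) \<Rightarrow> (real \<Rightarrow> real) \<Rightarrow> real" where
  "limit_cov f g = lag_cov f g 0 + (\<Sum>k. lag_cov f g (Suc k)) + (\<Sum>k. lag_cov g f (Suc k))"

lemma summable_lag_cov: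
  assumes f: "bounded_borel f" and g: "observable g"
  shows "summable (\<lambda>k. \<bar>lag_cov f g (Suc k)\<bar>)"
proof -
  obtain K where "centered_observable \<mu> \<psi> g K" by (rule centered_observableI[OF g])
  then interpret g: centered_observable \<mu> \<psi> g K .
  obtain B where B: "B > 0" "\<And>x. norm (f x) \<le> B" by (rule bounded_borel_bound[OF f]) blast
  show ?thesis
  proof (rule summable_comparison_test'[of "\<lambda>k. B * (3 * K * \<psi> (Suc k))" 0])
    show "summable (\<lambda>k. B * (3 * K * \<psi> (Suc k)))"
      using summable_\<psi> by (intro summable_mult) (simp add: summable_Suc_iff)
    fix k
    have bb: "bounded_borel (\<lambda>x. f x * (step_avg ^^ Suc k) g x)" by (intro bb_intros f g.bounded_borel_f)
    have "\<bar>lag_cov f g (Suc k)\<bar> \<le> (LINT x|unif. \<bar>f x * (step_avg ^^ Suc k) g x\<bar>)"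
      unfolding lag_cov_def by (rule integral_abs_bound)
    also have "\<dots> \<le> (LINT x|unif. B * (3 * K * \<psi> (Suc k)))"
    proof (rule integral_mono)
      show "\<bar>f x * (step_avg ^^ Suc k) g x\<bar> \<le> B * (3 * K * \<psi> (Suc k))" for x
        unfolding abs_mult using B g.step_avg_pow_f_le[of "Suc k" x] by (intro mult_mono) auto
    qed (simp_all add: integrable_abs[OF bounded_borel_unif_integrable[OF bb]] del: funpow.simps)
    also have "\<dots> = B * (3 * K * \<psi> (Suc k))" using unif.prob_space by simp
    finally show "norm \<bar>lag_cov f g (Suc k)\<bar> \<le> B * (3 * K * \<psi> (Suc k))" by simp
  qed
qed

lemma lag_cov_linear_left:
  assumes "bounded_borel f1" "bounded_borel f2" "bounded_borel g"
  shows "lag_cov (\<lambda>x. a * f1 x + b * f2 x) g k = a * lag_cov f1 g k + b * lag_cov f2 g k"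
proof -
  have i: "integrable unif (\<lambda>x. f x * (step_avg ^^ k) g x)" if "bounded_borel f" for f
    using that assms(3) by (intro bounded_borel_unif_integrable bb_intros)
  have "lag_cov (\<lambda>x. a * f1 x + b * f2 x) g k
      = (LINT x|unif. a * (f1 x * (step_avg ^^ k) g x) + b * (f2 x * (step_avg ^^ k) g x))"
    unfolding lag_cov_def by (simp add: algebra_simps)
  also have "\<dots> = a * lag_cov f1 g k + b * lag_cov f2 g k"
    using i[OF assms(1)] i[OF assms(2)] by (simp add: lag_cov_def)
  finally show ?thesis .
qed

lemma lag_cov_linear_right:
  assumes "bounded_borel f1" "bounded_borel f2" "bounded_borel g"
  shows "lag_cov g (\<lambda>x. a * f1 x + b * f2 x) k = a * lag_cov g f1 k + b * lag_cov g f2 k"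
proof -
  have i: "integrable unif (\<lambda>x. g x * (step_avg ^^ k) f x)" if "bounded_borel f" for f
    using that assms(3) by (intro bounded_borel_unif_integrable bb_intros)
  have "lag_cov g (\<lambda>x. a * f1 x + b * f2 x) k
      = (LINT x|unif. a * (g x * (step_avg ^^ k) f1 x) + b * (g x * (step_avg ^^ k) f2 x))"
    unfolding lag_cov_def step_avg_pow_linear[OF assms(1,2)] by (simp add: algebra_simps)
  also have "\<dots> = a * lag_cov g f1 k + b * lag_cov g f2 k"
    using i[OF assms(1)] i[OF assms(2)] by (simp add: lag_cov_def)
  finally show ?thesis .
qed

lemma limit_cov_commute: "limit_cov f g = limit_cov g f"
  by (simp add: limit_cov_def lag_cov_def mult.commute)

lemma limit_cov_linear:
  assumes f1: "observable f1" and f2: "observable f2" and g: "observable g"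
  shows "limit_cov (\<lambda>x. a * f1 x + b * f2 x) g = a * limit_cov f1 g + b * limit_cov f2 g"
proof -
  note bb = f1[THEN observable_bounded_borel] f2[THEN observable_bounded_borel] g[THEN observable_bounded_borel]
  note s = summable_rabs_cancel[OF summable_lag_cov[OF bb(1) g]] summable_rabs_cancel[OF summable_lag_cov[OF bb(2) g]]
    summable_rabs_cancel[OF summable_lag_cov[OF bb(3) f1]] summable_rabs_cancel[OF summable_lag_cov[OF bb(3) f2]]
  have "(\<Sum>k. a * u k + b * v k) = a * suminf u + b * suminf v" if "summable u" "summable v" for u v :: "nat \<Rightarrow> real"
    using that by (simp add: suminf_add[symmetric] suminf_mult[symmetric] summable_mult)
  note sum = this
  show ?thesis
    unfolding limit_cov_def lag_cov_linear_left[OF bb] lag_cov_linear_right[OF bb]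
    unfolding sum[OF s(1,2)] sum[OF s(3,4)] by (simp add: algebra_simps)
qed

end

context centered_observable
begin

lemma limit_cov_eq_sigma2: "limit_cov f f = sigma2"
  unfolding limit_cov_def sigma2_series lag_cov_def by simp

end

lemma char_centered_normal:
  assumes "0 \<le> \<sigma>"
  shows "char (centered_normal \<sigma>) t = of_real (exp (- (\<sigma> ^ 2 * t ^ 2 / 2)))"
proof (cases "\<sigma> = 0")
  case True
  then show ?thesis by (simp add: centered_normal_def char_def integral_return)
next
  case False
  then have \<sigma>: "0 < \<sigma>" using assms by simp
  let ?D = "density lborel (\<lambda>x. ennreal (normal_density 0 \<sigma> x))"
  interpret D: prob_space ?D by (rule prob_space_normal_density[OF \<sigma>])
  have "distributed ?D lborel (\<lambda>x. x) (normal_density 0 \<sigma>)"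
    unfolding distributed_def by (auto simp: distr_id2)
  then have "distributed ?D lborel (\<lambda>x. (x - 0) / \<sigma>) std_normal_density"
    by (subst (asm) D.normal_standard_normal_convert[OF \<sigma>])
  then have std: "distr ?D lborel (\<lambda>x. x / \<sigma>) = std_normal_distribution"
    by (simp add: distributed_def)
  have "char ?D t = (CLINT x|?D. iexp ((\<sigma> * t) * (x / \<sigma>)))"
    unfolding char_def using \<sigma> by (simp add: mult.commute)
  also have "\<dots> = (CLINT x|distr ?D lborel (\<lambda>x. x / \<sigma>). iexp ((\<sigma> * t) * x))"
    by (subst integral_distr) auto
  also have "\<dots> = char std_normal_distribution (\<sigma> * t)" unfolding std char_def ..
  finally show ?thesis
    using False by (simp add: char_std_normal_distribution centered_normal_def power_mult_distrib)
qed

lemma real_distribution_centered_normal: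
  assumes "0 \<le> \<sigma>" shows "real_distribution (centered_normal \<sigma>)"
proof -
  have "prob_space (centered_normal \<sigma>)"
    using assms prob_space_normal_density[of \<sigma> 0] prob_space_return[of 0 borel]
    by (cases "\<sigma> = 0") (auto simp: centered_normal_def)
  then show ?thesis
    by (auto simp: real_distribution_def real_distribution_axioms_def centered_normal_def)
qed

text \<open>Independence of \<open>U\<close> and the sequence, and of the members of the sequence,
  determines the joint law of \<open>U\<close> and the stream of increments. These two have
  different types, so independence is first stated for two restrictions of one family, and the
  product of their laws is then pushed forward.\<close>

lemma iid_path_distr:
  fixes X :: "nat \<Rightarrow> 'a \<Rightarrow> real"
  assumes "prob_space M" and ind: "prob_space.indep_vars M (\<lambda>_. borel) (X(0 := U)) UNIV"
    and id: "\<And>j. j \<ge> 1 \<Longrightarrow> distr M borel (X j) = \<mu>"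
  shows "distr M (borel \<Otimes>\<^sub>M stream_space borel) (\<lambda>\<omega>. (U \<omega>, to_stream (\<lambda>n. X (Suc n) \<omega>)))
    = distr M borel U \<Otimes>\<^sub>M stream_space \<mu>"
    and "distr M (stream_space borel) (\<lambda>\<omega>. to_stream (\<lambda>n. X (Suc n) \<omega>)) = stream_space \<mu>"
    and "U \<in> borel_measurable M" "\<And>j. j \<ge> 1 \<Longrightarrow> X j \<in> borel_measurable M"
proof -
  interpret prob_space M by fact
  define Y where "Y = X(0 := U)"
  have Y: "Y 0 = U" "Y (Suc n) = X (Suc n)" for n by (auto simp: Y_def)
  have indY: "indep_vars (\<lambda>_. borel) Y UNIV" using ind by (simp add: Y_def)
  have mY: "Y n \<in> borel_measurable M" for n using indY by (auto simp: indep_vars_def)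
  show mU: "U \<in> borel_measurable M" using mY[of 0] Y by simp
  show mX: "X j \<in> borel_measurable M" if "j \<ge> 1" for j using mY[of j] Y(2)[of "j - 1"] that by simp
  have mS: "X (Suc n) \<in> borel_measurable M" for n by (rule mX) simp
  have mpath: "(\<lambda>\<omega>. to_stream (\<lambda>n. X (Suc n) \<omega>)) \<in> measurable M (stream_space borel)"
    by (rule measurable_stream_space2) (simp add: to_stream_def mS)
  define A where "A \<omega> = restrict (\<lambda>i. Y i \<omega>) {0}" for \<omega>
  define B where "B \<omega> = restrict (\<lambda>i. Y i \<omega>) {1..}" for \<omega>
  define h where "h g = to_stream (\<lambda>n. g (Suc n))" for g :: "nat \<Rightarrow> real"
  have m0: "(\<lambda>g. g 0) \<in> Pi\<^sub>M {0} (\<lambda>_. borel :: real measure) \<rightarrow>\<^sub>M borel" by simp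
  have mh: "h \<in> Pi\<^sub>M {1..} (\<lambda>_. borel :: real measure) \<rightarrow>\<^sub>M stream_space borel"
    unfolding h_def by (rule measurable_stream_space2) (simp add: to_stream_def)
  have "indep_var (PiM {0} (\<lambda>_. borel)) A (PiM {1..} (\<lambda>_. borel)) B"
    unfolding A_def B_def by (rule indep_var_restrict[OF indY]) auto
  then have mA: "A \<in> M \<rightarrow>\<^sub>M PiM {0} (\<lambda>_. borel)" and mB: "B \<in> M \<rightarrow>\<^sub>M PiM {1..} (\<lambda>_. borel)"
    and AB: "distr M (PiM {0} (\<lambda>_. borel)) A \<Otimes>\<^sub>M distr M (PiM {1..} (\<lambda>_. borel)) B
      = distr M (PiM {0} (\<lambda>_. borel) \<Otimes>\<^sub>M PiM {1..} (\<lambda>_. borel)) (\<lambda>\<omega>. (A \<omega>, B \<omega>))"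
    unfolding indep_var_distribution_eq by auto
  have UA': "U \<omega> = A \<omega> 0" and PB': "to_stream (\<lambda>n. X (Suc n) \<omega>) = h (B \<omega>)" for \<omega>
    by (simp_all add: A_def B_def h_def Y)
  have UA: "U = (\<lambda>g. g 0) \<circ> A" by (simp add: comp_def A_def Y)
  have PB: "(\<lambda>\<omega>. to_stream (\<lambda>n. X (Suc n) \<omega>)) = h \<circ> B"
    by (simp add: comp_def B_def h_def Y)
  have "distr M borel U \<Otimes>\<^sub>M distr M (stream_space borel) (\<lambda>\<omega>. to_stream (\<lambda>n. X (Suc n) \<omega>))
      = distr (distr M (PiM {0} (\<lambda>_. borel)) A) borel (\<lambda>g. g 0)
        \<Otimes>\<^sub>M distr (distr M (PiM {1..} (\<lambda>_. borel)) B) (stream_space borel) h"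
    unfolding UA PB by (simp only: distr_distr[OF m0 mA] distr_distr[OF mh mB])
  also have "\<dots> = distr (distr M (PiM {0} (\<lambda>_. borel)) A \<Otimes>\<^sub>M distr M (PiM {1..} (\<lambda>_. borel)) B)
      (borel \<Otimes>\<^sub>M stream_space borel) (\<lambda>(x, y). (x 0, h y))"
  proof (rule pair_measure_distr)
    show "sigma_finite_measure (distr (distr M (PiM {1..} (\<lambda>_. borel)) B) (stream_space borel) h)"
      using mh mB by (intro prob_space_imp_sigma_finite prob_space.prob_space_distr prob_space_distr) auto
  qed (use m0 mh in auto)
  also have "\<dots> = distr M (borel \<Otimes>\<^sub>M stream_space borel) ((\<lambda>(x, y). (x 0, h y)) \<circ> (\<lambda>\<omega>. (A \<omega>, B \<omega>)))"
    unfolding AB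
  proof (rule distr_distr)
    show "(\<lambda>\<omega>. (A \<omega>, B \<omega>)) \<in> M \<rightarrow>\<^sub>M PiM {0} (\<lambda>_. borel) \<Otimes>\<^sub>M PiM {1..} (\<lambda>_. borel)"
      using mA mB by measurable
    show "(\<lambda>(x, y). (x 0, h y)) \<in> PiM {0} (\<lambda>_. borel :: real measure) \<Otimes>\<^sub>M PiM {1..} (\<lambda>_. borel) \<rightarrow>\<^sub>M borel \<Otimes>\<^sub>M stream_space borel"
      unfolding case_prod_beta
      by (intro measurable_Pair measurable_compose[OF measurable_fst m0] measurable_compose[OF measurable_snd mh])
  qed
  also have "(\<lambda>(x, y). (x 0, h y)) \<circ> (\<lambda>\<omega>. (A \<omega>, B \<omega>)) = (\<lambda>\<omega>. (U \<omega>, to_stream (\<lambda>n. X (Suc n) \<omega>)))"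
    by (rule ext) (simp add: UA' PB')
  finally have 1: "distr M borel U \<Otimes>\<^sub>M distr M (stream_space borel) (\<lambda>\<omega>. to_stream (\<lambda>n. X (Suc n) \<omega>))
      = distr M (borel \<Otimes>\<^sub>M stream_space borel) (\<lambda>\<omega>. (U \<omega>, to_stream (\<lambda>n. X (Suc n) \<omega>)))" .
  have "indep_vars (\<lambda>j. PiM {Suc j} (\<lambda>_. borel)) (\<lambda>j \<omega>. restrict (\<lambda>i. Y i \<omega>) {Suc j}) UNIV"
    by (rule indep_vars_restrict[OF indY]) (auto simp: disjoint_family_on_def)
  from indep_vars_compose2[OF this, of "\<lambda>j g. g (Suc j)" "\<lambda>_. borel"]
  have "indep_vars (\<lambda>_. borel) (\<lambda>j. X (Suc j)) UNIV" by (simp add: Y)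
  then have 2: "distr M (\<Pi>\<^sub>M i\<in>UNIV. borel) (\<lambda>\<omega>. \<lambda>i\<in>UNIV. X (Suc i) \<omega>) = (\<Pi>\<^sub>M i\<in>UNIV. \<mu>)"
    using indep_vars_iff_distr_eq_PiM[where I = UNIV and M' = "\<lambda>_. borel" and X = "\<lambda>j. X (Suc j)"] mS id by simp
  have s\<mu>: "sets \<mu> = sets borel" using id[of 1] by (metis order_refl sets_distr)
  have "stream_space \<mu> = distr (\<Pi>\<^sub>M i\<in>UNIV. \<mu>) (stream_space \<mu>) to_stream"
    by (rule stream_space_eq_distr)
  also have "\<dots> = distr (\<Pi>\<^sub>M i\<in>UNIV. \<mu>) (stream_space borel) to_stream"
    by (intro distr_cong sets_stream_space_cong s\<mu>) auto
  also have "\<dots> = distr M (stream_space borel) (to_stream \<circ> (\<lambda>\<omega>. \<lambda>i\<in>UNIV. X (Suc i) \<omega>))"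
    unfolding 2[symmetric] by (rule distr_distr) (auto intro!: measurable_restrict mS)
  also have "to_stream \<circ> (\<lambda>\<omega>. \<lambda>i\<in>UNIV. X (Suc i) \<omega>) = (\<lambda>\<omega>. to_stream (\<lambda>n. X (Suc n) \<omega>))"
    by (simp add: comp_def restrict_def)
  finally have 3: "stream_space \<mu> = distr M (stream_space borel) (\<lambda>\<omega>. to_stream (\<lambda>n. X (Suc n) \<omega>))" .
  show "distr M (stream_space borel) (\<lambda>\<omega>. to_stream (\<lambda>n. X (Suc n) \<omega>)) = stream_space \<mu>"
    by (rule 3[symmetric])
  show "distr M (borel \<Otimes>\<^sub>M stream_space borel) (\<lambda>\<omega>. (U \<omega>, to_stream (\<lambda>n. X (Suc n) \<omega>)))
    = distr M borel U \<Otimes>\<^sub>M stream_space \<mu>"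
    unfolding 3 using 1 by simp
qed

theorem theorem1:
  fixes M :: "'a measure" and X :: "nat \<Rightarrow> 'a \<Rightarrow> real" and U :: "'a \<Rightarrow> real" and \<delta> :: real
  assumes "prob_space M"
    and "prob_space.indep_vars M (\<lambda>_. borel) (X(0 := U)) UNIV"
    and "\<And>j. j \<ge> 1 \<Longrightarrow> distr M borel (X j) = distr M borel (X 1)"
    and "distr M borel U = uniform_measure lborel {0..<1}"
    and "\<delta> > 0"
    and "bdd_above ((\<lambda>k. real k powr (1 + \<delta>) * discrepancy M X k) ` {1..})"
  shows "(\<forall>f\<in>class_F. \<forall>g\<in>class_F.
            summable (\<lambda>k. \<bar>cross_moment M U X f g (Suc k)\<bar>) \<and>
            summable (\<lambda>k. \<bar>cross_moment M U X g f (Suc k)\<bar>))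
       \<and> (\<forall>f\<^sub>1\<in>class_F. \<forall>f\<^sub>2\<in>class_F. \<forall>g\<in>class_F. \<forall>a b :: real.
            cov_form M U X (\<lambda>x. a * f\<^sub>1 x + b * f\<^sub>2 x) g
              = a * cov_form M U X f\<^sub>1 g + b * cov_form M U X f\<^sub>2 g \<and>
            cov_form M U X g (\<lambda>x. a * f\<^sub>1 x + b * f\<^sub>2 x)
              = a * cov_form M U X g f\<^sub>1 + b * cov_form M U X g f\<^sub>2)
       \<and> (\<forall>f\<in>class_F. \<forall>g\<in>class_F. cov_form M U X f g = cov_form M U X g f)
       \<and> (\<forall>f\<in>class_F. cov_form M U X f f \<ge> 0)
       \<and> (\<forall>f\<in>class_F. cov_form M U X f f = 0 \<longleftrightarrow> (AE x in lborel. f x = 0))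
       \<and> (\<forall>f\<in>class_F.
            weak_conv_m
              (\<lambda>N. distr M borel (\<lambda>\<omega>. (\<Sum>k = 1..N. f (partial_sum X k \<omega>)) / sqrt (real N)))
              (centered_normal (sqrt (cov_form M U X f f))))
       \<and> (\<forall>f\<in>class_F. AE \<omega> in M.
            limsup (\<lambda>N. ereal ((\<Sum>k = 1..N. f (partial_sum X k \<omega>))
                               / sqrt (2 * real N * ln (ln (real N)))))
              = ereal (sqrt (cov_form M U X f f)))"
proof -
  interpret M: prob_space M by fact
  define \<mu> where "\<mu> = distr M borel (X 1)"
  define path where "path \<omega> = to_stream (\<lambda>n. X (Suc n) \<omega>)" for \<omega>
  note iid = iid_path_distr[OF assms(1,2), of \<mu>, unfolded \<mu>_def, OF assms(3), folded \<mu>_def]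
  have mU [measurable]: "U \<in> borel_measurable M" by (rule iid(3)) simp
  have mX: "X j \<in> borel_measurable M" if "j \<ge> 1" for j by (rule iid(4)) (use that in simp_all)
  have mS [measurable]: "X (Suc n) \<in> borel_measurable M" for n by (rule mX) simp
  have "prob_space \<mu>" unfolding \<mu>_def by (rule M.prob_space_distr) (rule mX, simp)
  then interpret W: random_walk \<mu>
    by (simp add: random_walk_def random_walk_axioms_def \<mu>_def)
  have mpath [measurable]: "path \<in> measurable M (stream_space borel)"
    unfolding path_def by (rule measurable_stream_space2) (simp add: to_stream_def mS)
  have joint: "distr M (borel \<Otimes>\<^sub>M stream_space borel) (\<lambda>\<omega>. (U \<omega>, path \<omega>)) = unif \<Otimes>\<^sub>M stream_space \<mu>"
    using iid(1) unfolding assms(4) path_def by simp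
  interpret pair: pair_prob_space unif "stream_space \<mu>" ..
  have pathdistr: "distr M (stream_space borel) path = stream_space \<mu>"
    using iid(2) unfolding path_def .
  have ps: "partial_sum X k \<omega> = walk_pos k 0 (path \<omega>)" for k \<omega>
  proof -
    have "partial_sum X k \<omega> = (\<Sum>i<k. X (Suc i) \<omega>)"
      unfolding partial_sum_def by (simp add: sum.atLeast_Suc_atMost_Suc_shift sum.atLeast1_atMost_eq)
    then show ?thesis by (simp add: walk_pos_eq path_def to_stream_def)
  qed
  have disc: "\<bar>measure M {\<omega> \<in> space M. frac (partial_sum X k \<omega>) \<le> t} - t\<bar> \<le> discrepancy M X k"
    if "0 \<le> t" "t \<le> 1" for k t
    unfolding discrepancy_def
  proof (rule cSUP_upper)
    show "t \<in> {0..1}" using that by simp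
    show "bdd_above ((\<lambda>t. \<bar>measure M {\<omega> \<in> space M. frac (partial_sum X k \<omega>) \<le> t} - t\<bar>) ` {0..1})"
    proof (rule bdd_aboveI2)
      fix t :: real assume "t \<in> {0..1}"
      then show "\<bar>measure M {\<omega> \<in> space M. frac (partial_sum X k \<omega>) \<le> t} - t\<bar> \<le> 1"
        using M.prob_le_1[of "{\<omega> \<in> space M. frac (partial_sum X k \<omega>) \<le> t}"]
          measure_nonneg[of M "{\<omega> \<in> space M. frac (partial_sum X k \<omega>) \<le> t}"]
        unfolding atLeastAtMost_iff abs_le_iff by linarith
    qed
  qed
  have summ: "summable (discrepancy M X)"
  proof -
    obtain C where C: "\<And>k. k \<ge> 1 \<Longrightarrow> real k powr (1 + \<delta>) * discrepancy M X k \<le> C"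
      using assms(6) unfolding bdd_above_def by auto
    have "\<forall>\<^sub>F k in sequentially. norm (discrepancy M X k) \<le> C * real k powr (- (1 + \<delta>))"
      using eventually_ge_at_top[of 1]
    proof eventually_elim
      case (elim k)
      have "0 \<le> discrepancy M X k" by (rule order.trans[OF abs_ge_zero disc[of 0 k]]) simp_all
      have "real k powr (- (1 + \<delta>)) * real k powr (1 + \<delta>) = 1"
        using elim by (simp flip: powr_add)
      then have "discrepancy M X k = real k powr (- (1 + \<delta>)) * (real k powr (1 + \<delta>) * discrepancy M X k)"
        by (simp only: mult.assoc[symmetric] mult_1_left)
      also have "\<dots> \<le> real k powr (- (1 + \<delta>)) * C"
        using C[OF elim] by (intro mult_left_mono) auto
      finally show ?case using \<open>0 \<le> discrepancy M X k\<close> by (simp add: mult.commute)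
    qed
    moreover have "summable (\<lambda>k. C * real k powr (- (1 + \<delta>)))"
      using assms(5) by (intro summable_mult) (simp add: summable_real_powr_iff)
    ultimately show ?thesis by (rule summable_comparison_test_ev)
  qed
  interpret E: equidistributed_walk \<mu> "discrepancy M X"
  proof
    show "summable (discrepancy M X)" by (rule summ)
    fix k and t :: real assume t: "0 \<le> t" "t \<le> 1"
    have ms: "{w. frac (walk_pos k 0 w) \<le> t} \<in> sets (stream_space borel)"
    proof -
      have "{w\<in>space (stream_space \<mu>). frac (walk_pos k 0 w) \<le> t} \<in> sets (stream_space \<mu>)" by measurable
      then show ?thesis by (simp add: W.sets_path)
    qed
    have "measure (stream_space \<mu>) {w\<in>space (stream_space \<mu>). frac (walk_pos k 0 w) \<le> t}
        = measure (distr M (stream_space borel) path) {w. frac (walk_pos k 0 w) \<le> t}"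
      by (simp add: pathdistr)
    also have "\<dots> = measure M (path -` {w. frac (walk_pos k 0 w) \<le> t} \<inter> space M)"
      by (rule measure_distr[OF mpath ms])
    also have "path -` {w. frac (walk_pos k 0 w) \<le> t} \<inter> space M = {\<omega> \<in> space M. frac (partial_sum X k \<omega>) \<le> t}"
      by (auto simp: ps)
    finally show "\<bar>measure (stream_space \<mu>) {w\<in>space (stream_space \<mu>). frac (walk_pos k 0 w) \<le> t} - t\<bar>
        \<le> discrepancy M X k" using disc[OF t] by simp
  qed
  have cross: "cross_moment M U X f g k = E.lag_cov f g k" if f: "bounded_borel f" and g: "bounded_borel g" for f g k
  proof -
    note [measurable] = bounded_borel_measurable[OF f] bounded_borel_measurable[OF g]
    obtain A where A: "A > 0" "\<And>x. norm (f x) \<le> A" by (rule bounded_borel_bound[OF f]) blast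
    obtain B where B: "B > 0" "\<And>x. norm (g x) \<le> B" by (rule bounded_borel_bound[OF g]) blast
    let ?F = "\<lambda>(u, w). f u * g (walk_pos k u w)"
    have mF: "?F \<in> borel_measurable (unif \<Otimes>\<^sub>M stream_space \<mu>)" by measurable
    then have mF': "?F \<in> borel_measurable (borel \<Otimes>\<^sub>M stream_space borel)"
      by (simp cong: measurable_cong_sets add: sets_pair_measure_cong[OF sets_unif W.sets_path, symmetric])
    have int: "integrable (unif \<Otimes>\<^sub>M stream_space \<mu>) ?F"
    proof (rule pair.P.integrable_const_bound[OF _ mF])
      show "AE z in unif \<Otimes>\<^sub>M stream_space \<mu>. norm (?F z) \<le> A * B"
        using A B by (intro AE_I2) (auto simp: abs_mult intro!: mult_mono)
    qed
    have "cross_moment M U X f g k = (LINT \<omega>|M. ?F (U \<omega>, path \<omega>))"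
      unfolding cross_moment_def ps by (simp add: walk_pos_shift[of k "U _"])
    also have "\<dots> = (LINT z|distr M (borel \<Otimes>\<^sub>M stream_space borel) (\<lambda>\<omega>. (U \<omega>, path \<omega>)). ?F z)"
      by (rule integral_distr[symmetric, OF _ mF']) measurable
    also have "\<dots> = (LINT u|unif. (LINT w|stream_space \<mu>. ?F (u, w)))"
      unfolding joint by (rule pair.integral_fst'[OF int, symmetric])
    also have "\<dots> = E.lag_cov f g k"
      unfolding E.lag_cov_def using W.integral_walk_pos[OF g] by simp
    finally show ?thesis .
  qed
  have cov: "cov_form M U X f g = E.limit_cov f g" if f: "bounded_borel f" and g: "bounded_borel g" for f g
  proof -
    note [measurable] = bounded_borel_measurable[OF f] bounded_borel_measurable[OF g]
    have "(LINT \<omega>|M. f (U \<omega>) * g (U \<omega>)) = E.lag_cov f g 0"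
      unfolding E.lag_cov_def assms(4)[symmetric] by (subst integral_distr) auto
    then show ?thesis
      unfolding cov_form_def E.limit_cov_def by (simp only: cross[OF f g] cross[OF g f])
  qed
  note obs = class_F_observable
  note bb = class_F_observable[THEN observable_bounded_borel]
  have sums: "(\<Sum>k = 1..N. f (partial_sum X k \<omega>)) = walk_sum f N 0 (path \<omega>)" for f N \<omega>
    unfolding walk_sum_eq ps ..
  have linear: "cov_form M U X (\<lambda>x. a * f1 x + b * f2 x) g = a * cov_form M U X f1 g + b * cov_form M U X f2 g"
    and linear': "cov_form M U X g (\<lambda>x. a * f1 x + b * f2 x) = a * cov_form M U X g f1 + b * cov_form M U X g f2"
    if "f1 \<in> class_F" "f2 \<in> class_F" "g \<in> class_F" for f1 f2 g a b
  proof -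
    have c: "bounded_borel (\<lambda>x. a * f1 x + b * f2 x)" using that[THEN bb] by (intro bb_intros)
    show "cov_form M U X (\<lambda>x. a * f1 x + b * f2 x) g = a * cov_form M U X f1 g + b * cov_form M U X f2 g"
      using that by (simp add: cov c bb E.limit_cov_linear obs)
    show "cov_form M U X g (\<lambda>x. a * f1 x + b * f2 x) = a * cov_form M U X g f1 + b * cov_form M U X g f2"
      using that by (simp add: cov c bb E.limit_cov_linear obs E.limit_cov_commute[of g])
  qed
  have zero: "cov_form M U X f f = 0" if "f \<in> class_F" "AE x in lborel. f x = 0" for f
  proof -
    have "AE x in unif. f x = 0" using that(2) by (rule AE_lborel_imp_AE_unif)
    then have "E.lag_cov f f k = 0" for k
      unfolding E.lag_cov_def by (intro integral_eq_zero_AE) (auto elim: eventually_mono)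
    then show ?thesis using that(1) by (simp add: cov bb E.limit_cov_def)
  qed
  have single: "cov_form M U X f f \<ge> 0 \<and> (cov_form M U X f f = 0 \<longrightarrow> (AE x in lborel. f x = 0))
    \<and> weak_conv_m (\<lambda>N. distr M borel (\<lambda>\<omega>. (\<Sum>k = 1..N. f (partial_sum X k \<omega>)) / sqrt (real N)))
        (centered_normal (sqrt (cov_form M U X f f)))
    \<and> (AE \<omega> in M. limsup (\<lambda>N. ereal ((\<Sum>k = 1..N. f (partial_sum X k \<omega>)) / sqrt (2 * real N * ln (ln (real N)))))
              = ereal (sqrt (cov_form M U X f f)))"
    if f: "f \<in> class_F" for f
  proof -
    obtain K where "centered_observable \<mu> (discrepancy M X) f K"
      by (rule E.centered_observableI[OF obs[OF f]])
    then interpret F: centered_observable \<mu> "discrepancy M X" f K .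
    have s: "cov_form M U X f f = F.sigma2" using F.limit_cov_eq_sigma2 cov[OF bb bb] f by simp
    have mW: "(\<lambda>w. walk_sum f n 0 w) \<in> borel_measurable (stream_space borel)" for n
    proof -
      have "(\<lambda>w. walk_sum f n 0 w) \<in> borel_measurable (stream_space \<mu>)" by measurable
      then show ?thesis by (simp cong: measurable_cong_sets add: W.sets_path)
    qed
    have mWM [measurable]: "(\<lambda>\<omega>. walk_sum f n 0 (path \<omega>)) \<in> borel_measurable M" for n
      by (rule measurable_compose[OF mpath mW])
    have "weak_conv_m (\<lambda>N. distr M borel (\<lambda>\<omega>. walk_sum f N 0 (path \<omega>) / sqrt (real N)))
        (centered_normal (sqrt F.sigma2))"
    proof (rule levy_continuity)
      show "real_distribution (distr M borel (\<lambda>\<omega>. walk_sum f N 0 (path \<omega>) / sqrt (real N)))" for N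
        by (rule M.real_distribution_distr) measurable
      show "real_distribution (centered_normal (sqrt F.sigma2))"
        using F.sigma2_nonneg by (intro real_distribution_centered_normal) simp
      fix t :: real
      have "char (distr M borel (\<lambda>\<omega>. walk_sum f n 0 (path \<omega>) / sqrt (real n))) t
          = (LINT w|stream_space \<mu>. exp (\<i> * of_real (t / sqrt (real n)) * of_real (walk_sum f n 0 w)))" for n
      proof -
        have "char (distr M borel (\<lambda>\<omega>. walk_sum f n 0 (path \<omega>) / sqrt (real n))) t
          = (LINT \<omega>|M. iexp (t * (walk_sum f n 0 (path \<omega>) / sqrt (real n))))"
          unfolding char_def by (subst integral_distr) auto
        also have "\<dots> = (LINT w|distr M (stream_space borel) path. iexp (t * (walk_sum f n 0 w / sqrt (real n))))"
          using mW by (subst integral_distr) auto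
        finally show ?thesis unfolding pathdistr by (simp add: mult.assoc)
      qed
      then show "(\<lambda>n. char (distr M borel (\<lambda>\<omega>. walk_sum f n 0 (path \<omega>) / sqrt (real n))) t)
          \<longlonglongrightarrow> char (centered_normal (sqrt F.sigma2)) t"
        using F.char_walk_sum_tendsto[of t 0] F.sigma2_nonneg by (simp add: char_centered_normal)
    qed
    moreover have "AE \<omega> in M. limsup (\<lambda>N. ereal (walk_sum f N 0 (path \<omega>) / sqrt (2 * real N * ln (ln (real N)))))
        = ereal (sqrt F.sigma2)"
    proof (rule AE_distrD[OF mpath])
      show "AE w in distr M (stream_space borel) path.
          limsup (\<lambda>N. ereal (walk_sum f N 0 w / sqrt (2 * real N * ln (ln (real N))))) = ereal (sqrt F.sigma2)"
        unfolding pathdistr by (rule F.law_of_iterated_logarithm)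
    qed
    moreover have "AE x in lborel. f x = 0" if "F.sigma2 = 0"
      by (rule AE_unif_imp_AE_lborel[OF F.periodic F.measurable_f F.sigma2_zero_imp_null[OF that]])
    ultimately show ?thesis unfolding s sums using F.sigma2_nonneg by blast
  qed
  show ?thesis
  proof (intro conjI ballI allI)
    fix f g assume fg: "f \<in> class_F" "g \<in> class_F"
    show "summable (\<lambda>k. \<bar>cross_moment M U X f g (Suc k)\<bar>)" "summable (\<lambda>k. \<bar>cross_moment M U X g f (Suc k)\<bar>)"
      using fg by (simp_all only: cross bb E.summable_lag_cov obs)
    show "cov_form M U X f g = cov_form M U X g f"
      using fg by (simp only: cov bb) (rule E.limit_cov_commute)
  qed (use linear linear' zero single in blast)+
qed

end
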